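(* Let $n\in\mathbb{N}$, $p>1$, and let $\mathcal{N}(u)=\pm|u|^p$ (one fixed choice of sign). Assume that for some integer $p_0\in[0,p]$ one has $\mathcal{N}\in C^{p_0}(\mathbb{R})$ and, for some constant $C>0$ and all $l=0,\ldots,p_0$, $$\mathcal{N}^{(l)}(0)=0,\qquad |\mathcal{N}^{(l)}(u)-\mathcal{N}^{(l)}(v)|\le C|u-v|(|u|+|v|)^{p-l-1}\quad (u,v\in\mathbb{R},\ (u,v)\neq(0,0)).$$ Let $s\ge 0$ with $0\le [s]\le p_0$, and if $n=1$ assume also $0\le s<1$. Let $r\in[1,2]$ and assume $$\begin{array}{ll} \min\{1+\frac r2,\,1+\frac rn\}\le p<\infty & \text{if } 1\le n\le 2s,\\[4pt] 1+\frac rn\le p\le \min\{1+\frac{2}{n-2s},\,\frac{2n}{r(n-2s)}\} & \text{if } 2s<n,\ n\ge 2,\\[4pt] 1+\frac r2\le p\le \frac{1}{1-2s} & \text{if } 2s<n,\ n=1, \end{array}$$ and in addition $p<1+\frac{2r}{n}$. Let $\alpha$ satisfy $$n\left(\frac1r-\frac12\right)<\alpha<\frac{2}{p-1}-\frac n2.$$ Let $u_0\in H^{s,0}(\mathbb{R}^n)\cap H^{0,\alpha}(\mathbb{R}^n)$ and $u_1\in H^{s-1,0}(\mathbb{R}^n)\cap H^{0,\alpha}(\mathbb{R}^n)$ fulfil $$\pm(u_0(x)+u_1(x))\ge\begin{cases}|x|^{-\lambda}&\text{if } |x|>1,\\ 0&\text{if } |x|\le1\end{cases}$$ (with the same sign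 as in $\mathcal{N}(u)=\pm|u|^p$) for some $\lambda$ satisfying $\frac n2+\alpha<\lambda<\frac2{p-1}$. Then there exists $\varepsilon_2=\varepsilon_2(n,p,r,s,\alpha,\lambda)>0$ such that for any $\varepsilon\in(0,\varepsilon_2]$ the lifespan $T(\varepsilon)$ of the solution of the Cauchy problem $$\partial_t^2u-\Delta u+\partial_tu=\mathcal{N}(u),\qquad u(0,x)=\varepsilon u_0(x),\quad \partial_tu(0,x)=\varepsilon u_1(x)$$ satisfies $$T(\varepsilon)\le C\varepsilon^{-1/\kappa},$$ where $\kappa=\frac1{p-1}-\frac\lambda2$ and $C$ is a positive constant independent of $\varepsilon\in(0,\varepsilon_2]$.
   Context: All functions are real-valued. $\langle x\rangle=(1+|x|^2)^{1/2}$, $\mathcal{F}f=\hat f$ is the Fourier transform $(2\pi)^{-n/2}\int f(x)e^{-ix\xi}dx$, $\langle\nabla\rangle^sf=\mathcal{F}^{-1}[\langle\xi\rangle^s\hat f]$. $[s]$ is the integer part of $s$. $H^{s,\alpha}(\mathbb{R}^n)$ is the weighted Sobolev space with norm $\|f\|_{H^{s,\alpha}}=\|\langle x\rangle^{\alpha}\langle\nabla\rangle^sf\|_{L^2}$ (the order $s-1$ may be negative). The solution operator of the linear damped wave equation is $\mathcal{D}(t)=e^{-t/2}\mathcal{F}^{-1}L(t,\xi)\mathcal{F}$ with $$L(t,\xi)=\frac{\sinh(t\sqrt{1/4-|\xi|^2})}{\sqrt{1/4-|\xi|^2}}\ (|\xi|<1/2),\qquad L(t,\xi)=\frac{\sin(t\sqrt{|\xi|^2-1/4})}{\sqrt{|\xi|^2-1/4}}\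 (|\xi|>1/2).$$ A function $u\in L^\infty(0,T;L^2(\mathbb{R}^n))$ is a mild solution of the Cauchy problem on $[0,T)$ if $$u(t)=(\partial_t+1)\mathcal{D}(t)\varepsilon u_0+\mathcal{D}(t)\varepsilon u_1+\int_0^t\mathcal{D}(t-\tau)\mathcal{N}(u(\tau))\,d\tau$$ in $L^\infty(0,T;L^2(\mathbb{R}^n))$; a function $u\in C([0,T);H^{s,0}\cap H^{0,\alpha})$ is called a mild solution on $[0,T)$ if this holds on $(0,T')$ for every $T'<T$. The lifespan is $T(\varepsilon):=\sup\{T\in(0,\infty):\text{there exists a mild solution } u\in C([0,T);H^{s,0}(\mathbb{R}^n)\cap H^{0,\alpha}(\mathbb{R}^n))\}$. *)

theory Defs
  imports "HOL-Analysis.Analysis"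
begin

section \<open>Schwartz functions and the Fourier transform\<close>

definition bracket :: "'a::real_normed_vector \<Rightarrow> real" where
  "bracket x = sqrt (1 + (norm x)\<^sup>2)"

fun iterated_partial :: "'a::euclidean_space list \<Rightarrow> ('a \<Rightarrow> complex) \<Rightarrow> 'a \<Rightarrow> complex" where
  "iterated_partial [] \<phi> = \<phi>"
| "iterated_partial (b # bs) \<phi> = (\<lambda>x. frechet_derivative (iterated_partial bs \<phi>) (at x) b)"

definition schwartz :: "('a::euclidean_space \<Rightarrow> complex) set" where
  "schwartz = {\<phi>. \<forall>bs \<in> lists Basis.
      iterated_partial bs \<phi> differentiable_on UNIV \<and>
      (\<forall>k::nat. bounded (range (\<lambda>x. (1 + norm x) ^ k *\<^sub>R iterated_partial bs \<phi> x)))}"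

definition fourier :: "('a::euclidean_space \<Rightarrow> complex) \<Rightarrow> 'a \<Rightarrow> complex" where
  "fourier \<phi> \<xi> = complex_of_real ((2 * pi) powr (- (real DIM('a) / 2))) *
     (LINT x|lborel. \<phi> x * cis (- (x \<bullet> \<xi>)))"

definition fourier_inv :: "('a::euclidean_space \<Rightarrow> complex) \<Rightarrow> 'a \<Rightarrow> complex" where
  "fourier_inv \<phi> x = complex_of_real ((2 * pi) powr (- (real DIM('a) / 2))) *
     (LINT \<xi>|lborel. \<phi> \<xi> * cis (x \<bullet> \<xi>))"

section \<open>Tempered distributions\<close>

text \<open>
  A tempered distribution is represented by its action on test functions; only the values on
  \<^const>\<open>schwartz\<close> matter. The distributions considered below all come from slowly growing
  functions by operations that preserve tempered distributions, so linearity and continuity are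
  not imposed separately. The Fourier transform and the multiplication by a function act by
  transposition.
\<close>

type_synonym 'a dist = "('a \<Rightarrow> complex) \<Rightarrow> complex"

definition slowly_growing :: "('a::euclidean_space \<Rightarrow> 'b::{banach, second_countable_topology}) \<Rightarrow> bool" where
  "slowly_growing f \<longleftrightarrow> f \<in> borel_measurable lborel \<and>
     (\<exists>k::nat. integrable lborel (\<lambda>x. f x /\<^sub>R (1 + norm x) ^ k))"

definition dist_of_cfun :: "('a::euclidean_space \<Rightarrow> complex) \<Rightarrow> 'a dist" where
  "dist_of_cfun g = (\<lambda>\<phi>. LINT x|lborel. g x * \<phi> x)"

definition dist_of :: "('a::euclidean_space \<Rightarrow> real) \<Rightarrow> 'a dist" where
  "dist_of f = dist_of_cfun (\<lambda>x. complex_of_real (f x))"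

definition dist_fourier :: "'a::euclidean_space dist \<Rightarrow> 'a dist" where
  "dist_fourier S = (\<lambda>\<phi>. S (fourier \<phi>))"

definition dist_fourier_inv :: "'a::euclidean_space dist \<Rightarrow> 'a dist" where
  "dist_fourier_inv S = (\<lambda>\<phi>. S (fourier_inv \<phi>))"

definition dist_mult :: "('a::euclidean_space \<Rightarrow> real) \<Rightarrow> 'a dist \<Rightarrow> 'a dist" where
  "dist_mult m S = (\<lambda>\<phi>. S (\<lambda>x. complex_of_real (m x) * \<phi> x))"

section \<open>Weighted Sobolev spaces\<close>

definition square_integrable :: "('a::euclidean_space \<Rightarrow> complex) \<Rightarrow> bool" where
  "square_integrable g \<longleftrightarrow> g \<in> borel_measurable lborel \<and> integrable lborel (\<lambda>x. (cmod (g x))\<^sup>2)"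

definition L2_reps :: "'a::euclidean_space dist \<Rightarrow> ('a \<Rightarrow> complex) set" where
  "L2_reps S = {g. square_integrable g \<and> (\<forall>\<phi>\<in>schwartz. S \<phi> = dist_of_cfun g \<phi>)}"

text \<open>
  The elements of \<open>L2_reps S\<close> agree almost everywhere, so the infimum is the common value of their
  norms; it is infinite when \<open>S\<close> is not in \<open>L\<^sup>2\<close>.
\<close>

definition L2_norm :: "'a::euclidean_space dist \<Rightarrow> ennreal" where
  "L2_norm S = (INF g \<in> L2_reps S. ennreal (sqrt (LINT x|lborel. (cmod (g x))\<^sup>2)))"

definition bessel_potential :: "real \<Rightarrow> 'a::euclidean_space dist \<Rightarrow> 'a dist" where
  "bessel_potential s S = dist_fourier_inv (dist_mult (\<lambda>\<xi>. bracket \<xi> powr s) (dist_fourier S))"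

definition sobolev_norm :: "real \<Rightarrow> real \<Rightarrow> ('a::euclidean_space \<Rightarrow> real) \<Rightarrow> ennreal" where
  "sobolev_norm s \<alpha> f =
     L2_norm (dist_mult (\<lambda>x. bracket x powr \<alpha>) (bessel_potential s (dist_of f)))"

text \<open>
  Those elements of \<open>H\<^bsup>s,\<alpha>\<^esup>\<close> that are functions. For negative \<open>s\<close> the full space also contains
  distributions that are not functions, but any intersection with \<open>H\<^bsup>0,\<alpha>\<^esup>\<close>, \<open>\<alpha> \<ge> 0\<close>, consists of
  \<open>L\<^sup>2\<close> functions.
\<close>

definition sobolev :: "real \<Rightarrow> real \<Rightarrow> ('a::euclidean_space \<Rightarrow> real) set" where
  "sobolev s \<alpha> = {f. slowly_growing f \<and> sobolev_norm s \<alpha> f < \<infinity>}"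

definition sobolev_continuous_on ::
  "real set \<Rightarrow> real \<Rightarrow> real \<Rightarrow> (real \<Rightarrow> 'a::euclidean_space \<Rightarrow> real) \<Rightarrow> bool" where
  "sobolev_continuous_on I s \<alpha> u \<longleftrightarrow> (\<forall>t\<in>I. u t \<in> sobolev s \<alpha> \<and>
     ((\<lambda>t'. sobolev_norm s \<alpha> (\<lambda>x. u t' x - u t x)) \<longlongrightarrow> 0) (at t within I))"

section \<open>The linear damped wave equation\<close>

text \<open>On the null set \<open>|\<xi>| = 1/2\<close> the symbol is given its continuous extension \<open>t\<close>.\<close>

definition damped_symbol :: "real \<Rightarrow> 'a::euclidean_space \<Rightarrow> real" where
  "damped_symbol t \<xi> =
     (if norm \<xi> < 1/2 then sinh (t * sqrt (1/4 - (norm \<xi>)\<^sup>2)) / sqrt (1/4 - (norm \<xi>)\<^sup>2)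
      else if norm \<xi> > 1/2 then sin (t * sqrt ((norm \<xi>)\<^sup>2 - 1/4)) / sqrt ((norm \<xi>)\<^sup>2 - 1/4)
      else t)"

definition damped :: "real \<Rightarrow> 'a::euclidean_space dist \<Rightarrow> 'a dist" where
  "damped t S = (\<lambda>\<phi>. complex_of_real (exp (- t / 2)) *
     dist_fourier_inv (dist_mult (damped_symbol t) (dist_fourier S)) \<phi>)"

definition dt_damped :: "real \<Rightarrow> 'a::euclidean_space dist \<Rightarrow> 'a dist" where
  "dt_damped t S = (\<lambda>\<phi>. vector_derivative (\<lambda>t'. damped t' S \<phi>) (at t))"

section \<open>Mild solutions and lifespan\<close>

text \<open>
  Since \<open>L\<^sup>2\<close> is separable and Schwartz functions are dense in it, Pettis' theorem identifies strong
  measurability of an \<open>L\<^sup>2\<close>-valued map with measurability of its pairings with Schwartz functions.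
\<close>

definition L2_strongly_measurable :: "real set \<Rightarrow> (real \<Rightarrow> 'a::euclidean_space dist) \<Rightarrow> bool" where
  "L2_strongly_measurable I F \<longleftrightarrow> (AE t in lborel. t \<in> I \<longrightarrow> L2_norm (F t) < \<infinity>) \<and>
     (\<forall>\<phi>\<in>schwartz. set_borel_measurable lborel I (\<lambda>t. F t \<phi>))"

definition L2_bochner_integrable :: "real set \<Rightarrow> (real \<Rightarrow> 'a::euclidean_space dist) \<Rightarrow> bool" where
  "L2_bochner_integrable I F \<longleftrightarrow> L2_strongly_measurable I F \<and>
     (\<integral>\<^sup>+ t\<in>I. L2_norm (F t) \<partial>lborel) < \<infinity>"

definition Linf_L2 :: "real set \<Rightarrow> (real \<Rightarrow> 'a::euclidean_space dist) \<Rightarrow> bool" where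
  "Linf_L2 I F \<longleftrightarrow> L2_strongly_measurable I F \<and>
     (\<exists>M::real. AE t in lborel. t \<in> I \<longrightarrow> L2_norm (F t) \<le> ennreal M)"

definition duhamel_integrand ::
  "(real \<Rightarrow> real) \<Rightarrow> (real \<Rightarrow> 'a::euclidean_space \<Rightarrow> real) \<Rightarrow> real \<Rightarrow> real \<Rightarrow> 'a dist" where
  "duhamel_integrand N u t \<tau> = damped (t - \<tau>) (dist_of (\<lambda>x. N (u \<tau> x)))"

text \<open>
  \<open>v\<^sub>0\<close> and \<open>v\<^sub>1\<close> are the complete initial data, including the factor \<open>\<epsilon>\<close>. The Duhamel term is a
  Bochner integral in \<open>L\<^sup>2\<close>, evaluated by pairing it with test functions.
\<close>

definition mild_solution_Linf ::
  "(real \<Rightarrow> real) \<Rightarrow> ('a::euclidean_space \<Rightarrow> real) \<Rightarrow> ('a \<Rightarrow> real) \<Rightarrow> real \<Rightarrow> (real \<Rightarrow> 'a \<Rightarrow> real) \<Rightarrow> bool"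
  where
  "mild_solution_Linf N v\<^sub>0 v\<^sub>1 T u \<longleftrightarrow>
     (AE t in lborel. t \<in> {0<..<T} \<longrightarrow> slowly_growing (u t)) \<and>
     Linf_L2 {0<..<T} (\<lambda>t. dist_of (u t)) \<and>
     (AE t in lborel. t \<in> {0<..<T} \<longrightarrow>
        (AE \<tau> in lborel. \<tau> \<in> {0<..<t} \<longrightarrow> slowly_growing (\<lambda>x. N (u \<tau> x))) \<and>
        L2_bochner_integrable {0<..<t} (duhamel_integrand N u t) \<and>
        (\<forall>\<phi>\<in>schwartz. dist_of (u t) \<phi> =
           dt_damped t (dist_of v\<^sub>0) \<phi> + damped t (dist_of v\<^sub>0) \<phi> + damped t (dist_of v\<^sub>1) \<phi>
           + (LINT \<tau>:{0<..<t}|lborel. duhamel_integrand N u t \<tau> \<phi>)))"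

definition mild_solution ::
  "(real \<Rightarrow> real) \<Rightarrow> real \<Rightarrow> real \<Rightarrow> ('a::euclidean_space \<Rightarrow> real) \<Rightarrow> ('a \<Rightarrow> real) \<Rightarrow> real \<Rightarrow>
   (real \<Rightarrow> 'a \<Rightarrow> real) \<Rightarrow> bool" where
  "mild_solution N s \<alpha> v\<^sub>0 v\<^sub>1 T u \<longleftrightarrow>
     sobolev_continuous_on {0..<T} s 0 u \<and> sobolev_continuous_on {0..<T} 0 \<alpha> u \<and>
     (\<forall>T'. 0 < T' \<and> T' < T \<longrightarrow> mild_solution_Linf N v\<^sub>0 v\<^sub>1 T' u)"

definition lifespan ::
  "(real \<Rightarrow> real) \<Rightarrow> real \<Rightarrow> real \<Rightarrow> ('a::euclidean_space \<Rightarrow> real) \<Rightarrow> ('a \<Rightarrow> real) \<Rightarrow> ennreal" where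
  "lifespan N s \<alpha> v\<^sub>0 v\<^sub>1 = (SUP T \<in> {T. 0 < T \<and> (\<exists>u. mild_solution N s \<alpha> v\<^sub>0 v\<^sub>1 T u)}. ennreal T)"

section \<open>The nonlinearity\<close>

definition C_k :: "nat \<Rightarrow> (real \<Rightarrow> real) \<Rightarrow> bool" where
  "C_k k N \<longleftrightarrow> (\<forall>l<k. (deriv ^^ l) N differentiable_on UNIV) \<and> continuous_on UNIV ((deriv ^^ k) N)"

definition admissible_nonlinearity :: "real \<Rightarrow> nat \<Rightarrow> (real \<Rightarrow> real) \<Rightarrow> bool" where
  "admissible_nonlinearity p p\<^sub>0 N \<longleftrightarrow> C_k p\<^sub>0 N \<and>
     (\<exists>C>0. \<forall>l\<le>p\<^sub>0. (deriv ^^ l) N 0 = 0 \<and>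
        (\<forall>u v. (u, v) \<noteq> (0, 0) \<longrightarrow>
           \<bar>(deriv ^^ l) N u - (deriv ^^ l) N v\<bar> \<le> C * \<bar>u - v\<bar> * (\<bar>u\<bar> + \<bar>v\<bar>) powr (p - real l - 1)))"

end

theory Submission
  imports Defs "HOL-Probability.Distributions" "HOL-Complex_Analysis.Complex_Analysis"
    "HOL-Real_Asymp.Real_Asymp"
begin

text \<open>
  Test the equation with \<open>\<psi>(t, x) = \<eta>(t) gauss(x)\<close>, where \<open>\<eta>(t) = (1 - t\<^sup>2/T\<^sup>2)\<^sup>m\<close> and the Gaussian has width
  of order \<open>\<surd>T\<close>. Because \<open>\<eta>'(0) = 0\<close>, this gives
  \<open>\<integral>\<integral> \<bar>u\<bar>\<^sup>p \<psi> + \<epsilon> \<integral> \<sigma> (u\<^sub>0 + u\<^sub>1) \<psi>(0) \<le> \<integral>\<integral> \<bar>u\<bar> \<bar>\<psi>\<^sub>t\<^sub>t - \<psi>\<^sub>t - \<Delta>\<psi>\<bar>\<close>, and Young's inequality absorbs \<open>\<bar>u\<bar>\<^sup>p \<psi>\<close> and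
  leaves \<open>\<epsilon> T\<^bsup>(n - \<lambda>)/2\<^esup> \<le> C T\<^bsup>1 + n/2 - p/(p - 1)\<^esup>\<close>, that is \<open>T\<^sup>\<kappa> \<le> C/\<epsilon>\<close>.

  The solution operator acts on a Gaussian through the series
  \<open>\<Sum>\<^sub>k t\<^bsup>2k+1\<^esup>/(2k+1)! (1/4 + \<Delta>)\<^sup>k gauss\<close>; Cauchy's formula in the (complex) width shows that its terms are bounded by
  \<open>k!\<close> times a wider Gaussian, so every pairing is an entire function of time that solves the damped wave
  equation.

  The double integral of \<open>\<bar>u\<bar>\<^sup>p\<close> must be known to be finite beforehand. No Sobolev embedding is needed for that: the Duhamel
  integrand at one fixed later time is integrable in \<open>L\<^sup>2\<close>, and paired with a wide Gaussian it controls
  \<open>\<integral> \<bar>u\<bar>\<^sup>p gauss\<close> up to an error that is absorbed by passing to wider and wider Gaussians.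
\<close>

section \<open>Gaussians as test functions\<close>

text \<open>Gaussians replace the usual compactly supported test functions because the solution
  operator is given only through Fourier integrals of the test function; for a Gaussian these are
  explicit. Expanding the symbol in powers of \<open>1/4 - |\<xi>|^2\<close> turns it into powers of
  \<open>1/4 + \<Delta>\<close> on the Gaussian, so that the equation in time becomes an identity
  between power series.

  The main obstacle is Fubini. The tested Duhamel term is a double integral in (\<tau>, t) that has
  to be evaluated in both orders, whereas the definition of a mild solution gives measurability in
  \<tau> only for almost every fixed t, and no bound on the integral of |u|^p. Joint measurability
  and absolute integrability are therefore established separately.

  Origin of the constants: a Cauchy circle of radius a/2 about the width a yields the majorant
  \<open>gauss (9 * a / 2)\<close> and the factor (4/a)^k k!. From a = 16 on, (4/a)^j is at most
  (16/a) (1/4)^j for j > 0, so all Laplacians together are a perturbation of relative size 1/a of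
  multiplication by (1/4)^k.\<close>

lemma power_le_exp_square:
  fixes r \<delta> :: real
  assumes "0 \<le> r" "0 < \<delta>"
  shows "(1 + r) ^ k \<le> exp (real k ^ 2 / (4 * \<delta>)) * exp (\<delta> * r\<^sup>2)"
proof -
  have "(1 + r) ^ k \<le> exp r ^ k"
    using assms by (intro power_mono exp_ge_add_one_self) auto
  also have "\<dots> = exp (real k * r)" by (simp add: exp_of_nat_mult)
  also have "real k * r \<le> real k ^ 2 / (4 * \<delta>) + \<delta> * r\<^sup>2"
  proof -
    have "0 \<le> (real k - 2 * \<delta> * r)\<^sup>2 / (4 * \<delta>)" using assms by simp
    also have "\<dots> = real k ^ 2 / (4 * \<delta>) + \<delta> * r\<^sup>2 - real k * r"
      using assms by (simp add: power2_eq_square field_simps)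
    finally show ?thesis by simp
  qed
  hence "exp (real k * r) \<le> exp (real k ^ 2 / (4 * \<delta>) + \<delta> * r\<^sup>2)" by simp
  finally show ?thesis by (simp add: exp_add)
qed

definition gauss :: "real \<Rightarrow> 'a::euclidean_space \<Rightarrow> real" where
  "gauss a x = exp (- (norm x)\<^sup>2 / (2 * a))"

lemma gauss_pos [simp]: "gauss a x > 0"
  by (simp add: gauss_def)

lemma gauss_nonneg [simp]: "gauss a x \<ge> 0"
  by (simp add: gauss_def)

lemma gauss_le_1: "a > 0 \<Longrightarrow> gauss a x \<le> 1"
  by (simp add: gauss_def)

lemma gauss_mono: "0 < a \<Longrightarrow> a \<le> b \<Longrightarrow> gauss a x \<le> gauss b x"
  unfolding gauss_def by (simp add: frac_le)

lemma continuous_gauss [continuous_intros]: "continuous_on S (gauss a)"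
  unfolding gauss_def by (cases "a = 0") (auto intro!: continuous_intros)

lemma gauss_measurable [measurable]: "gauss a \<in> borel_measurable borel"
  by (intro borel_measurable_continuous_onI continuous_gauss)

text \<open>Half of the exponent pays for the polynomial weight. The other half survives as a
  Gaussian of doubled width, so the weighted product is still integrable.\<close>

lemma gauss_decay:
  fixes x :: "'a::euclidean_space"
  assumes "0 < a"
  shows "(1 + norm x) ^ k * gauss a x \<le> exp (real k ^ 2 * a)" 
    and "(1 + norm x) ^ k * gauss a x \<le> exp (real k ^ 2 * a) * gauss (2 * a) x"
proof -
  have "(1 + norm x) ^ k \<le> exp (real k ^ 2 / (4 * (1 / (4 * a)))) * exp (1 / (4 * a) * (norm x)\<^sup>2)"
    using assms by (intro power_le_exp_square) auto
  also have "\<dots> = exp (real k ^ 2 * a) * exp ((norm x)\<^sup>2 / (4 * a))" by simp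
  finally have "(1 + norm x) ^ k * gauss a x \<le> exp (real k ^ 2 * a) * exp ((norm x)\<^sup>2 / (4 * a)) * gauss a x"
    by (intro mult_right_mono) auto
  also have "\<dots> = exp (real k ^ 2 * a) * gauss (2 * a) x"
    using assms unfolding gauss_def by (simp add: field_simps flip: exp_add)
  finally show 2: "(1 + norm x) ^ k * gauss a x \<le> exp (real k ^ 2 * a) * gauss (2 * a) x" .
  also have "\<dots> \<le> exp (real k ^ 2 * a) * 1"
    using assms by (intro mult_left_mono gauss_le_1) auto
  finally show "(1 + norm x) ^ k * gauss a x \<le> exp (real k ^ 2 * a)" by simp
qed

lemma has_derivative_gauss:
  assumes "a \<noteq> 0"
  shows "(gauss a has_derivative (\<lambda>h. - (x \<bullet> h) / a * gauss a x)) (at x)"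
  unfolding gauss_def using assms
  by (auto intro!: derivative_eq_intros simp: power2_norm_eq_inner inner_commute field_simps)

lemma real_polynomial_function_has_derivative:
  assumes "real_polynomial_function P"
  shows "\<exists>D. (\<forall>x. (P has_derivative D x) (at x)) \<and> (\<forall>b. real_polynomial_function (\<lambda>x. D x b))"
  using assms
proof induction
  case (linear f)
  then show ?case
    by (intro exI[of _ "\<lambda>x. f"]) (auto intro: bounded_linear_imp_has_derivative)
next
  case (const c)
  then show ?case by (intro exI[of _ "\<lambda>x h. 0"]) auto
next
  case (add f g)
  then obtain D E where "\<forall>x. (f has_derivative D x) (at x)" "\<forall>b. real_polynomial_function (\<lambda>x. D x b)"
    "\<forall>x. (g has_derivative E x) (at x)" "\<forall>b. real_polynomial_function (\<lambda>x. E x b)" by blast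
  then show ?case
    by (intro exI[of _ "\<lambda>x h. D x h + E x h"]) (auto intro!: derivative_intros)
next
  case (mult f g)
  then obtain D E where "\<forall>x. (f has_derivative D x) (at x)" "\<forall>b. real_polynomial_function (\<lambda>x. D x b)"
    "\<forall>x. (g has_derivative E x) (at x)" "\<forall>b. real_polynomial_function (\<lambda>x. E x b)" by blast
  then show ?case using mult.hyps
    by (intro exI[of _ "\<lambda>x h. f x * E x h + D x h * g x"])
      (simp add: has_derivative_mult real_polynomial_function.intros(3,4))
qed

lemma real_polynomial_function_growth:
  assumes "real_polynomial_function P"
  shows "\<exists>C k. C \<ge> 0 \<and> (\<forall>x. \<bar>P x\<bar> \<le> C * (1 + norm x) ^ k)"
  using assms
proof induction
  case (linear f)
  then obtain K where "K \<ge> 0" "\<And>x. norm (f x) \<le> norm x * K"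
    by (meson bounded_linear.nonneg_bounded)
  then have "\<bar>f x\<bar> \<le> K * (1 + norm x) ^ 1" for x
    by (smt (verit, best) mult.commute mult_left_mono norm_ge_zero power_one_right real_norm_def)
  with \<open>K \<ge> 0\<close> show ?case by blast
next
  case (const c)
  show ?case by (intro exI[of _ "\<bar>c\<bar>"] exI[of _ 0]) auto
next
  case (add f g)
  then obtain C k D l where *: "C \<ge> 0" "\<forall>x. \<bar>f x\<bar> \<le> C * (1 + norm x) ^ k"
      "D \<ge> 0" "\<forall>x. \<bar>g x\<bar> \<le> D * (1 + norm x) ^ l" by blast
  have "\<bar>f x + g x\<bar> \<le> (C + D) * (1 + norm x) ^ (k + l)" for x
  proof -
    have "\<bar>f x + g x\<bar> \<le> C * (1 + norm x) ^ k + D * (1 + norm x) ^ l"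
      using * by (smt (verit))
    also have "\<dots> \<le> C * (1 + norm x) ^ (k + l) + D * (1 + norm x) ^ (k + l)"
      using * by (intro add_mono mult_left_mono power_increasing) auto
    finally show ?thesis by (simp add: algebra_simps)
  qed
  with * show ?case by (meson add_nonneg_nonneg)
next
  case (mult f g)
  then obtain C k D l where *: "C \<ge> 0" "\<forall>x. \<bar>f x\<bar> \<le> C * (1 + norm x) ^ k"
      "D \<ge> 0" "\<forall>x. \<bar>g x\<bar> \<le> D * (1 + norm x) ^ l" by blast
  have "\<bar>f x * g x\<bar> \<le> (C * D) * (1 + norm x) ^ (k + l)" for x
  proof -
    have "\<bar>f x * g x\<bar> \<le> (C * (1 + norm x) ^ k) * (D * (1 + norm x) ^ l)"
      unfolding abs_mult using * by (intro mult_mono) auto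
    then show ?thesis by (simp add: power_add mult_ac)
  qed
  with * show ?case by (meson mult_nonneg_nonneg)
qed

lemma real_polynomial_function_continuous:
  "real_polynomial_function P \<Longrightarrow> continuous_on S P"
  by (simp add: continuous_on_polymonial_function real_polynomial_function_eq)

text \<open>Polynomials times a fixed Gaussian form a class closed under partial derivatives. The
  induction over lists of directions in the definition of \<open>schwartz\<close> therefore never
  leaves it.\<close>

lemma has_derivative_poly_gauss:
  fixes P :: "'a::euclidean_space \<Rightarrow> real"
  assumes "real_polynomial_function P" "a > 0"
  obtains D where "\<And>x. ((\<lambda>x. complex_of_real (P x * gauss a x)) has_derivative D x) (at x)"
    and "\<And>b. \<exists>Q. real_polynomial_function Q \<and> (\<forall>x. D x b = complex_of_real (Q x * gauss a x))"
proof -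
  obtain E where E: "\<And>x. (P has_derivative E x) (at x)" "\<And>b. real_polynomial_function (\<lambda>x. E x b)"
    using real_polynomial_function_has_derivative[OF assms(1)] by blast
  show ?thesis
  proof (rule that)
    show "((\<lambda>x. complex_of_real (P x * gauss a x)) has_derivative
        (\<lambda>h. complex_of_real (P x * (- (x \<bullet> h) / a * gauss a x) + E x h * gauss a x))) (at x)" for x
      using assms by (intro has_derivative_of_real has_derivative_mult E has_derivative_gauss) auto
    have "real_polynomial_function (\<lambda>x. P x * (- (x \<bullet> b) / a) + E x b)" for b
      by (rule real_polynomial_function.intros(3)[OF real_polynomial_function.intros(4)[OF assms(1)] E(2)])
        (intro real_polynomial_function_divide real_polynomial_function_minus
          real_polynomial_function.intros(1) bounded_linear_inner_left)
    then show "\<exists>Q. real_polynomial_function Q \<and>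
       (\<forall>x. complex_of_real (P x * (- (x \<bullet> b) / a * gauss a x) + E x b * gauss a x) = complex_of_real (Q x * gauss a x))" for b
      by (rule_tac exI[of _ "\<lambda>x. P x * (- (x \<bullet> b) / a) + E x b"]) (simp add: algebra_simps)
  qed
qed

lemma iterated_partial_poly_gauss:
  fixes P :: "'a::euclidean_space \<Rightarrow> real"
  assumes "real_polynomial_function P" "a > 0"
  shows "\<exists>Q. real_polynomial_function Q \<and>
    iterated_partial bs (\<lambda>x. complex_of_real (P x * gauss a x)) = (\<lambda>x. complex_of_real (Q x * gauss a x))"
proof (induction bs)
  case Nil
  show ?case using assms by auto
next
  case (Cons b bs)
  then obtain Q where Q: "real_polynomial_function Q"
    "iterated_partial bs (\<lambda>x. complex_of_real (P x * gauss a x)) = (\<lambda>x. complex_of_real (Q x * gauss a x))"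
    by blast
  obtain D where D: "\<And>x. ((\<lambda>x. complex_of_real (Q x * gauss a x)) has_derivative D x) (at x)"
    "\<And>b. \<exists>Q'. real_polynomial_function Q' \<and> (\<forall>x. D x b = complex_of_real (Q' x * gauss a x))"
    using has_derivative_poly_gauss[OF Q(1) assms(2)] by blast
  have "frechet_derivative (\<lambda>x. complex_of_real (Q x * gauss a x)) (at x) = D x" for x
    using D(1) by (metis frechet_derivative_at)
  moreover obtain Q' where "real_polynomial_function Q'" "\<And>x. D x b = complex_of_real (Q' x * gauss a x)"
    using D(2)[of b] by blast
  ultimately show ?case by (intro exI[of _ Q']) (simp only: iterated_partial.simps Q(2))
qed

lemma poly_gauss_schwartz:
  fixes P :: "'a::euclidean_space \<Rightarrow> real"
  assumes "real_polynomial_function P" "a > 0"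
  shows "(\<lambda>x. complex_of_real (P x * gauss a x)) \<in> schwartz"
  unfolding schwartz_def mem_Collect_eq
proof (intro ballI conjI allI)
  fix bs :: "'a list" and k :: nat
  obtain Q where Q: "real_polynomial_function Q"
    and eq: "iterated_partial bs (\<lambda>x. complex_of_real (P x * gauss a x)) = (\<lambda>x. complex_of_real (Q x * gauss a x))"
    using iterated_partial_poly_gauss[OF assms] by blast
  obtain D where "\<And>x. ((\<lambda>x. complex_of_real (Q x * gauss a x)) has_derivative D x) (at x)"
      "\<And>b. \<exists>R. real_polynomial_function R \<and> (\<forall>x. D x b = complex_of_real (R x * gauss a x))"
    by (rule has_derivative_poly_gauss[OF Q assms(2)], rule that)
  then show "iterated_partial bs (\<lambda>x. complex_of_real (P x * gauss a x)) differentiable_on UNIV"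
    unfolding eq differentiable_on_def differentiable_def by auto
  obtain C l where C: "C \<ge> 0" "\<And>x. \<bar>Q x\<bar> \<le> C * (1 + norm x) ^ l"
    using real_polynomial_function_growth[OF Q] by blast
  have "norm ((1 + norm x) ^ k *\<^sub>R complex_of_real (Q x * gauss a x)) \<le> C * exp (real (k + l) ^ 2 * a)" for x
  proof -
    have "norm ((1 + norm x) ^ k *\<^sub>R complex_of_real (Q x * gauss a x)) = (1 + norm x) ^ k * (\<bar>Q x\<bar> * gauss a x)"
      by (simp add: norm_mult)
    also have "\<dots> \<le> (1 + norm x) ^ k * ((C * (1 + norm x) ^ l) * gauss a x)"
      by (intro mult_left_mono mult_right_mono C) auto
    also have "\<dots> = C * ((1 + norm x) ^ (k + l) * gauss a x)" by (simp add: power_add mult_ac)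
    also have "\<dots> \<le> C * exp (real (k + l) ^ 2 * a)"
      by (intro mult_left_mono gauss_decay C assms)
    finally show ?thesis .
  qed
  then show "bounded (range (\<lambda>x. (1 + norm x) ^ k *\<^sub>R
      iterated_partial bs (\<lambda>x. complex_of_real (P x * gauss a x)) x))"
    unfolding eq bounded_iff by blast
qed

lemma gauss_schwartz: "a > 0 \<Longrightarrow> (\<lambda>x. complex_of_real (gauss a x)) \<in> schwartz"
  using poly_gauss_schwartz[of "\<lambda>x. 1" a] by auto

text \<open>The formula is -\<Delta> applied to \<open>gauss a\<close>, written out. That it acts as
  -\<Delta> enters only through its inverse Fourier transform, computed in
  \<open>fourier_inv_neg_lap_gauss\<close>.\<close>

definition neg_lap_gauss :: "real \<Rightarrow> 'a::euclidean_space \<Rightarrow> real" where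
  "neg_lap_gauss a x = (real DIM('a) / a - (norm x)\<^sup>2 / a\<^sup>2) * gauss a x"

lemma real_polynomial_function_norm_square:
  "real_polynomial_function (\<lambda>x::'a::euclidean_space. (norm x)\<^sup>2)"
proof -
  have "(\<lambda>x::'a. (norm x)\<^sup>2) = (\<lambda>x. \<Sum>b\<in>Basis. (x \<bullet> b) * (x \<bullet> b))"
    by (auto simp: power2_norm_eq_inner intro: euclidean_inner)
  then show ?thesis
    by (simp only:) (intro real_polynomial_function_sum finite_Basis real_polynomial_function.intros(4)
        real_polynomial_function.intros(1)[OF bounded_linear_inner_left])
qed

lemma neg_lap_gauss_schwartz:
  "a > 0 \<Longrightarrow> (\<lambda>x. complex_of_real (neg_lap_gauss a x)) \<in> schwartz"
  unfolding neg_lap_gauss_def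
  by (intro poly_gauss_schwartz real_polynomial_function_diff real_polynomial_function_divide
      real_polynomial_function_norm_square) auto

section \<open>Fourier transforms of Gaussians\<close>

lemma has_vector_derivative_iff_quotient:
  fixes f :: "real \<Rightarrow> 'a::real_normed_vector"
  shows "(f has_vector_derivative D) (at x) \<longleftrightarrow> ((\<lambda>y. (f y - f x) /\<^sub>R (y - x)) \<longlongrightarrow> D) (at x)"
proof -
  have "norm (f y - f x - (y - x) *\<^sub>R D) / norm (y - x) = norm ((f y - f x) /\<^sub>R (y - x) - D)" if "y \<noteq> x" for y
  proof -
    have "(f y - f x) /\<^sub>R (y - x) - D = (f y - f x - (y - x) *\<^sub>R D) /\<^sub>R (y - x)"
      using that by (simp add: scaleR_diff_right)
    then show ?thesis by (simp add: divide_inverse mult.commute)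
  qed
  then have "((\<lambda>y. norm (f y - f x - (y - x) *\<^sub>R D) / norm (y - x)) \<longlongrightarrow> 0) (at x) \<longleftrightarrow>
      ((\<lambda>y. norm ((f y - f x) /\<^sub>R (y - x) - D)) \<longlongrightarrow> 0) (at x)"
    by (intro tendsto_cong) (auto simp: eventually_at_filter)
  also have "\<dots> \<longleftrightarrow> ((\<lambda>y. (f y - f x) /\<^sub>R (y - x)) \<longlongrightarrow> D) (at x)"
    by (simp add: tendsto_norm_zero_iff LIM_zero_iff)
  finally show ?thesis
    by (simp add: has_vector_derivative_def has_derivative_iff_norm bounded_linear_scaleR_left)
qed

text \<open>The mean value inequality makes g a majorant of the difference quotients, and dominated
  convergence along sequences does the rest. The derivative is measurable as a limit of measurable
  quotients.\<close>

lemma has_vector_derivative_lebesgue_integral: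
  fixes f :: "real \<Rightarrow> 'b \<Rightarrow> 'c::{banach, second_countable_topology}"
  assumes "e > 0"
    and int: "\<And>x. x \<in> ball x0 e \<Longrightarrow> integrable M (f x)"
    and der: "\<And>x s. x \<in> ball x0 e \<Longrightarrow> ((\<lambda>x. f x s) has_vector_derivative f' x s) (at x)"
    and bound: "\<And>x s. x \<in> ball x0 e \<Longrightarrow> norm (f' x s) \<le> g s"
    and g: "integrable M g"
  shows "((\<lambda>x. integral\<^sup>L M (f x)) has_vector_derivative integral\<^sup>L M (f' x0)) (at x0)"
    and "integrable M (f' x0)"
proof -
  have lip: "norm (f x s - f x0 s) \<le> g s * \<bar>x - x0\<bar>" if "x \<in> ball x0 e" for x s
  proof -
    have "norm (f x s - f x0 s) \<le> g s * norm (x - x0)"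
    proof (rule differentiable_bound[where S="ball x0 e" and f'="\<lambda>x h. h *\<^sub>R f' x s"])
      show "((\<lambda>x. f x s) has_derivative (\<lambda>h. h *\<^sub>R f' y s)) (at y within ball x0 e)" if "y \<in> ball x0 e" for y
        using der[OF that] by (simp add: has_vector_derivative_def has_derivative_at_withinI)
      show "onorm (\<lambda>h. h *\<^sub>R f' y s) \<le> g s" if "y \<in> ball x0 e" for y
        using bound[OF that, of s] onorm_le
        by (smt (verit) mult.commute mult_right_mono norm_ge_zero norm_scaleR onorm_le real_norm_def)
    qed (use that assms in auto)
    then show ?thesis by simp
  qed
  have x0: "x0 \<in> ball x0 e" using assms by simp
  have *: "((\<lambda>n. integral\<^sup>L M (\<lambda>s. (f (X n) s - f x0 s) /\<^sub>R (X n - x0))) \<longlongrightarrow> integral\<^sup>L M (f' x0)) sequentially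
     \<and> integrable M (f' x0)"
    if X: "\<And>n. X n \<in> ball x0 e" "\<And>n. X n \<noteq> x0" "X \<longlonglongrightarrow> x0" for X
  proof -
    have lim: "(\<lambda>n. (f (X n) s - f x0 s) /\<^sub>R (X n - x0)) \<longlonglongrightarrow> f' x0 s" for s
    proof -
      have "((\<lambda>x. (f x s - f x0 s) /\<^sub>R (x - x0)) \<longlongrightarrow> f' x0 s) (at x0)"
        using der[OF x0, of s] by (simp add: has_vector_derivative_iff_quotient)
      then show ?thesis
        using X unfolding tendsto_at_iff_sequentially by (auto simp: o_def)
    qed
    have meas: "(\<lambda>s. (f (X n) s - f x0 s) /\<^sub>R (X n - x0)) \<in> borel_measurable M" for n
      using int[OF X(1)[of n]] int[OF x0] by measurable
    have f'meas: "f' x0 \<in> borel_measurable M"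
      by (rule borel_measurable_LIMSEQ_metric[OF meas lim])
    have bd: "norm ((f (X n) s - f x0 s) /\<^sub>R (X n - x0)) \<le> g s" for n s
      using lip[OF X(1)[of n], of s] X(2)[of n]
      by (simp add: divide_simps mult.commute abs_minus_commute split: if_splits)
    have "(\<lambda>n. integral\<^sup>L M (\<lambda>s. (f (X n) s - f x0 s) /\<^sub>R (X n - x0))) \<longlonglongrightarrow> integral\<^sup>L M (f' x0)"
      by (rule integral_dominated_convergence[where w=g]) (use f'meas meas g lim bd in auto)
    moreover have "integrable M (f' x0)"
      by (rule Bochner_Integration.integrable_bound[OF g f'meas]) (use bound[OF x0] in \<open>auto intro!: AE_I2 intro: order_trans[OF _ abs_ge_self]\<close>)
    ultimately show ?thesis by blast
  qed
  \<comment> \<open>Integrability of the derivative needs one concrete sequence in the punctured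
    ball; the summand 2 keeps every term at distance at most e/2.\<close>
  have "(\<lambda>n. x0 + e / (real n + 2)) \<longlonglongrightarrow> x0" by real_asymp
  then show "integrable M (f' x0)"
    using *[of "\<lambda>n. x0 + e / (real n + 2)"] \<open>e > 0\<close> by (auto simp: dist_real_def divide_simps)
  have "((\<lambda>x. (integral\<^sup>L M (f x) - integral\<^sup>L M (f x0)) /\<^sub>R (x - x0)) \<longlongrightarrow> integral\<^sup>L M (f' x0)) (at x0)"
  proof -
    have "((\<lambda>x. (integral\<^sup>L M (f x) - integral\<^sup>L M (f x0)) /\<^sub>R (x - x0)) \<longlongrightarrow> integral\<^sup>L M (f' x0)) (at x0 within ball x0 e)"
      unfolding tendsto_at_iff_sequentially
    proof (intro allI impI)
      fix X assume X: "\<forall>n. X n \<in> ball x0 e - {x0}" "X \<longlonglongrightarrow> x0"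
      have "integral\<^sup>L M (\<lambda>s. (f (X n) s - f x0 s) /\<^sub>R (X n - x0)) = (integral\<^sup>L M (f (X n)) - integral\<^sup>L M (f x0)) /\<^sub>R (X n - x0)" for n
        using X int x0 by (subst integral_scaleR_right) (auto simp: Bochner_Integration.integral_diff)
      then show "((\<lambda>x. (integral\<^sup>L M (f x) - integral\<^sup>L M (f x0)) /\<^sub>R (x - x0)) \<circ> X) \<longlonglongrightarrow> integral\<^sup>L M (f' x0)"
        using *[of X] X by (auto simp: o_def)
    qed
    then show ?thesis by (simp only: at_within_open[OF x0 open_ball])
  qed
  then show "((\<lambda>x. integral\<^sup>L M (f x)) has_vector_derivative integral\<^sup>L M (f' x0)) (at x0)"
    by (simp add: has_vector_derivative_iff_quotient)
qed

section \<open>Product integrals and Gaussian integrals of complex width\<close>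

lemma
  fixes f :: "'a::euclidean_space \<Rightarrow> real \<Rightarrow> complex"
  assumes "\<And>b. b \<in> Basis \<Longrightarrow> integrable lborel (f b)"
  shows integrable_lborel_prod: "integrable lborel (\<lambda>x::'a. \<Prod>b\<in>Basis. f b (x \<bullet> b))"
    and integral_lborel_prod: "(LINT x|lborel. (\<Prod>b\<in>Basis. f b (x \<bullet> b))) = (\<Prod>b\<in>Basis. integral\<^sup>L lborel (f b))"
proof -
  interpret product_sigma_finite "\<lambda>_::'a. lborel :: real measure" ..
  have [measurable]: "b \<in> Basis \<Longrightarrow> f b \<in> borel_measurable borel" for b
    using assms borel_measurable_integrable by fastforce
  have eq: "(\<Prod>b\<in>Basis. f b ((\<Sum>b\<in>Basis. g b *\<^sub>R b) \<bullet> b)) = (\<Prod>b\<in>Basis. f b (g b))" for g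
    by (intro prod.cong refl) simp
  show "integrable lborel (\<lambda>x::'a. \<Prod>b\<in>Basis. f b (x \<bullet> b))"
    unfolding lborel_eq[where 'a='a]
    by (subst integrable_distr_eq) (auto simp: eq intro!: product_integrable_prod assms)
  show "(LINT x|lborel. (\<Prod>b\<in>Basis. f b (x \<bullet> b))) = (\<Prod>b\<in>Basis. integral\<^sup>L lborel (f b))"
    unfolding lborel_eq[where 'a='a]
    by (subst integral_distr) (auto simp: eq intro!: product_integral_prod assms)
qed

lemma
  fixes a :: real
  assumes "a > 0"
  shows integrable_gauss1: "integrable lborel (\<lambda>s::real. exp (- a * s\<^sup>2 / 2))"
    and integral_gauss1: "(LINT s|lborel. exp (- a * s\<^sup>2 / 2)) = sqrt (2 * pi / a)"
    and integrable_abs_gauss1: "integrable lborel (\<lambda>s::real. \<bar>s\<bar> * exp (- a * s\<^sup>2 / 2))"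
proof -
  define \<sigma> where "\<sigma> = 1 / sqrt a"
  have \<sigma>: "\<sigma> > 0" "\<sigma>\<^sup>2 = 1 / a" using assms by (auto simp: \<sigma>_def power_divide)
  have eq: "exp (- a * s\<^sup>2 / 2) = sqrt (2 * pi / a) * normal_density 0 \<sigma> s" for s
    using assms by (simp add: normal_density_def \<sigma> field_simps)
  show "integrable lborel (\<lambda>s::real. exp (- a * s\<^sup>2 / 2))"
    unfolding eq using \<sigma> by (intro integrable_mult_right integrable_normal_density)
  show "(LINT s|lborel. exp (- a * s\<^sup>2 / 2)) = sqrt (2 * pi / a)"
    unfolding eq using \<sigma> by simp
  have "integrable lborel (\<lambda>s. sqrt (2 * pi / a) * (normal_density 0 \<sigma> s * \<bar>s - 0\<bar> ^ 1))"
    using \<sigma> by (intro integrable_mult_right integrable_normal_moment_abs)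
  then show "integrable lborel (\<lambda>s::real. \<bar>s\<bar> * exp (- a * s\<^sup>2 / 2))"
    unfolding eq by (simp add: mult_ac)
qed

text \<open>Its value is the principal branch of sqrt (2 pi / z). It stays unevaluated for complex
  z, since a bound on its modulus and its values at positive reals suffice; this avoids any
  discussion of branches.\<close>

definition cgauss_integral :: "complex \<Rightarrow> complex" where
  "cgauss_integral z = (LINT s::real|lborel. exp (- z * of_real (s\<^sup>2) / 2))"

lemma norm_exp_quadratic:
  fixes s y :: real
  shows "norm (exp (- z * of_real (s\<^sup>2) / 2 - \<i> * of_real (s * y))) = exp (- Re z * s\<^sup>2 / 2)"
  by (simp add: norm_exp_eq_Re)

lemma integrable_cgauss1:
  assumes "Re z > 0"
  shows "integrable lborel (\<lambda>s::real. exp (- z * of_real (s\<^sup>2) / 2 - \<i> * of_real (s * y)))"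
    and "integrable lborel (\<lambda>s::real. of_real s * exp (- z * of_real (s\<^sup>2) / 2 - \<i> * of_real (s * y)))"
proof -
  have m: "(\<lambda>s::real. exp (- z * of_real (s\<^sup>2) / 2 - \<i> * of_real (s * y))) \<in> borel_measurable lborel"
    unfolding measurable_lborel2 by (intro borel_measurable_continuous_onI continuous_intros) auto
  show "integrable lborel (\<lambda>s::real. exp (- z * of_real (s\<^sup>2) / 2 - \<i> * of_real (s * y)))"
    by (rule Bochner_Integration.integrable_bound[OF integrable_gauss1[OF assms] m])
      (simp add: norm_exp_quadratic del: of_real_mult)
  show "integrable lborel (\<lambda>s::real. of_real s * exp (- z * of_real (s\<^sup>2) / 2 - \<i> * of_real (s * y)))"
    by (rule Bochner_Integration.integrable_bound[OF integrable_abs_gauss1[OF assms]])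
      (use m in measurable, simp add: norm_exp_quadratic norm_mult del: of_real_mult)
qed

lemma norm_cgauss_integral_le:
  assumes "Re z > 0"
  shows "norm (cgauss_integral z) \<le> sqrt (2 * pi / Re z)"
proof -
  have "norm (cgauss_integral z) \<le> (LINT s|lborel. norm (exp (- z * complex_of_real (s\<^sup>2) / 2)))"
    unfolding cgauss_integral_def by (rule integral_norm_bound)
  also have "\<dots> = sqrt (2 * pi / Re z)"
    unfolding integral_gauss1[OF assms, symmetric]
    using norm_exp_quadratic[of z _ 0] by (intro Bochner_Integration.integral_cong) auto
  finally show ?thesis .
qed

lemma cgauss_integral_of_real:
  assumes "a > 0"
  shows "cgauss_integral (of_real a) = of_real (sqrt (2 * pi / a))"
proof -
  have "cgauss_integral (of_real a) = (LINT s|lborel. complex_of_real (exp (- a * s\<^sup>2 / 2)))"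
    unfolding cgauss_integral_def
    by (intro Bochner_Integration.integral_cong refl) (simp flip: exp_of_real)
  then show ?thesis using assms by (simp only: integral_complex_of_real integral_gauss1)
qed

text \<open>As a function of \<open>y\<close>, the left-hand side solves \<open>f' = - (y / z) f\<close>.\<close>

lemma cgauss1_transform:
  assumes "Re z > 0"
  shows "(LINT s::real|lborel. exp (- z * of_real (s\<^sup>2) / 2 - \<i> * of_real (s * y))) =
    cgauss_integral z * exp (- of_real (y\<^sup>2) / (2 * z))"
proof -
  have z: "z \<noteq> 0" using assms by auto
  define E where "E = (\<lambda>y s :: real. exp (- z * of_real (s\<^sup>2) / 2 - \<i> * of_real (s * y)))"
  define f where "f = (\<lambda>y. integral\<^sup>L lborel (E y))"
  have intE: "integrable lborel (E y)" "integrable lborel (\<lambda>s. of_real s * E y s)" for y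
    unfolding E_def using integrable_cgauss1[OF assms] by blast+
  have f': "(f has_vector_derivative (LINT s|lborel. - \<i> * of_real s * E y s)) (at y)" for y
    unfolding f_def
  proof (rule has_vector_derivative_lebesgue_integral[where e = 1 and g = "\<lambda>s. \<bar>s\<bar> * exp (- Re z * s\<^sup>2 / 2)"])
    show "((\<lambda>y. E y s) has_vector_derivative - \<i> * of_real s * E x s) (at x)" for x s
    proof -
      have "((\<lambda>w. exp (- z * of_real (s\<^sup>2) / 2 - \<i> * (of_real s * w))) has_field_derivative - \<i> * of_real s * E x s) (at (of_real x))"
        unfolding E_def by (auto intro!: derivative_eq_intros)
      from has_vector_derivative_real_field[OF this] show ?thesis by (simp add: E_def)
    qed
    show "norm (- \<i> * of_real s * E x s) \<le> \<bar>s\<bar> * exp (- Re z * s\<^sup>2 / 2)" for x s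
      unfolding E_def norm_mult norm_exp_quadratic by simp
  qed (use intE integrable_abs_gauss1[OF assms] in auto)
  \<comment> \<open>The integrand is the derivative of \<open>E y\<close>, which vanishes at both
    ends of the line. This expresses the first moment, and hence f', through f.\<close>
  have parts: "(LINT s|lborel. (- z * of_real s - \<i> * of_real y) * E y s) = 0" for y
  proof -
    have lim: "((E y) \<longlongrightarrow> 0) F" if "filterlim (\<lambda>s::real. s\<^sup>2) at_top F" for F
    proof (rule tendsto_norm_zero_cancel)
      have "((\<lambda>s. exp (- (Re z / 2 * s\<^sup>2))) \<longlongrightarrow> 0) F"
        using that assms
        by (intro filterlim_compose[OF exp_at_bot] filterlim_compose[OF filterlim_uminus_at_bot_at_top]
            filterlim_tendsto_pos_mult_at_top[OF tendsto_const]) auto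
      then show "((\<lambda>s. norm (E y s)) \<longlongrightarrow> 0) F"
        unfolding E_def norm_exp_quadratic by simp
    qed
    have "(LBINT s=-\<infinity>..\<infinity>. (- z * of_real s - \<i> * of_real y) * E y s) = 0 - 0"
    proof (rule interval_integral_FTC_integrable[where F = "E y"])
      show "(E y has_vector_derivative (- z * of_real s - \<i> * of_real y) * E y s) (at s)" for s
      proof -
        have "((\<lambda>w. exp (- z * w\<^sup>2 / 2 - \<i> * (w * of_real y))) has_field_derivative (- z * of_real s - \<i> * of_real y) * E y s) (at (of_real s))"
          unfolding E_def by (auto intro!: derivative_eq_intros simp: algebra_simps)
        from has_vector_derivative_real_field[OF this] show ?thesis by (simp add: E_def)
      qed
      show "isCont (\<lambda>s. (- z * of_real s - \<i> * of_real y) * E y s) s" for s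
        unfolding E_def by (intro continuous_intros) auto
      show "set_integrable lborel (einterval (-\<infinity>) \<infinity>) (\<lambda>s. (- z * of_real s - \<i> * of_real y) * E y s)"
        using intE[of y] by (simp add: set_integrable_def algebra_simps)
      have "filterlim (\<lambda>s::real. s\<^sup>2) at_top at_bot" by real_asymp
      then show "(((E y) \<circ> real_of_ereal) \<longlongrightarrow> 0) (at_right (-\<infinity>))"
        using lim by (simp add: ereal_tendsto_simps)
      have "filterlim (\<lambda>s::real. s\<^sup>2) at_top at_top" by real_asymp
      then show "(((E y) \<circ> real_of_ereal) \<longlongrightarrow> 0) (at_left \<infinity>)"
        using lim by (simp add: ereal_tendsto_simps)
    qed auto
    then show ?thesis by (simp add: interval_lebesgue_integral_def set_lebesgue_integral_def)
  qed
  have ode: "(f has_vector_derivative - (of_real y / z) * f y) (at y)" for y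
  proof -
    have "0 = (LINT s|lborel. - z * (of_real s * E y s) - \<i> * of_real y * E y s)"
      using parts[of y] by (simp add: algebra_simps)
    also have "\<dots> = - z * (LINT s|lborel. of_real s * E y s) - \<i> * of_real y * f y"
      unfolding f_def using intE[of y]
      by (subst Bochner_Integration.integral_diff) auto
    finally have "(LINT s|lborel. of_real s * E y s) = - \<i> * of_real y * f y / z"
      using z by (simp add: field_simps)
    then have "(LINT s|lborel. - \<i> * of_real s * E y s) = - (of_real y / z) * f y"
      using intE(2)[of y] by (simp add: mult.assoc)
    with f'[of y] show ?thesis by simp
  qed
  \<comment> \<open>Multiplying by the reciprocal of the expected solution turns the differential
    equation into constancy; the constant is read off at y = 0.\<close>
  have "((\<lambda>y. f y * exp (of_real (y\<^sup>2) / (2 * z))) has_vector_derivative 0) (at y)" for y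
  proof -
    have "((\<lambda>y::real. exp (of_real (y\<^sup>2) / (2 * z))) has_vector_derivative
        (of_real y / z) * exp (of_real (y\<^sup>2) / (2 * z))) (at y)"
    proof -
      have "((\<lambda>w. exp (w\<^sup>2 / (2 * z))) has_field_derivative (of_real y / z) * exp (of_real (y\<^sup>2) / (2 * z))) (at (of_real y))"
        using z by (auto intro!: derivative_eq_intros)
      from has_vector_derivative_real_field[OF this] show ?thesis by simp
    qed
    from has_vector_derivative_mult[OF ode this] show ?thesis by (simp add: algebra_simps)
  qed
  then have "((\<lambda>y. f y * exp (of_real (y\<^sup>2) / (2 * z))) has_vector_derivative 0) (at y within UNIV)" for y
    by simp
  from has_vector_derivative_zero_constant[OF convex_UNIV this]
  obtain c where c: "\<And>y. f y * exp (of_real (y\<^sup>2) / (2 * z)) = c" by (metis UNIV_I)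
  have "f y * exp (of_real (y\<^sup>2) / (2 * z)) = f 0 * exp (of_real (0\<^sup>2) / (2 * z))"
    unfolding c ..
  then have "f y = f 0 * exp (- of_real (y\<^sup>2) / (2 * z))"
    by (simp add: exp_minus field_simps)
  then show ?thesis by (simp add: f_def E_def cgauss_integral_def)
qed

lemma cgauss_transform:
  fixes x :: "'a::euclidean_space"
  assumes "Re z > 0"
  shows "integrable lborel (\<lambda>\<xi>. exp (- z * of_real ((norm \<xi>)\<^sup>2) / 2) * cis (- (\<xi> \<bullet> x)))" (is ?int)
    and "(LINT \<xi>|lborel. exp (- z * of_real ((norm \<xi>)\<^sup>2) / 2) * cis (- (\<xi> \<bullet> x))) =
      cgauss_integral z ^ DIM('a) * exp (- of_real ((norm x)\<^sup>2) / (2 * z))" (is ?eq)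
proof -
  define f where "f = (\<lambda>b s :: real. exp (- z * of_real (s\<^sup>2) / 2 - \<i> * of_real (s * (x \<bullet> (b::'a)))))"
  have n: "(norm \<xi>)\<^sup>2 = (\<Sum>b\<in>Basis. (\<xi> \<bullet> b)\<^sup>2)" for \<xi> :: 'a
    unfolding power2_norm_eq_inner by (subst euclidean_inner) (simp add: power2_eq_square)
  have i: "\<xi> \<bullet> x = (\<Sum>b\<in>Basis. (\<xi> \<bullet> b) * (x \<bullet> b))" for \<xi> :: 'a
    by (rule euclidean_inner)
  have eq: "exp (- z * of_real ((norm \<xi>)\<^sup>2) / 2) * cis (- (\<xi> \<bullet> x)) = (\<Prod>b\<in>Basis. f b (\<xi> \<bullet> b))" for \<xi> :: 'a
    unfolding cis_conv_exp exp_add[symmetric] f_def exp_sum[OF finite_Basis, symmetric] n i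
    by (simp add: sum_subtractf sum_distrib_left sum_divide_distrib)
  have int: "integrable lborel (f b)" for b
    unfolding f_def by (rule integrable_cgauss1[OF assms])
  show ?int unfolding eq by (intro integrable_lborel_prod int)
  have "(LINT \<xi>|lborel. exp (- z * of_real ((norm \<xi>)\<^sup>2) / 2) * cis (- (\<xi> \<bullet> x))) = (\<Prod>b\<in>Basis. integral\<^sup>L lborel (f b))"
    unfolding eq by (intro integral_lborel_prod int)
  also have "\<dots> = (\<Prod>b\<in>Basis. cgauss_integral z * exp (- of_real ((x \<bullet> b)\<^sup>2) / (2 * z)))"
    unfolding f_def cgauss1_transform[OF assms] ..
  also have "\<dots> = cgauss_integral z ^ DIM('a) * exp (- of_real ((norm x)\<^sup>2) / (2 * z))"
    unfolding prod.distrib exp_sum[OF finite_Basis, symmetric] n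
    by (simp add: sum_negf sum_divide_distrib)
  finally show ?eq .
qed

lemma
  assumes "a > 0"
  shows integrable_gauss: "integrable lborel (gauss a :: 'a::euclidean_space \<Rightarrow> real)"
    and integral_gauss: "integral\<^sup>L lborel (gauss a :: 'a \<Rightarrow> real) = sqrt (2 * pi * a) ^ DIM('a)"
proof -
  have a: "Re (of_real (1 / a)) > 0" using assms by simp
  have eq: "exp (- of_real (1 / a) * of_real ((norm \<xi>)\<^sup>2) / 2) * cis (- (\<xi> \<bullet> 0)) = complex_of_real (gauss a \<xi>)" for \<xi> :: 'a
    by (simp add: gauss_def mult.commute[of 2] flip: exp_of_real)
  have "integrable lborel (\<lambda>\<xi>::'a. complex_of_real (gauss a \<xi>))"
    using cgauss_transform(1)[OF a, of "0::'a"] unfolding eq .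
  from integrable_Re[OF this] show "integrable lborel (gauss a :: 'a \<Rightarrow> real)" by simp
  have "complex_of_real (integral\<^sup>L lborel (gauss a :: 'a \<Rightarrow> real)) = of_real (sqrt (2 * pi * a) ^ DIM('a))"
    using cgauss_transform(2)[OF a, of "0::'a"] assms unfolding eq integral_complex_of_real
    by (subst (asm) cgauss_integral_of_real) auto
  then show "integral\<^sup>L lborel (gauss a :: 'a \<Rightarrow> real) = sqrt (2 * pi * a) ^ DIM('a)"
    by (simp only: of_real_eq_iff)
qed

lemma two_pi_powr: "(2 * pi) powr (- (real n / 2)) = inverse (sqrt (2 * pi) ^ n)"
proof -
  have "(2 * pi) powr (- (real n / 2)) = inverse ((2 * pi) powr (1 / 2 * real n))"
    by (simp add: powr_minus)
  also have "(2 * pi) powr (1 / 2 * real n) = ((2 * pi) powr (1 / 2)) powr real n"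
    by (simp only: powr_powr)
  also have "\<dots> = sqrt (2 * pi) ^ n"
    by (simp add: powr_realpow powr_half_sqrt)
  finally show ?thesis .
qed

definition gauss_hat :: "real \<Rightarrow> 'a::euclidean_space \<Rightarrow> real" where
  "gauss_hat a \<xi> = sqrt a ^ DIM('a) * exp (- a * (norm \<xi>)\<^sup>2 / 2)"

lemma gauss_inverse_transform:
  fixes \<xi> :: "'a::euclidean_space"
  assumes "a > 0"
  shows "integrable lborel (\<lambda>x. complex_of_real (gauss a x) * cis (\<xi> \<bullet> x))"
    and "(LINT x|lborel. complex_of_real (gauss a x) * cis (\<xi> \<bullet> x)) = of_real (sqrt (2 * pi) ^ DIM('a) * gauss_hat a \<xi>)"
proof -
  have a: "Re (of_real (1 / a)) > 0" using assms by simp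
  have eq: "exp (- of_real (1 / a) * of_real ((norm x)\<^sup>2) / 2) * cis (- (x \<bullet> - \<xi>)) = complex_of_real (gauss a x) * cis (\<xi> \<bullet> x)" for x :: 'a
    by (simp add: gauss_def inner_commute mult.commute[of 2] flip: exp_of_real)
  show "integrable lborel (\<lambda>x. complex_of_real (gauss a x) * cis (\<xi> \<bullet> x))"
    using cgauss_transform(1)[OF a, of "-\<xi>"] unfolding eq .
  show "(LINT x|lborel. complex_of_real (gauss a x) * cis (\<xi> \<bullet> x)) = of_real (sqrt (2 * pi) ^ DIM('a) * gauss_hat a \<xi>)"
    using cgauss_transform(2)[OF a, of "-\<xi>"] assms unfolding eq
    by (subst (asm) cgauss_integral_of_real)
      (auto simp: gauss_hat_def real_sqrt_mult power_mult_distrib mult_ac simp flip: exp_of_real)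
qed

lemma fourier_inv_gauss:
  assumes "a > 0"
  shows "fourier_inv (\<lambda>x. complex_of_real (gauss a x)) \<xi> = of_real (gauss_hat a \<xi>)"
  unfolding fourier_inv_def two_pi_powr gauss_inverse_transform[OF assms] by simp

lemma fourier_gauss_hat:
  assumes "a > 0"
  shows "fourier (\<lambda>\<xi>. complex_of_real (gauss_hat a \<xi>)) x = of_real (gauss a x)"
proof -
  have a: "Re (of_real a) > 0" using assms by simp
  have "(LINT \<xi>|lborel. complex_of_real (gauss_hat a \<xi>) * cis (- (\<xi> \<bullet> x))) =
    (LINT \<xi>|lborel. of_real (sqrt a ^ DIM('a)) * (exp (- of_real a * of_real ((norm \<xi>)\<^sup>2) / 2) * cis (- (\<xi> \<bullet> x))))"
    by (intro Bochner_Integration.integral_cong) (auto simp: gauss_hat_def simp flip: exp_of_real)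
  also have "\<dots> = of_real (sqrt a ^ DIM('a)) * (of_real (sqrt (2 * pi / a)) ^ DIM('a) * of_real (gauss a x))"
    using assms by (simp only: integral_mult_right_zero cgauss_transform(2)[OF a] cgauss_integral_of_real)
       (simp add: gauss_def mult.commute[of 2] flip: exp_of_real)
  also have "\<dots> = of_real (sqrt (2 * pi) ^ DIM('a) * gauss a x)"
    using assms by (simp add: real_sqrt_divide power_divide real_sqrt_mult)
  finally show ?thesis unfolding fourier_def two_pi_powr by simp
qed

text \<open>Differentiating \<open>gauss b x\<close> in the width b produces the factor |x|^2 / (2
  b^2). The quadratic term therefore comes from differentiating the known transform of the Gaussian
  with respect to its width, without integration by parts in space.\<close>

lemma fourier_inv_neg_lap_gauss:
  fixes \<xi> :: "'a::euclidean_space"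
  assumes "a > 0"
  shows "fourier_inv (\<lambda>x. complex_of_real (neg_lap_gauss a x)) \<xi> = of_real ((norm \<xi>)\<^sup>2 * gauss_hat a \<xi>)"
proof -
  define F where "F = (\<lambda>b. LINT x|lborel. complex_of_real (gauss b x) * cis (\<xi> \<bullet> x))"
  define H where "H = (\<lambda>b (x::'a). complex_of_real ((norm x)\<^sup>2 / (2 * b\<^sup>2) * gauss b x) * cis (\<xi> \<bullet> x))"
  have F: "F b = of_real (sqrt (2 * pi) ^ DIM('a) * gauss_hat b \<xi>)" if "b > 0" for b
    unfolding F_def by (rule gauss_inverse_transform(2)[OF that])
  have b: "b > 0" "b \<le> 3 / 2 * a" "b \<ge> a / 2" if "b \<in> ball a (a / 2)" for b
    using that assms by (auto simp: dist_real_def abs_if split: if_splits)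
  \<comment> \<open>For b between a/2 and 3a/2 the factor 1/(2 b^2) is at most 2/a^2 and the
    Gaussian is largest at width 3a/2; absorbing |x|^2 doubles that width.\<close>
  define g where "g = (\<lambda>x::'a. 2 / a\<^sup>2 * (exp (real 2 ^ 2 * (3 / 2 * a)) * gauss (2 * (3 / 2 * a)) x))"
  have bound: "((\<lambda>b. complex_of_real (gauss b x) * cis (\<xi> \<bullet> x)) has_vector_derivative H b x) (at b) \<and>
      norm (H b x) \<le> g x" if "b \<in> ball a (a / 2)" for b x
  proof (intro conjI)
    note b = b[OF that]
    show "((\<lambda>b. complex_of_real (gauss b x) * cis (\<xi> \<bullet> x)) has_vector_derivative H b x) (at b)"
    proof -
      have "((\<lambda>b. gauss b x) has_real_derivative (norm x)\<^sup>2 / (2 * b\<^sup>2) * gauss b x) (at b)"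
        unfolding gauss_def using b
        by (auto intro!: derivative_eq_intros simp: field_simps power2_eq_square)
      then show ?thesis unfolding H_def
        by (intro has_vector_derivative_mult_left has_vector_derivative_of_real)
          (simp add: has_real_derivative_iff_has_vector_derivative)
    qed
    have "norm (H b x) = (norm x)\<^sup>2 * gauss b x / (2 * b\<^sup>2)"
      unfolding H_def norm_mult norm_cis norm_of_real by (simp add: abs_mult)
    also have "\<dots> \<le> (1 + norm x)\<^sup>2 * gauss (3 / 2 * a) x / (2 * (a / 2)\<^sup>2)"
      using b assms by (intro frac_le mult_mono gauss_mono power_mono mult_left_mono) auto
    also have "\<dots> = 2 / a\<^sup>2 * ((1 + norm x)\<^sup>2 * gauss (3 / 2 * a) x)"
      by (simp add: power2_eq_square)
    also have "\<dots> \<le> 2 / a\<^sup>2 * (exp (real 2 ^ 2 * (3 / 2 * a)) * gauss (2 * (3 / 2 * a)) x)"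
      using assms by (intro mult_left_mono gauss_decay) auto
    finally show "norm (H b x) \<le> g x" by (simp only: g_def)
  qed
  have int: "integrable lborel (\<lambda>x. complex_of_real (gauss b x) * cis (\<xi> \<bullet> x))" if "b \<in> ball a (a / 2)" for b
    using b[OF that] by (intro gauss_inverse_transform(1)) auto
  have g: "integrable lborel g"
    unfolding g_def using assms by (intro integrable_mult_right integrable_gauss) auto
  have "a / 2 > 0" using assms by simp
  note leibniz = has_vector_derivative_lebesgue_integral[OF this int conjunct1[OF bound] conjunct2[OF bound] g]
  have F': "(F has_vector_derivative integral\<^sup>L lborel (H a)) (at a)" and Hint: "integrable lborel (H a)"
    unfolding F_def by (rule leibniz; assumption)+
  have "((\<lambda>b. sqrt (2 * pi) ^ DIM('a) * gauss_hat b \<xi>) has_real_derivative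
     sqrt (2 * pi) ^ DIM('a) * ((real DIM('a) / (2 * a) - (norm \<xi>)\<^sup>2 / 2) * gauss_hat a \<xi>)) (at a)"
  proof -
    have "((\<lambda>b. sqrt b ^ DIM('a)) has_real_derivative real DIM('a) / (2 * a) * sqrt a ^ DIM('a)) (at a)"
    proof -
      have "((\<lambda>b. sqrt b ^ DIM('a)) has_real_derivative
          real DIM('a) * (inverse (sqrt a) / 2 * sqrt a ^ (DIM('a) - 1))) (at a)"
        using assms by (auto intro!: derivative_eq_intros)
      also have "real DIM('a) * (inverse (sqrt a) / 2 * sqrt a ^ (DIM('a) - 1)) = real DIM('a) / (2 * a) * sqrt a ^ DIM('a)"
      proof -
        have "sqrt a ^ DIM('a) = sqrt a ^ (DIM('a) - 1) * sqrt a"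
          by (metis DIM_positive power_minus_mult)
        moreover have "a = sqrt a * sqrt a" "sqrt a > 0" using assms by auto
        ultimately show ?thesis by (simp add: field_simps)
      qed
      finally show ?thesis .
    qed
    moreover have "((\<lambda>b. exp (- b * (norm \<xi>)\<^sup>2 / 2)) has_real_derivative - (norm \<xi>)\<^sup>2 / 2 * exp (- a * (norm \<xi>)\<^sup>2 / 2)) (at a)"
      by (auto intro!: derivative_eq_intros)
    ultimately show ?thesis unfolding gauss_hat_def
      by (rule DERIV_cong[OF DERIV_cmult[OF DERIV_mult]]) (simp add: algebra_simps)
  qed
  then have "((\<lambda>b. complex_of_real (sqrt (2 * pi) ^ DIM('a) * gauss_hat b \<xi>)) has_vector_derivative
     of_real (sqrt (2 * pi) ^ DIM('a) * ((real DIM('a) / (2 * a) - (norm \<xi>)\<^sup>2 / 2) * gauss_hat a \<xi>))) (at a)"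
    by (intro has_vector_derivative_of_real) (simp add: has_real_derivative_iff_has_vector_derivative)
  then have "(F has_vector_derivative
     of_real (sqrt (2 * pi) ^ DIM('a) * ((real DIM('a) / (2 * a) - (norm \<xi>)\<^sup>2 / 2) * gauss_hat a \<xi>))) (at a)"
    by (rule has_vector_derivative_transform_within_open[where S = "{0<..}"]) (use F assms in auto)
  from vector_derivative_unique_at[OF F' this] have
    I: "integral\<^sup>L lborel (H a) = of_real (sqrt (2 * pi) ^ DIM('a) * ((real DIM('a) / (2 * a) - (norm \<xi>)\<^sup>2 / 2) * gauss_hat a \<xi>))" .
  have "(LINT x|lborel. complex_of_real (neg_lap_gauss a x) * cis (\<xi> \<bullet> x)) =
      (LINT x|lborel. of_real (real DIM('a) / a) * (complex_of_real (gauss a x) * cis (\<xi> \<bullet> x)) - 2 * H a x)"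
    by (intro Bochner_Integration.integral_cong) (auto simp: neg_lap_gauss_def H_def algebra_simps)
  also have "\<dots> = of_real (real DIM('a) / a) * F a - 2 * integral\<^sup>L lborel (H a)"
    unfolding F_def using Hint gauss_inverse_transform(1)[OF assms, of \<xi>]
    by (subst Bochner_Integration.integral_diff) auto
  also have "\<dots> = of_real (sqrt (2 * pi) ^ DIM('a) * ((norm \<xi>)\<^sup>2 * gauss_hat a \<xi>))"
    unfolding I F[OF assms] by (simp add: algebra_simps)
  finally show ?thesis unfolding fourier_inv_def two_pi_powr by simp
qed

section \<open>Iterated Laplacians of Gaussians\<close>

lemma higher_deriv_exp_cmult:
  fixes c :: complex
  shows "(deriv ^^ k) (\<lambda>z. exp (c * z)) = (\<lambda>z. c ^ k * exp (c * z))"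
proof (induction k)
  case (Suc k)
  have "((\<lambda>z. c ^ k * exp (c * z)) has_field_derivative c ^ Suc k * exp (c * z)) (at z)" for z
    by (auto intro!: derivative_eq_intros)
  with Suc show ?case by (auto intro: DERIV_imp_deriv)
qed simp

text \<open>The radius a/2 keeps the circle in the half-plane where the complex Gaussian integral
  converges, while still being proportional to a, so that Cauchy's formula costs (2/a)^k.\<close>

definition circ :: "real \<Rightarrow> real \<Rightarrow> complex" where
  "circ a \<theta> = of_real a + of_real (a / 2) * cis (2 * pi * \<theta>)"

lemma circ_eq_circlepath: "circ a = circlepath (of_real a) (a / 2)"
  by (auto simp: circ_def circlepath cis_conv_exp mult_ac)

text \<open>The first bound controls decay in the frequency. For the second, the real part is at
  least a/2 and the modulus at most 3a/2; the quotient 2/(9a) becomes the width 9a/2 after the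
  Fourier transform.\<close>

lemma Re_circ:
  assumes "a > 0"
  shows "Re (circ a \<theta>) \<ge> a / 2" and "Re (1 / circ a \<theta>) \<ge> 2 / (9 * a)"
proof -
  have c: "\<bar>cos (2 * pi * \<theta>)\<bar> \<le> 1" by simp
  then have "- (a / 2) \<le> a / 2 * cos (2 * pi * \<theta>)"
    using assms mult_left_mono[of "-1" "cos (2 * pi * \<theta>)" "a / 2"] by simp
  then show *: "Re (circ a \<theta>) \<ge> a / 2" by (simp add: circ_def)
  have "cmod (circ a \<theta>) \<le> 3 / 2 * a"
    unfolding circ_def using assms by (intro order_trans[OF norm_triangle_ineq]) (simp add: norm_mult)
  then have n: "(cmod (circ a \<theta>))\<^sup>2 \<le> (3 / 2 * a)\<^sup>2" by (intro power_mono) auto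
  have pos: "(cmod (circ a \<theta>))\<^sup>2 > 0" using * assms by (auto simp: complex_eq_iff)
  have "2 / (9 * a) = (a / 2) / (3 / 2 * a)\<^sup>2" using assms by (simp add: power2_eq_square field_simps)
  also have "\<dots> \<le> Re (circ a \<theta>) / (cmod (circ a \<theta>))\<^sup>2"
    using * n pos assms by (intro frac_le) auto
  also have "\<dots> = Re (1 / circ a \<theta>)" by (simp add: Re_divide cmod_power2)
  finally show "Re (1 / circ a \<theta>) \<ge> 2 / (9 * a)" .
qed

lemma continuous_circ [continuous_intros]: "continuous_on S (circ a)"
  unfolding circ_def by (intro continuous_intros)

lemma circ_measurable [measurable]: "circ a \<in> borel_measurable borel"
  by (intro borel_measurable_continuous_onI continuous_circ)

text \<open>The left-hand side is the k-th derivative of z \<mapsto> exp (-z q / 2) at z = a, to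
  which Cauchy's formula applies. Writing it as an integral over [0, 1] prepares the exchange with
  the Fourier integral.\<close>

lemma monomial_times_exp_as_circle_integral:
  fixes q a :: real
  assumes "a > 0"
  shows "complex_of_real ((- q / 2) ^ k * exp (- a * q / 2)) = fact k / of_real ((a / 2) ^ k) *
    (LINT \<theta>:{0..1}|lborel. cis (- 2 * pi * real k * \<theta>) * exp (- circ a \<theta> * of_real q / 2))"
proof -
  define c where "c = - complex_of_real q / 2"
  define I where "I = (2 * pi * \<i>) / fact k * (c ^ k * exp (c * of_real a))"
  define f where "f = (\<lambda>\<theta>. cis (- 2 * pi * real k * \<theta>) * exp (- circ a \<theta> * of_real q / 2))"
  have "((\<lambda>u. exp (c * u) / (u - of_real a) ^ Suc k) has_contour_integral
      (2 * pi * \<i>) / fact k * (deriv ^^ k) (\<lambda>z. exp (c * z)) (of_real a)) (circlepath (of_real a) (a / 2))"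
    using assms by (intro Cauchy_has_contour_integral_higher_derivative_circlepath)
      (auto intro!: continuous_intros holomorphic_intros)
  then have "((\<lambda>\<theta>. exp (c * circ a \<theta>) / (circ a \<theta> - of_real a) ^ Suc k *
      vector_derivative (circlepath (of_real a) (a / 2)) (at \<theta> within {0..1})) has_integral I) {0..1}"
    unfolding has_contour_integral_def higher_deriv_exp_cmult circ_eq_circlepath I_def .
  \<comment> \<open>The velocity of the path cancels one of the k + 1 powers in the denominator; the
    others leave the radius to the power -k and a phase.\<close>
  moreover have "exp (c * circ a \<theta>) / (circ a \<theta> - of_real a) ^ Suc k *
      vector_derivative (circlepath (of_real a) (a / 2)) (at \<theta> within {0..1}) =
      (2 * pi * \<i> / of_real ((a / 2) ^ k)) * f \<theta>" if "\<theta> \<in> {0..1}" for \<theta>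
  proof -
    have vd: "vector_derivative (circlepath (of_real a) (a / 2)) (at \<theta> within {0..1}) =
        2 * pi * \<i> * (of_real (a / 2) * cis (2 * pi * \<theta>))"
      using that by (subst vector_derivative_circlepath01) (auto simp: cis_conv_exp mult_ac)
    have "X / w ^ Suc k * (Y * w) = Y * X * inverse (w ^ k)" if "w \<noteq> 0" for w X Y :: complex
      using that by (simp add: field_simps)
    moreover have "of_real (a / 2) * cis (2 * pi * \<theta>) \<noteq> 0" using assms by simp
    ultimately have "exp (c * circ a \<theta>) / (circ a \<theta> - of_real a) ^ Suc k * (2 * pi * \<i> * (of_real (a / 2) * cis (2 * pi * \<theta>)))
      = (2 * pi * \<i>) * exp (c * circ a \<theta>) * inverse ((of_real (a / 2) * cis (2 * pi * \<theta>)) ^ k)"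
      unfolding circ_def by (simp only: add_diff_cancel_left')
    also have "inverse ((of_real (a / 2) * cis (2 * pi * \<theta>)) ^ k) = cis (- 2 * pi * real k * \<theta>) / of_real ((a / 2) ^ k)"
    proof -
      have "(of_real (a / 2) * cis (2 * pi * \<theta>)) ^ k = complex_of_real ((a / 2) ^ k) * cis (real k * (2 * pi * \<theta>))"
        by (simp only: power_mult_distrib Complex.DeMoivre of_real_power)
      then have "inverse ((of_real (a / 2) * cis (2 * pi * \<theta>)) ^ k) = inverse (complex_of_real ((a / 2) ^ k)) * cis (- (real k * (2 * pi * \<theta>)))"
        by (simp only: inverse_mult_distrib cis_inverse)
      moreover have "- (real k * (2 * pi * \<theta>)) = - 2 * pi * real k * \<theta>" by simp
      ultimately show ?thesis by (simp only: divide_inverse mult.commute)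
    qed
    finally show ?thesis unfolding vd by (simp add: f_def c_def mult_ac)
  qed
  ultimately have "((\<lambda>\<theta>. (2 * pi * \<i> / of_real ((a / 2) ^ k)) * f \<theta>) has_integral I) {0..1}"
    by (subst (asm) has_integral_cong) auto
  moreover have cont: "continuous_on {0..1} f"
    unfolding f_def by (intro continuous_intros) auto
  then have "(f has_integral (LINT \<theta>:{0..1}|lborel. f \<theta>)) {0..1}"
    using set_borel_integral_eq_integral[OF borel_integrable_atLeastAtMost'[OF cont]]
    by (simp add: integrable_integral)
  then have "((\<lambda>\<theta>. (2 * pi * \<i> / of_real ((a / 2) ^ k)) * f \<theta>) has_integral
      (2 * pi * \<i> / of_real ((a / 2) ^ k)) * (LINT \<theta>:{0..1}|lborel. f \<theta>)) {0..1}"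
    by (rule has_integral_mult_right)
  ultimately have I_eq: "I = (2 * pi * \<i> / of_real ((a / 2) ^ k)) * (LINT \<theta>:{0..1}|lborel. f \<theta>)"
    by (rule has_integral_unique)
  then have "c ^ k * exp (c * of_real a) = fact k / of_real ((a / 2) ^ k) * (LINT \<theta>:{0..1}|lborel. f \<theta>)"
  proof -
    have "P / F * X = P / R * L \<Longrightarrow> P \<noteq> 0 \<Longrightarrow> F \<noteq> 0 \<Longrightarrow> X = F / R * L" for P F R X L :: complex
      by (auto simp: divide_simps mult_ac split: if_splits)
    from this[OF I_eq[unfolded I_def]] show ?thesis by simp
  qed
  moreover have "c ^ k * exp (c * of_real a) = complex_of_real ((- q / 2) ^ k * exp (- a * q / 2))"
    by (simp add: c_def mult_ac flip: exp_of_real)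
  ultimately show ?thesis unfolding f_def by simp
qed

lemma integrable_poly_gauss:
  assumes "a > 0" "\<And>x. \<bar>f x\<bar> \<le> C * (1 + norm x) ^ k" "f \<in> borel_measurable borel"
  shows "integrable lborel (\<lambda>x::'a::euclidean_space. f x * gauss a x)"
proof (rule Bochner_Integration.integrable_bound)
  show "integrable lborel (\<lambda>x::'a. C * (exp (real k ^ 2 * a) * gauss (2 * a) x))"
    using assms by (intro integrable_mult_right integrable_gauss) auto
  show "(\<lambda>x. f x * gauss a x) \<in> borel_measurable lborel" using assms by measurable
  have "0 \<le> C" using assms(2)[of 0] by auto
  have "\<bar>f x\<bar> * gauss a x \<le> C * ((1 + norm x) ^ k * gauss a x)" for x
    using assms(2)[of x] by (simp add: mult_right_mono flip: mult.assoc)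
  also have "C * ((1 + norm x) ^ k * gauss a x) \<le> C * (exp (real k ^ 2 * a) * gauss (2 * a) x)" for x :: 'a
    using \<open>0 \<le> C\<close> assms by (intro mult_left_mono gauss_decay) auto
  finally show "AE x in lborel. norm (f x * gauss a x) \<le> norm (C * (exp (real k ^ 2 * a) * gauss (2 * a) x))"
    using \<open>0 \<le> C\<close> by (intro AE_I2) (simp add: abs_mult)
qed

lemma gauss_hat_eq: "a > 0 \<Longrightarrow> gauss_hat a \<xi> = sqrt a ^ DIM('a) * gauss (1 / a) (\<xi>::'a::euclidean_space)"
  by (simp add: gauss_hat_def gauss_def)

text \<open>\<open>lap_coeff a j\<close> is \<open>\<Delta>\<^sup>j gauss a\<close> and \<open>wave_coeff a k\<close> is \<open>(1/4 + \<Delta>)\<^sup>k gauss a\<close>.\<close>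

definition lap_coeff :: "real \<Rightarrow> nat \<Rightarrow> 'a::euclidean_space \<Rightarrow> complex" where
  "lap_coeff a j = fourier (\<lambda>\<xi>. complex_of_real ((- (norm \<xi>)\<^sup>2) ^ j * gauss_hat a \<xi>))"

definition wave_coeff :: "real \<Rightarrow> nat \<Rightarrow> 'a::euclidean_space \<Rightarrow> complex" where
  "wave_coeff a k = fourier (\<lambda>\<xi>. complex_of_real ((1 / 4 - (norm \<xi>)\<^sup>2) ^ k * gauss_hat a \<xi>))"

lemma integrable_norm_power_gauss_hat:
  fixes x :: "'a::euclidean_space"
  assumes "a > 0"
  shows "integrable lborel (\<lambda>\<xi>::'a. complex_of_real ((- (norm \<xi>)\<^sup>2) ^ j * gauss_hat a \<xi>) * cis (- (\<xi> \<bullet> x)))"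
proof (rule Bochner_Integration.integrable_bound)
  have "integrable lborel (\<lambda>\<xi>::'a. (- (norm \<xi>)\<^sup>2) ^ j * gauss (1 / a) \<xi>)"
    using assms by (intro integrable_poly_gauss[where C = 1 and k = "2 * j"])
     (auto simp: power_abs intro!: power_mono simp flip: power_mult)
  then show "integrable lborel (\<lambda>\<xi>::'a. sqrt a ^ DIM('a) * ((- (norm \<xi>)\<^sup>2) ^ j * gauss (1 / a) \<xi>))"
    by (rule integrable_mult_right)
  show "(\<lambda>\<xi>::'a. complex_of_real ((- (norm \<xi>)\<^sup>2) ^ j * gauss_hat a \<xi>) * cis (- (\<xi> \<bullet> x))) \<in> borel_measurable lborel"
    unfolding gauss_hat_def measurable_lborel2
    by (intro borel_measurable_continuous_onI continuous_intros) auto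
qed (use assms in \<open>simp only: norm_mult norm_cis norm_of_real gauss_hat_eq abs_mult, auto simp: abs_mult\<close>)

text \<open>
  Cauchy's formula on the circle of radius \<open>a/2\<close> about \<open>a\<close> reduces the bound to the Fourier transforms of Gaussians
  of complex width.
\<close>

lemma norm_lap_coeff_le:
  fixes x :: "'a::euclidean_space"
  assumes "a > 0"
  shows "norm (lap_coeff a k x) \<le> sqrt 2 ^ DIM('a) * (fact k * (4 / a) ^ k) * gauss (9 * a / 2) x"
proof -
  \<comment> \<open>The joint integrand of Fourier and Cauchy integrals, with the indicator making
    both integrals run over full spaces. Its majorant \<open>gauss (2 / a)\<close> is uniform in
    \<theta>, which justifies Fubini.\<close>
  define f where "f = (\<lambda>(\<xi>::'a, \<theta>::real). indicator {0..1} \<theta> *\<^sub>R (cis (- 2 * pi * real k * \<theta>) *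
      (exp (- circ a \<theta> * of_real ((norm \<xi>)\<^sup>2) / 2) * cis (- (\<xi> \<bullet> x)))))"
  have fm [measurable]: "f \<in> borel_measurable (lborel \<Otimes>\<^sub>M lborel)"
  proof -
    have [measurable]: "cis \<in> borel_measurable borel"
      by (intro borel_measurable_continuous_onI continuous_intros)
    show ?thesis unfolding f_def by measurable
  qed
  have bound: "norm (f (\<xi>, \<theta>)) \<le> indicator {0..1} \<theta> * gauss (2 / a) \<xi>" for \<xi> \<theta>
  proof -
    have "norm (exp (- circ a \<theta> * of_real ((norm \<xi>)\<^sup>2) / 2)) = exp (- Re (circ a \<theta>) * (norm \<xi>)\<^sup>2 / 2)"
      by (simp add: norm_exp_eq_Re)
    also have "\<dots> \<le> exp (- (a / 2) * (norm \<xi>)\<^sup>2 / 2)"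
      using mult_right_mono[OF Re_circ(1)[OF assms, of \<theta>] zero_le_power2[of "norm \<xi>"]] by simp
    also have "\<dots> = gauss (2 / a) \<xi>" by (simp add: gauss_def)
    finally show ?thesis by (simp add: f_def norm_mult indicator_def)
  qed
  have int: "integrable (lborel \<Otimes>\<^sub>M lborel) f"
  proof (rule integrableI_bounded[OF fm])
    have "(\<integral>\<^sup>+p. norm (f p) \<partial>(lborel \<Otimes>\<^sub>M lborel)) = (\<integral>\<^sup>+\<xi>. \<integral>\<^sup>+\<theta>. norm (f (\<xi>, \<theta>)) \<partial>lborel \<partial>lborel)"
      by (subst lborel.nn_integral_fst[symmetric]) auto
    also have "\<dots> \<le> (\<integral>\<^sup>+\<xi>. \<integral>\<^sup>+\<theta>. ennreal (gauss (2 / a) (\<xi>::'a)) * indicator {0..1::real} \<theta> \<partial>lborel \<partial>lborel)"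
    proof (intro nn_integral_mono)
      fix \<xi> :: 'a and \<theta> :: real
      show "ennreal (norm (f (\<xi>, \<theta>))) \<le> ennreal (gauss (2 / a) \<xi>) * indicator {0..1} \<theta>"
        using ennreal_leI[OF bound[of \<xi> \<theta>]] by (cases "\<theta> \<in> {0..1}") (auto simp: norm_le_zero_iff)
    qed
    also have "\<dots> = (\<integral>\<^sup>+\<xi>. ennreal (gauss (2 / a) (\<xi>::'a)) \<partial>lborel)"
      by (simp add: nn_integral_cmult)
    also have "\<dots> < \<infinity>"
      using integrable_gauss[of "2 / a", where 'a='a] assms by (simp add: integrable_iff_bounded)
    finally show "(\<integral>\<^sup>+p. norm (f p) \<partial>(lborel \<Otimes>\<^sub>M lborel)) < \<infinity>" .
  qed
  have Re_pos: "Re (circ a \<theta>) > 0" for \<theta> using Re_circ(1)[OF assms, of \<theta>] assms by linarith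
  \<comment> \<open>For fixed \<theta> the frequency integral is an exact complex Gaussian, so
    cancellation in \<xi> is fully exploited; absolute values are taken only afterwards.\<close>
  have inner: "norm (LINT \<xi>|lborel. f (\<xi>, \<theta>)) \<le> indicator {0..1} \<theta> * (sqrt (4 * pi / a) ^ DIM('a) * gauss (9 * a / 2) x)" for \<theta>
  proof -
    have "(LINT \<xi>|lborel. f (\<xi>, \<theta>)) = indicator {0..1} \<theta> *\<^sub>R (cis (- 2 * pi * real k * \<theta>) *
      (cgauss_integral (circ a \<theta>) ^ DIM('a) * exp (- of_real ((norm x)\<^sup>2) / (2 * circ a \<theta>))))"
      unfolding f_def prod.case by (simp only: integral_scaleR_right integral_mult_right_zero cgauss_transform(2)[OF Re_pos])
    then have "norm (LINT \<xi>|lborel. f (\<xi>, \<theta>)) = indicator {0..1} \<theta> * (norm (cgauss_integral (circ a \<theta>)) ^ DIM('a) *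
         norm (exp (- of_real ((norm x)\<^sup>2) / (2 * circ a \<theta>))))"
      by (simp add: norm_mult norm_power)
    also have "\<dots> \<le> indicator {0..1} \<theta> * (sqrt (4 * pi / a) ^ DIM('a) * gauss (9 * a / 2) x)"
    proof (intro mult_left_mono mult_mono power_mono)
      have "norm (cgauss_integral (circ a \<theta>)) \<le> sqrt (2 * pi / Re (circ a \<theta>))"
        by (rule norm_cgauss_integral_le[OF Re_pos])
      also have "\<dots> \<le> sqrt (2 * pi / (a / 2))"
        using Re_circ(1)[OF assms, of \<theta>] assms by (intro real_sqrt_le_mono frac_le) auto
      finally show "norm (cgauss_integral (circ a \<theta>)) \<le> sqrt (4 * pi / a)" by simp
      have "- of_real ((norm x)\<^sup>2) / (2 * circ a \<theta>) = of_real (- (norm x)\<^sup>2 / 2) * (1 / circ a \<theta>)" by simp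
      then have "norm (exp (- of_real ((norm x)\<^sup>2) / (2 * circ a \<theta>))) = exp (- (norm x)\<^sup>2 / 2 * Re (1 / circ a \<theta>))"
        by (simp only: norm_exp_eq_Re Re_complex_of_real times_complex.sel Im_complex_of_real mult_zero_left diff_0_right)
      also have "\<dots> \<le> exp (- (norm x)\<^sup>2 / 2 * (2 / (9 * a)))"
        using Re_circ(2)[OF assms, of \<theta>] by (intro iffD2[OF exp_le_cancel_iff] mult_left_mono_neg) auto
      also have "\<dots> = gauss (9 * a / 2) x" by (simp add: gauss_def)
      finally show "norm (exp (- of_real ((norm x)\<^sup>2) / (2 * circ a \<theta>))) \<le> gauss (9 * a / 2) x" .
    qed (use assms in auto)
    finally show ?thesis .
  qed
  define F where "F = (LINT \<xi>|lborel. complex_of_real ((- (norm \<xi>)\<^sup>2 / 2) ^ k * exp (- a * (norm \<xi>)\<^sup>2 / 2)) * cis (- (\<xi> \<bullet> x)))"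
  have "F = (LINT \<xi>|lborel. fact k / of_real ((a / 2) ^ k) * (LINT \<theta>|lborel. f (\<xi>, \<theta>)))"
    unfolding F_def
  proof (intro Bochner_Integration.integral_cong refl)
    fix \<xi> :: 'a
    have "(LINT \<theta>|lborel. f (\<xi>, \<theta>)) = (LINT \<theta>:{0..1}|lborel. cis (- 2 * pi * real k * \<theta>) *
        exp (- circ a \<theta> * of_real ((norm \<xi>)\<^sup>2) / 2)) * cis (- (\<xi> \<bullet> x))"
      unfolding set_lebesgue_integral_def integral_mult_left_zero[symmetric] f_def by (simp add: mult_ac)
    then show "complex_of_real ((- (norm \<xi>)\<^sup>2 / 2) ^ k * exp (- a * (norm \<xi>)\<^sup>2 / 2)) * cis (- (\<xi> \<bullet> x)) =
       fact k / of_real ((a / 2) ^ k) * (LINT \<theta>|lborel. f (\<xi>, \<theta>))"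
      by (simp only: monomial_times_exp_as_circle_integral[OF assms] mult.assoc)
  qed
  also have "\<dots> = fact k / of_real ((a / 2) ^ k) * (LINT \<theta>|lborel. LINT \<xi>|lborel. f (\<xi>, \<theta>))"
    using lborel_pair.Fubini_integral[of "\<lambda>\<xi> \<theta>. f (\<xi>, \<theta>)"] int by simp
  finally have F_eq: "norm F = fact k / (a / 2) ^ k * norm (LINT \<theta>|lborel. LINT \<xi>|lborel. f (\<xi>, \<theta>))"
    using assms by (simp add: norm_mult norm_divide norm_power)
  have "norm (LINT \<theta>|lborel. LINT \<xi>|lborel. f (\<xi>, \<theta>)) \<le> (LINT \<theta>|lborel. norm (LINT \<xi>|lborel. f (\<xi>, \<theta>)))"
    by (rule integral_norm_bound)
  also have "\<dots> \<le> (LINT \<theta>::real|lborel. indicator {0..1} \<theta> * (sqrt (4 * pi / a) ^ DIM('a) * gauss (9 * a / 2) x))"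
  proof (rule Bochner_Integration.integral_mono[OF integrable_norm _ inner])
    show "integrable lborel (\<lambda>\<theta>. LINT \<xi>|lborel. f (\<xi>, \<theta>))"
      using lborel_pair.integrable_snd[of "\<lambda>\<xi> \<theta>. f (\<xi>, \<theta>)"] int by simp
    show "integrable lborel (\<lambda>\<theta>::real. indicator {0..1} \<theta> * (sqrt (4 * pi / a) ^ DIM('a) * gauss (9 * a / 2) x))"
      by (intro integrable_mult_left) auto
  qed
  also have "\<dots> = sqrt (4 * pi / a) ^ DIM('a) * gauss (9 * a / 2) x" by simp
  finally have F: "norm F \<le> fact k / (a / 2) ^ k * (sqrt (4 * pi / a) ^ DIM('a) * gauss (9 * a / 2) x)"
    unfolding F_eq using assms by (intro mult_left_mono) auto
  \<comment> \<open>Cauchy's formula produced powers of -|\<xi>|^2 / 2. The compensating 2^k turns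
    (2/a)^k into (4/a)^k.\<close>
  have "(LINT \<xi>|lborel. complex_of_real ((- (norm \<xi>)\<^sup>2) ^ k * gauss_hat a \<xi>) * cis (- (\<xi> \<bullet> x))) =
      (LINT \<xi>|lborel. of_real (2 ^ k * sqrt a ^ DIM('a)) * (complex_of_real ((- (norm \<xi>)\<^sup>2 / 2) ^ k * exp (- a * (norm \<xi>)\<^sup>2 / 2)) * cis (- (\<xi> \<bullet> x))))"
  proof (intro Bochner_Integration.integral_cong refl)
    fix \<xi> :: 'a
    have "(- (norm \<xi>)\<^sup>2) ^ k = 2 ^ k * (- (norm \<xi>)\<^sup>2 / 2) ^ k" by (simp flip: power_mult_distrib)
    then show "complex_of_real ((- (norm \<xi>)\<^sup>2) ^ k * gauss_hat a \<xi>) * cis (- (\<xi> \<bullet> x)) =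
       of_real (2 ^ k * sqrt a ^ DIM('a)) * (complex_of_real ((- (norm \<xi>)\<^sup>2 / 2) ^ k * exp (- a * (norm \<xi>)\<^sup>2 / 2)) * cis (- (\<xi> \<bullet> x)))"
      by (simp only: gauss_hat_def of_real_mult mult_ac)
  qed
  also have "\<dots> = of_real (2 ^ k * sqrt a ^ DIM('a)) * F"
    unfolding F_def by (rule integral_mult_right_zero)
  finally have "lap_coeff a k x = of_real (inverse (sqrt (2 * pi) ^ DIM('a)) * (2 ^ k * sqrt a ^ DIM('a))) * F"
    unfolding lap_coeff_def fourier_def two_pi_powr by simp
  then have "norm (lap_coeff a k x) = (inverse (sqrt (2 * pi) ^ DIM('a)) * (2 ^ k * sqrt a ^ DIM('a))) * norm F"
    using assms by (simp only: norm_mult norm_of_real) simp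
  also have "\<dots> \<le> (inverse (sqrt (2 * pi) ^ DIM('a)) * (2 ^ k * sqrt a ^ DIM('a))) *
      (fact k / (a / 2) ^ k * (sqrt (4 * pi / a) ^ DIM('a) * gauss (9 * a / 2) x))"
    using assms by (intro mult_left_mono F) auto
  also have "\<dots> = (inverse (sqrt (2 * pi)) * sqrt a * sqrt (4 * pi / a)) ^ DIM('a) * (fact k * (4 / a) ^ k) * gauss (9 * a / 2) x"
  proof -
    have "2 ^ k * (fact k / (a / 2) ^ k) = fact k * (2 / (a / 2)) ^ k"
      unfolding power_divide by simp
    then have eq: "fact k * (4 / a) ^ k = 2 ^ k * (fact k / (a / 2) ^ k)" by simp
    show ?thesis unfolding eq power_mult_distrib power_inverse by (simp only: mult_ac)
  qed
  also have "inverse (sqrt (2 * pi)) * sqrt a * sqrt (4 * pi / a) = sqrt 2"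
    using assms by (simp add: real_sqrt_mult real_sqrt_divide field_simps)
  finally show ?thesis .
qed

lemma lap_coeff_0: "a > 0 \<Longrightarrow> lap_coeff a 0 x = of_real (gauss a x)"
  unfolding lap_coeff_def using fourier_gauss_hat[of a x] by simp

lemma wave_coeff_0: "a > 0 \<Longrightarrow> wave_coeff a 0 x = of_real (gauss a x)"
  unfolding wave_coeff_def using fourier_gauss_hat[of a x] by simp

lemma wave_coeff_eq_sum:
  fixes x :: "'a::euclidean_space"
  assumes "a > 0"
  shows "wave_coeff a k x = (\<Sum>j\<le>k. of_real (real (k choose j) * (1 / 4) ^ (k - j)) * lap_coeff a j x)"
    and "integrable lborel (\<lambda>\<xi>. complex_of_real ((1 / 4 - (norm \<xi>)\<^sup>2) ^ k * gauss_hat a \<xi>) * cis (- (\<xi> \<bullet> x)))"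
proof -
  have eq: "complex_of_real ((1 / 4 - (norm \<xi>)\<^sup>2) ^ k * gauss_hat a \<xi>) * cis (- (\<xi> \<bullet> x)) =
      (\<Sum>j\<le>k. of_real (real (k choose j) * (1 / 4) ^ (k - j)) *
         (complex_of_real ((- (norm \<xi>)\<^sup>2) ^ j * gauss_hat a \<xi>) * cis (- (\<xi> \<bullet> x))))" for \<xi> :: 'a
  proof -
    have "(1 / 4 - (norm \<xi>)\<^sup>2) ^ k = (- (norm \<xi>)\<^sup>2 + 1 / 4) ^ k" by simp
    also have "\<dots> = (\<Sum>j\<le>k. real (k choose j) * (- (norm \<xi>)\<^sup>2) ^ j * (1 / 4) ^ (k - j))"
      by (rule binomial_ring)
    finally show ?thesis by (simp only: of_real_mult of_real_sum sum_distrib_right) (simp only: mult_ac)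
  qed
  note int = integrable_norm_power_gauss_hat[OF assms, of _ x]
  show "integrable lborel (\<lambda>\<xi>. complex_of_real ((1 / 4 - (norm \<xi>)\<^sup>2) ^ k * gauss_hat a \<xi>) * cis (- (\<xi> \<bullet> x)))"
    unfolding eq by (intro Bochner_Integration.integrable_sum integrable_mult_right int)
  show "wave_coeff a k x = (\<Sum>j\<le>k. of_real (real (k choose j) * (1 / 4) ^ (k - j)) * lap_coeff a j x)"
  proof -
    have "(LINT \<xi>|lborel. complex_of_real ((1 / 4 - (norm \<xi>)\<^sup>2) ^ k * gauss_hat a \<xi>) * cis (- (\<xi> \<bullet> x))) =
      (\<Sum>j\<le>k. of_real (real (k choose j) * (1 / 4) ^ (k - j)) *
         (LINT \<xi>|lborel. complex_of_real ((- (norm \<xi>)\<^sup>2) ^ j * gauss_hat a \<xi>) * cis (- (\<xi> \<bullet> x))))"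
      unfolding eq
      by (subst Bochner_Integration.integral_sum) (intro integrable_mult_right int, simp only: integral_mult_right_zero)
    then show ?thesis
      unfolding wave_coeff_def lap_coeff_def fourier_def by (simp only: sum_distrib_left) (simp only: mult_ac)
  qed
qed

text \<open>In the binomial expansion of (1/4 + \<Delta>)^k the term j = 0 is the main part. Every
  other term carries (4/a)^j, from which one factor 16/a is split off; the remaining sum is at most
  (1/4 + 1/4)^k. The gain 1/a is what the later absorption feeds on.\<close>

lemma norm_wave_coeff_diff_le:
  fixes x :: "'a::euclidean_space"
  assumes "a \<ge> 16"
  shows "norm (wave_coeff a k x - of_real ((1 / 4) ^ k * gauss a x)) \<le> 16 / a * (sqrt 2 ^ DIM('a) * fact k * gauss (9 * a / 2) x)"
proof -
  define g where "g = sqrt 2 ^ DIM('a) * gauss (9 * a / 2) x"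
  have g: "g \<ge> 0" by (simp add: g_def)
  have a: "a > 0" using assms by simp
  have "wave_coeff a k x = of_real (real (k choose 0) * (1 / 4) ^ (k - 0)) * lap_coeff a 0 x +
      (\<Sum>j\<in>{..k} - {0}. of_real (real (k choose j) * (1 / 4) ^ (k - j)) * lap_coeff a j x)"
    unfolding wave_coeff_eq_sum(1)[OF a] by (rule sum.remove) auto
  then have "norm (wave_coeff a k x - of_real ((1 / 4) ^ k * gauss a x)) =
      norm (\<Sum>j\<in>{..k} - {0}. of_real (real (k choose j) * (1 / 4) ^ (k - j)) * lap_coeff a j x)"
    by (simp add: lap_coeff_0[OF a])
  also have "\<dots> \<le> (\<Sum>j\<in>{..k} - {0}. norm (of_real (real (k choose j) * (1 / 4) ^ (k - j)) * lap_coeff a j x))"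
    by (rule norm_sum)
  also have "\<dots> \<le> (\<Sum>j\<in>{..k} - {0}. (16 / a * (g * fact k)) * (real (k choose j) * (1 / 4) ^ j * (1 / 4) ^ (k - j)))"
  proof (intro sum_mono)
    fix j assume j: "j \<in> {..k} - {0}"
    have "(4 / a) ^ j = (16 / a) ^ j * (1 / 4) ^ j" by (simp flip: power_mult_distrib)
    also have "\<dots> \<le> (16 / a) ^ 1 * (1 / 4) ^ j"
      using j assms by (intro mult_right_mono power_decreasing) auto
    finally have p: "(4 / a) ^ j \<le> 16 / a * (1 / 4) ^ j" by simp
    have "norm (of_real (real (k choose j) * (1 / 4) ^ (k - j)) * lap_coeff a j x) =
      (real (k choose j) * (1 / 4) ^ (k - j)) * norm (lap_coeff a j x)"
      unfolding norm_mult norm_of_real by simp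
    also have "\<dots> \<le> (real (k choose j) * (1 / 4) ^ (k - j)) * (sqrt 2 ^ DIM('a) * (fact j * (4 / a) ^ j) * gauss (9 * a / 2) x)"
      by (intro mult_left_mono norm_lap_coeff_le a) auto
    also have "\<dots> = (real (k choose j) * (1 / 4) ^ (k - j)) * (g * (fact j * (4 / a) ^ j))"
      by (simp add: g_def)
    also have "\<dots> \<le> (real (k choose j) * (1 / 4) ^ (k - j)) * (g * (fact k * (16 / a * (1 / 4) ^ j)))"
      using j p g assms by (intro mult_left_mono mult_mono fact_mono) auto
    finally show "norm (of_real (real (k choose j) * (1 / 4) ^ (k - j)) * lap_coeff a j x) \<le>
       (16 / a * (g * fact k)) * (real (k choose j) * (1 / 4) ^ j * (1 / 4) ^ (k - j))"
      by (simp only: mult_ac)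
  qed
  also have "\<dots> = (16 / a * (g * fact k)) * (\<Sum>j\<in>{..k} - {0}. real (k choose j) * (1 / 4) ^ j * (1 / 4) ^ (k - j))"
    by (simp only: sum_distrib_left)
  also have "\<dots> \<le> (16 / a * (g * fact k)) * (\<Sum>j\<le>k. real (k choose j) * (1 / 4) ^ j * (1 / 4) ^ (k - j))"
    using g assms by (intro mult_left_mono sum_mono2) auto
  also have "(\<Sum>j\<le>k. real (k choose j) * (1 / 4) ^ j * (1 / 4) ^ (k - j)) = (1 / 4 + 1 / 4) ^ k"
    by (rule binomial_ring[symmetric])
  also have "(16 / a * (g * fact k)) * (1 / 4 + 1 / 4) ^ k \<le> (16 / a * (g * fact k)) * 1"
    using g assms by (intro mult_left_mono power_le_one) auto
  finally show ?thesis by (simp add: g_def mult_ac)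
qed

lemma norm_wave_coeff_le:
  fixes x :: "'a::euclidean_space"
  assumes "a \<ge> 16"
  shows "norm (wave_coeff a k x) \<le> 2 * sqrt 2 ^ DIM('a) * fact k * gauss (9 * a / 2) x"
proof -
  define g where "g = sqrt 2 ^ DIM('a) * gauss (9 * a / 2) x"
  have g: "g \<ge> 0" by (simp add: g_def)
  have "1 * gauss a x \<le> sqrt 2 ^ DIM('a) * gauss (9 * a / 2) x"
    using assms by (intro mult_mono gauss_mono one_le_power) auto
  then have "gauss a x \<le> g" by (simp add: g_def)
  have "norm (wave_coeff a k x) \<le> norm (wave_coeff a k x - of_real ((1 / 4) ^ k * gauss a x)) + norm (complex_of_real ((1 / 4) ^ k * gauss a x))"
    by norm
  also have "\<dots> \<le> 16 / a * (g * fact k) + fact k * g"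
  proof (intro add_mono)
    show "norm (wave_coeff a k x - of_real ((1 / 4) ^ k * gauss a x)) \<le> 16 / a * (g * fact k)"
      using norm_wave_coeff_diff_le[OF assms, of k x] by (simp add: g_def mult_ac)
    have "norm (complex_of_real ((1 / 4) ^ k * gauss a x)) = (1 / 4) ^ k * gauss a x" by (simp add: norm_mult norm_power)
    also have "\<dots> \<le> fact k * g"
      using \<open>gauss a x \<le> g\<close> by (intro mult_mono order_trans[OF power_le_one fact_ge_1]) auto
    finally show "norm (complex_of_real ((1 / 4) ^ k * gauss a x)) \<le> fact k * g" .
  qed
  also have "\<dots> \<le> 1 * (g * fact k) + fact k * g"
    using g assms by (intro add_mono mult_right_mono) auto
  finally show ?thesis by (simp add: g_def mult_ac)
qed

section \<open>The solution operator on Gaussians\<close>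

definition wave_series :: "(nat \<Rightarrow> complex) \<Rightarrow> complex \<Rightarrow> complex" where
  "wave_series d z = (\<Sum>k. d k * z ^ (2 * k + 1) / fact (2 * k + 1))"

definition wave_series_deriv :: "(nat \<Rightarrow> complex) \<Rightarrow> complex \<Rightarrow> complex" where
  "wave_series_deriv d z = (\<Sum>k. d k * z ^ (2 * k) / fact (2 * k))"

lemma fact_square_le: "(fact k * fact k :: real) \<le> fact (2 * k)"
proof -
  have "(fact k * fact k :: nat) dvd fact (k + k)" by (rule fact_fact_dvd_fact)
  then have "(fact k * fact k :: nat) \<le> fact (2 * k)" by (simp add: dvd_imp_le mult_2)
  then have "real (fact k * fact k) \<le> real (fact (2 * k))" by (rule of_nat_mono)
  then show ?thesis by simp
qed

text \<open>This makes coefficients of size k! harmless: the denominators of the series leave 1/k!,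
  so the series is dominated by an exponential and is entire.\<close>

lemma fact_quotient_le: "(fact k / fact (2 * k) :: real) \<le> 1 / fact k" "(fact k / fact (2 * k + 1) :: real) \<le> 1 / fact k"
proof -
  show *: "(fact k / fact (2 * k) :: real) \<le> 1 / fact k"
    using fact_square_le[of k] by (simp add: field_simps)
  have "(fact k / fact (2 * k + 1) :: real) \<le> fact k / fact (2 * k)"
    by (intro divide_left_mono fact_mono mult_pos_pos) auto
  with * show "(fact k / fact (2 * k + 1) :: real) \<le> 1 / fact k" by linarith
qed

lemma wave_series_term_le:
  assumes "norm (d k) \<le> B * R ^ k * fact k" "0 \<le> B" "0 \<le> R"
  shows "norm (d k * z ^ (2 * k) / fact (2 * k) :: complex) \<le> B * ((R * (norm z)\<^sup>2) ^ k /\<^sub>R fact k)"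
    and "norm (d k * z ^ (2 * k + 1) / fact (2 * k + 1) :: complex) \<le> B * norm z * ((R * (norm z)\<^sup>2) ^ k /\<^sub>R fact k)"
proof -
  have "norm (d k * z ^ (2 * k) / fact (2 * k)) = norm (d k) * norm z ^ (2 * k) / fact (2 * k)"
    by (simp add: norm_mult norm_divide norm_power)
  also have "\<dots> \<le> (B * R ^ k * fact k) * norm z ^ (2 * k) / fact (2 * k)"
    using assms by (intro divide_right_mono mult_right_mono) auto
  also have "\<dots> = (B * (R * (norm z)\<^sup>2) ^ k) * (fact k / fact (2 * k))"
    by (simp add: power_mult power_mult_distrib)
  also have "\<dots> \<le> (B * (R * (norm z)\<^sup>2) ^ k) * (1 / fact k)"
    using assms by (intro mult_left_mono fact_quotient_le) auto
  finally show "norm (d k * z ^ (2 * k) / fact (2 * k) :: complex) \<le> B * ((R * (norm z)\<^sup>2) ^ k /\<^sub>R fact k)"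
    by (simp add: divide_inverse mult_ac)
  have "norm (d k * z ^ (2 * k + 1) / fact (2 * k + 1)) = norm (d k) * norm z ^ (2 * k + 1) / fact (2 * k + 1)"
    by (simp add: norm_mult norm_divide norm_power del: fact_Suc)
  also have "\<dots> \<le> (B * R ^ k * fact k) * norm z ^ (2 * k + 1) / fact (2 * k + 1)"
    using assms by (intro divide_right_mono mult_right_mono) auto
  also have "\<dots> = (B * norm z * (R * (norm z)\<^sup>2) ^ k) * (fact k / fact (2 * k + 1))"
    unfolding power_add power_mult power_mult_distrib by simp
  also have "\<dots> \<le> (B * norm z * (R * (norm z)\<^sup>2) ^ k) * (1 / fact k)"
    using assms by (intro mult_left_mono fact_quotient_le) auto
  finally show "norm (d k * z ^ (2 * k + 1) / fact (2 * k + 1) :: complex) \<le> B * norm z * ((R * (norm z)\<^sup>2) ^ k /\<^sub>R fact k)"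
    by (simp add: divide_inverse mult_ac del: fact_Suc)
qed

context
  fixes d :: "nat \<Rightarrow> complex" and B R :: real
  assumes d: "\<And>k. norm (d k) \<le> B * R ^ k * fact k" and B: "0 \<le> B" and R: "0 \<le> R"
begin

lemma term_le:
  "norm (d k * z ^ (2 * k) / fact (2 * k)) \<le> B * ((R * (norm z)\<^sup>2) ^ k /\<^sub>R fact k)"
  "norm (d k * z ^ (2 * k + 1) / fact (2 * k + 1)) \<le> B * norm z * ((R * (norm z)\<^sup>2) ^ k /\<^sub>R fact k)"
  by (rule wave_series_term_le; fact d B R)+

lemma summable_exp_mult: "summable (\<lambda>k. c * (r ^ k /\<^sub>R fact k))" for c r :: real
  by (intro summable_mult sums_summable[OF exp_converges])

lemma summable_wave_series: "summable (\<lambda>k. norm (d k * z ^ (2 * k + 1) / fact (2 * k + 1)))"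
  by (rule summable_comparison_test'[where N = 0, OF summable_exp_mult]) (use term_le(2) in simp)

lemma summable_wave_series_deriv: "summable (\<lambda>k. norm (d k * z ^ (2 * k) / fact (2 * k)))"
  by (rule summable_comparison_test'[where N = 0, OF summable_exp_mult]) (use term_le(1) in simp)

lemma norm_wave_series_le: "norm (wave_series d z) \<le> B * norm z * exp (R * (norm z)\<^sup>2)"
  unfolding wave_series_def exp_def
  by (subst suminf_mult[symmetric, OF sums_summable[OF exp_converges]],
      rule norm_suminf_le[OF term_le(2) summable_exp_mult])

text \<open>Since k + 1 is at most 2^k, a shift of the coefficients only doubles R. The geometric
  factor in the growth condition makes that condition stable under shifts, and a shift is an
  application of 1/4 + \<Delta>.\<close>

lemma shift_bound: "norm (d (Suc k)) \<le> (B * R) * (2 * R) ^ k * fact k"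
proof -
  have "real (Suc k) \<le> 2 ^ k" by (metis of_nat_le_iff of_nat_numeral of_nat_power Suc_leI less_exp)
  have "norm (d (Suc k)) \<le> B * R ^ Suc k * fact (Suc k)" by (rule d)
  also have "\<dots> = B * R * R ^ k * (fact k * real (Suc k))" by simp
  also have "\<dots> \<le> B * R * R ^ k * (fact k * 2 ^ k)"
    using \<open>real (Suc k) \<le> 2 ^ k\<close> B R by (intro mult_left_mono) auto
  finally show ?thesis by (simp add: power_mult_distrib mult_ac)
qed

end

text \<open>Together the two parts say that the second derivative in time is the shift of the
  coefficients: the series solves f'' = (1/4 + \<Delta>) f, paired with a test function.\<close>

lemma
  fixes d :: "nat \<Rightarrow> complex"
  assumes d: "\<And>k. norm (d k) \<le> B * R ^ k * fact k" and B: "0 \<le> B" and R: "0 \<le> R"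
  shows DERIV_wave_series: "(wave_series d has_field_derivative wave_series_deriv d z) (at z)"
    and DERIV_wave_series_deriv: "(wave_series_deriv d has_field_derivative wave_series (\<lambda>k. d (Suc k)) z) (at z)"
proof -
  \<comment> \<open>Zeros are inserted at the even (for f: odd) places, so that the theorem on
    termwise differentiation of ordinary power series applies.\<close>
  define e where "e = (\<lambda>n. if odd n then d (n div 2) / fact n else 0 :: complex)"
  define f where "f = (\<lambda>n. if even n then d (n div 2) / fact n else 0 :: complex)"
  have mono: "strict_mono (\<lambda>k::nat. 2 * k + 1)" "strict_mono (\<lambda>k::nat. 2 * k)"
    by (auto intro!: strict_monoI)
  have e0: "e n * z ^ n = 0" if "n \<notin> range (\<lambda>k. 2 * k + 1)" for n z
    using that by (auto simp: e_def elim!: oddE)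
  have f0: "f n * z ^ n = 0" if "n \<notin> range (\<lambda>k. 2 * k)" for n z
    using that by (auto simp: f_def elim!: evenE)
  have ek: "e (2 * k + 1) * z ^ (2 * k + 1) = d k * z ^ (2 * k + 1) / fact (2 * k + 1)" for k z
    by (simp add: e_def del: fact_Suc)
  have fk: "f (2 * k) * z ^ (2 * k) = d k * z ^ (2 * k) / fact (2 * k)" for k z
    by (simp add: f_def)
  have es: "summable (\<lambda>n. e n * z ^ n)" for z
  proof (rule iffD1[OF summable_mono_reindex[OF mono(1)]])
    show "summable (\<lambda>k. e (2 * k + 1) * z ^ (2 * k + 1))"
      unfolding ek by (rule summable_norm_cancel[OF summable_wave_series[OF d B R]])
  qed (rule e0)
  have fs: "summable (\<lambda>n. f n * z ^ n)" for z
  proof (rule iffD1[OF summable_mono_reindex[OF mono(2)]])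
    show "summable (\<lambda>k. f (2 * k) * z ^ (2 * k))"
      unfolding fk by (rule summable_norm_cancel[OF summable_wave_series_deriv[OF d B R]])
  qed (rule f0)
  have E: "wave_series d z = (\<Sum>n. e n * z ^ n)" for z
    unfolding wave_series_def ek[symmetric] by (rule suminf_mono_reindex[OF mono(1)]) (rule e0)
  have F: "wave_series_deriv d z = (\<Sum>n. f n * z ^ n)" for z
    unfolding wave_series_deriv_def fk[symmetric] by (rule suminf_mono_reindex[OF mono(2)]) (rule f0)
  have quot: "of_nat (Suc n) * (X / fact (Suc n)) = X / (fact n :: complex)" for n X
    unfolding fact_Suc using of_nat_neq_0[of n, where 'a=complex] by (simp del: of_nat_Suc)
  have de: "diffs e = f"
  proof
    show "diffs e n = f n" for n
      using quot[of n "d (n div 2)"] by (auto simp: diffs_def e_def f_def simp del: fact_Suc of_nat_Suc elim!: evenE)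
  qed
  have df: "diffs f n * z ^ n = 0" if "n \<notin> range (\<lambda>k. 2 * k + 1)" for n z
    using that by (auto simp: f_def diffs_def elim!: oddE)
  have dfk: "diffs f (2 * k + 1) * z ^ (2 * k + 1) = d (Suc k) * z ^ (2 * k + 1) / fact (2 * k + 1)" for k z
  proof -
    have "diffs f (2 * k + 1) = of_nat (Suc (2 * k + 1)) * (d (Suc k) / fact (Suc (2 * k + 1)))"
      by (simp add: diffs_def f_def del: fact_Suc of_nat_Suc)
    then have "diffs f (2 * k + 1) = d (Suc k) / fact (2 * k + 1)" by (simp only: quot)
    then show ?thesis by (simp del: fact_Suc)
  qed
  have F': "wave_series (\<lambda>k. d (Suc k)) z = (\<Sum>n. diffs f n * z ^ n)" for z
    unfolding wave_series_def dfk[symmetric] by (rule suminf_mono_reindex[OF mono(1)]) (rule df)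
  show "(wave_series d has_field_derivative wave_series_deriv d z) (at z)"
    unfolding E[abs_def] F de[symmetric] by (rule termdiffs_strong_converges_everywhere[OF es])
  show "(wave_series_deriv d has_field_derivative wave_series (\<lambda>k. d (Suc k)) z) (at z)"
    unfolding F[abs_def] F' by (rule termdiffs_strong_converges_everywhere[OF fs])
qed

lemma wave_series_at_0 [simp]: "wave_series d 0 = 0" "wave_series_deriv d 0 = d 0"
proof -
  show "wave_series d 0 = 0" by (simp add: wave_series_def)
  have "(\<Sum>k. d k * 0 ^ (2 * k) / fact (2 * k)) = (\<Sum>k\<in>{0}. d k * 0 ^ (2 * k) / fact (2 * k))"
    by (intro suminf_finite) auto
  then show "wave_series_deriv d 0 = d 0" by (simp add: wave_series_deriv_def)
qed

text \<open>The three branches of the symbol are one power series in c = 1/4 - |\<xi>|^2: hyperbolic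
  for c > 0 and trigonometric for c < 0.\<close>

lemma sums_damped_symbol:
  "(\<lambda>k. (1 / 4 - (norm \<xi>)\<^sup>2) ^ k * (t ^ (2 * k + 1) / fact (2 * k + 1))) sums damped_symbol t \<xi>"
proof -
  define c where "c = 1 / 4 - (norm \<xi>)\<^sup>2"
  have iff: "norm \<xi> < 1 / 2 \<longleftrightarrow> c > 0" "norm \<xi> > 1 / 2 \<longleftrightarrow> c < 0"
  proof -
    have "u < v \<longleftrightarrow> u\<^sup>2 < v\<^sup>2" if "0 \<le> u" "0 \<le> v" for u v :: real
      using that power_strict_mono[of u v 2] power_less_imp_less_base[of u 2 v] by auto
    from this[of "norm \<xi>" "1 / 2"] this[of "1 / 2" "norm \<xi>"]
    show "norm \<xi> < 1 / 2 \<longleftrightarrow> c > 0" "norm \<xi> > 1 / 2 \<longleftrightarrow> c < 0"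
      by (auto simp: c_def power2_eq_square)
  qed
  consider "c > 0" | "c < 0" | "c = 0" by linarith
  then have "(\<lambda>k. c ^ k * (t ^ (2 * k + 1) / fact (2 * k + 1))) sums damped_symbol t \<xi>"
  proof cases
    case 1
    have mono: "strict_mono (\<lambda>k::nat. 2 * k + 1)" by (auto intro!: strict_monoI)
    have "(\<lambda>n. if even n then 0 else (t * sqrt c) ^ n /\<^sub>R fact n) sums sinh (t * sqrt c)"
      by (rule sinh_converges)
    then have "(\<lambda>k. (t * sqrt c) ^ (2 * k + 1) /\<^sub>R fact (2 * k + 1)) sums sinh (t * sqrt c)"
      by (subst (asm) sums_mono_reindex[OF mono, symmetric]) (auto elim!: oddE)
    from sums_divide[OF this, of "sqrt c"] 1
    have "(\<lambda>k. (t * sqrt c) ^ (2 * k + 1) /\<^sub>R fact (2 * k + 1) / sqrt c) sums damped_symbol t \<xi>"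
      using iff by (simp add: damped_symbol_def c_def)
    moreover have "(t * sqrt c) ^ (2 * k + 1) /\<^sub>R fact (2 * k + 1) / sqrt c = c ^ k * (t ^ (2 * k + 1) / fact (2 * k + 1))" for k
      using 1 by (simp add: power_mult_distrib power_mult divide_inverse del: fact_Suc)
    ultimately show ?thesis by simp
  next
    case 2
    have c': "(norm \<xi>)\<^sup>2 - 1 / 4 = - c" by (simp add: c_def)
    from sums_divide[OF sin_paired[of "t * sqrt (- c)"], of "sqrt (- c)"] 2
    have "(\<lambda>k. (- 1) ^ k / fact (2 * k + 1) * (t * sqrt (- c)) ^ (2 * k + 1) / sqrt (- c)) sums damped_symbol t \<xi>"
      using iff by (simp add: damped_symbol_def c' del: fact_Suc)
    moreover have "(- 1) ^ k / fact (2 * k + 1) * (t * sqrt (- c)) ^ (2 * k + 1) / sqrt (- c) = c ^ k * (t ^ (2 * k + 1) / fact (2 * k + 1))" for k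
    proof -
      have "(- 1) ^ k * (sqrt (- c)) ^ (2 * k) = ((-1) * (sqrt (- c))\<^sup>2) ^ k"
        by (simp only: power_mult power_mult_distrib)
      also have "\<dots> = c ^ k" using 2 by simp
      finally have *: "(- 1) ^ k * (sqrt (- c)) ^ (2 * k) = c ^ k" .
      show ?thesis unfolding *[symmetric] using 2 by (simp add: power_mult_distrib del: fact_Suc)
    qed
    ultimately show ?thesis by simp
  next
    case 3
    \<comment> \<open>Only the term k = 0 survives, because 0^0 = 1; it is t, the continuous
      extension chosen in \<open>damped_symbol\<close>.\<close>
    have "(\<lambda>k. c ^ k * (t ^ (2 * k + 1) / fact (2 * k + 1))) sums (\<Sum>k\<in>{0}. c ^ k * (t ^ (2 * k + 1) / fact (2 * k + 1)))"
      by (rule sums_finite) (auto simp: 3)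
    then show ?thesis using iff 3 by (simp add: damped_symbol_def)
  qed
  then show ?thesis by (simp only: c_def)
qed

lemma power_le_fact_exp:
  fixes y b :: real
  assumes "0 \<le> y" "b > 0"
  shows "y ^ k \<le> fact k * (1 / b) ^ k * exp (b * y)"
proof -
  have "(b * y) ^ k /\<^sub>R fact k \<le> (\<Sum>n. (b * y) ^ n /\<^sub>R fact n)"
    using assms sum_le_suminf[OF sums_summable[OF exp_converges[of "b * y"]], of "{k}"] by simp
  then have "(b * y) ^ k / fact k \<le> exp (b * y)"
    unfolding exp_def by (simp add: divide_inverse mult.commute)
  then have "y ^ k * b ^ k \<le> fact k * exp (b * y)"
    by (simp add: power_mult_distrib field_simps)
  then show ?thesis using assms by (simp add: power_divide field_simps)
qed

text \<open>The series of the symbol is transformed term by term. The exponent i = 1 occurs for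
  \<open>neg_lap_gauss\<close>, since |\<xi>|^2 = 1/4 - (1/4 - |\<xi>|^2).\<close>

lemma fourier_damped_symbol:
  fixes x :: "'a::euclidean_space"
  assumes "a > 0"
  shows "fourier (\<lambda>\<xi>. complex_of_real (damped_symbol t \<xi> * ((1 / 4 - (norm \<xi>)\<^sup>2) ^ i * gauss_hat a \<xi>))) x =
      wave_series (\<lambda>k. wave_coeff a (k + i) x) (of_real t)"
    and "integrable lborel (\<lambda>\<xi>. complex_of_real (damped_symbol t \<xi> * ((1 / 4 - (norm \<xi>)\<^sup>2) ^ i * gauss_hat a \<xi>)) * cis (- (\<xi> \<bullet> x)))"
proof -
  define T where "T = (\<lambda>k (\<xi>::'a). of_real (t ^ (2 * k + 1) / fact (2 * k + 1)) *
     (complex_of_real ((1 / 4 - (norm \<xi>)\<^sup>2) ^ (k + i) * gauss_hat a \<xi>) * cis (- (\<xi> \<bullet> x))))"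
  \<comment> \<open>A summable majorant: \<open>power_le_fact_exp\<close> with b = a/4 bounds the
    k-th power at the price of half the Gaussian decay. What remains is
    \<open>gauss (2 / a)\<close>, and the 1/4 in the base gives exp (a/16).\<close>
  define h where "h = (\<lambda>\<xi>::'a. \<bar>1 / 4 - (norm \<xi>)\<^sup>2\<bar> ^ i * (exp (a / 16) * sqrt a ^ DIM('a) * gauss (2 / a) \<xi>))"
  have h0: "h \<xi> \<ge> 0" for \<xi> unfolding h_def using assms by simp
  have hint: "integrable lborel h"
  proof -
    have "integrable lborel (\<lambda>\<xi>::'a. (\<bar>1 / 4 - (norm \<xi>)\<^sup>2\<bar> ^ i * (exp (a / 16) * sqrt a ^ DIM('a))) * gauss (2 / a) \<xi>)"
    proof (rule integrable_poly_gauss[where C = "exp (a / 16) * sqrt a ^ DIM('a)" and k = "2 * i"])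
      fix \<xi> :: 'a
      have "(norm \<xi>)\<^sup>2 \<ge> 0" "norm \<xi> \<ge> 0" by auto
      then have "\<bar>1 / 4 - (norm \<xi>)\<^sup>2\<bar> \<le> (1 + norm \<xi>)\<^sup>2"
        unfolding power2_sum abs_le_iff by (intro conjI; simp; linarith?)
      then have "\<bar>1 / 4 - (norm \<xi>)\<^sup>2\<bar> ^ i \<le> (1 + norm \<xi>) ^ (2 * i)"
        by (simp add: power_mult power_mono)
      then show "\<bar>\<bar>1 / 4 - (norm \<xi>)\<^sup>2\<bar> ^ i * (exp (a / 16) * sqrt a ^ DIM('a))\<bar> \<le> (exp (a / 16) * sqrt a ^ DIM('a)) * (1 + norm \<xi>) ^ (2 * i)"
        using assms by (simp add: abs_mult mult_ac mult_left_mono)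
    qed (use assms in auto)
    then show ?thesis by (simp add: h_def mult_ac)
  qed
  have bound: "norm (T k \<xi>) \<le> \<bar>t\<bar> * ((4 / a * t\<^sup>2) ^ k /\<^sub>R fact k) * h \<xi>" for k \<xi>
  proof -
    have "norm (T k \<xi>) = \<bar>t\<bar> ^ (2 * k + 1) / fact (2 * k + 1) * (\<bar>1 / 4 - (norm \<xi>)\<^sup>2\<bar> ^ (k + i) * gauss_hat a \<xi>)"
      unfolding T_def norm_mult norm_cis norm_of_real
      using assms by (simp add: abs_mult power_abs gauss_hat_def del: fact_Suc)
    also have "\<dots> = \<bar>t\<bar> ^ (2 * k + 1) / fact (2 * k + 1) * (\<bar>1 / 4 - (norm \<xi>)\<^sup>2\<bar> ^ i * (\<bar>1 / 4 - (norm \<xi>)\<^sup>2\<bar> ^ k * gauss_hat a \<xi>))"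
      by (simp add: power_add del: fact_Suc)
    also have "\<dots> \<le> \<bar>t\<bar> ^ (2 * k + 1) / fact (2 * k + 1) * (\<bar>1 / 4 - (norm \<xi>)\<^sup>2\<bar> ^ i * ((fact k * (4 / a) ^ k) * (exp (a / 16) * sqrt a ^ DIM('a) * gauss (2 / a) \<xi>)))"
    proof (intro mult_left_mono)
      have "\<bar>1 / 4 - (norm \<xi>)\<^sup>2\<bar> ^ k \<le> (1 / 4 + (norm \<xi>)\<^sup>2) ^ k"
        by (intro power_mono) (auto simp: abs_le_iff)
      also have "\<dots> \<le> fact k * (1 / (a / 4)) ^ k * exp (a / 4 * (1 / 4 + (norm \<xi>)\<^sup>2))"
        using assms by (intro power_le_fact_exp) auto
      finally have "\<bar>1 / 4 - (norm \<xi>)\<^sup>2\<bar> ^ k * gauss_hat a \<xi> \<le> fact k * (1 / (a / 4)) ^ k * exp (a / 4 * (1 / 4 + (norm \<xi>)\<^sup>2)) * gauss_hat a \<xi>"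
        using assms by (intro mult_right_mono) (auto simp: gauss_hat_def)
      also have "\<dots> = fact k * (4 / a) ^ k * (sqrt a ^ DIM('a) * (exp (a / 4 * (1 / 4 + (norm \<xi>)\<^sup>2)) * exp (- a * (norm \<xi>)\<^sup>2 / 2)))"
        by (simp add: gauss_hat_def)
      also have "exp (a / 4 * (1 / 4 + (norm \<xi>)\<^sup>2)) * exp (- a * (norm \<xi>)\<^sup>2 / 2) = exp (a / 16) * gauss (2 / a) \<xi>"
        unfolding gauss_def exp_add[symmetric] by (simp add: field_simps)
      finally show "\<bar>1 / 4 - (norm \<xi>)\<^sup>2\<bar> ^ k * gauss_hat a \<xi> \<le> (fact k * (4 / a) ^ k) * (exp (a / 16) * sqrt a ^ DIM('a) * gauss (2 / a) \<xi>)"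
        by (simp add: mult_ac)
    qed auto
    also have "\<dots> = \<bar>t\<bar> * (4 / a * t\<^sup>2) ^ k * h \<xi> * (fact k / fact (2 * k + 1))"
    proof -
      have t: "\<bar>t\<bar> ^ (2 * k + 1) = \<bar>t\<bar> * (t\<^sup>2) ^ k" by (simp add: power_mult)
      show ?thesis unfolding t h_def power_mult_distrib by simp
    qed
    also have "\<dots> \<le> \<bar>t\<bar> * (4 / a * t\<^sup>2) ^ k * h \<xi> * (1 / fact k)"
      using assms h0 by (intro mult_left_mono fact_quotient_le) auto
    finally show ?thesis by (simp add: divide_inverse mult_ac)
  qed
  note summ = sums_summable[OF exp_converges[of "4 / a * t\<^sup>2"]]
  have T: "(\<lambda>k. T k \<xi>) sums (complex_of_real (damped_symbol t \<xi> * ((1 / 4 - (norm \<xi>)\<^sup>2) ^ i * gauss_hat a \<xi>)) * cis (- (\<xi> \<bullet> x)))" for \<xi>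
  proof -
    have "(\<lambda>k. complex_of_real ((1 / 4 - (norm \<xi>)\<^sup>2) ^ k * (t ^ (2 * k + 1) / fact (2 * k + 1))) *
      (complex_of_real ((1 / 4 - (norm \<xi>)\<^sup>2) ^ i * gauss_hat a \<xi>) * cis (- (\<xi> \<bullet> x)))) sums
      (complex_of_real (damped_symbol t \<xi>) * (complex_of_real ((1 / 4 - (norm \<xi>)\<^sup>2) ^ i * gauss_hat a \<xi>) * cis (- (\<xi> \<bullet> x))))"
      by (intro sums_mult2 sums_of_real sums_damped_symbol)
    then show ?thesis unfolding T_def by (simp only: power_add of_real_mult mult_ac)
  qed
  have Tint: "integrable lborel (T k)" for k
    unfolding T_def by (intro integrable_mult_right wave_coeff_eq_sum(2) assms)
  have "summable (\<lambda>k. \<bar>t\<bar> * ((4 / a * t\<^sup>2) ^ k /\<^sub>R fact k) * integral\<^sup>L lborel h)"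
    by (intro summable_mult summable_mult2 summ)
  then have s2: "summable (\<lambda>k. LINT \<xi>|lborel. norm (T k \<xi>))"
  proof (rule summable_comparison_test'[where N=0])
    fix k
    have "(LINT \<xi>|lborel. norm (T k \<xi>)) \<le> (LINT \<xi>|lborel. \<bar>t\<bar> * ((4 / a * t\<^sup>2) ^ k /\<^sub>R fact k) * h \<xi>)"
      using hint Tint bound by (intro Bochner_Integration.integral_mono) auto
    then show "norm (LINT \<xi>|lborel. norm (T k \<xi>)) \<le> \<bar>t\<bar> * ((4 / a * t\<^sup>2) ^ k /\<^sub>R fact k) * integral\<^sup>L lborel h"
      by (simp add: integral_nonneg_AE)
  qed
  have s1: "summable (\<lambda>k. norm (T k \<xi>))" for \<xi>
    by (rule summable_comparison_test'[where N=0, OF summable_mult2[OF summable_mult[OF summ]]]) (use bound in auto)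
  have "integrable lborel (\<lambda>\<xi>. \<Sum>k. T k \<xi>)"
    by (rule integrable_suminf[OF Tint AE_I2 s2]) (rule s1)
  then show "integrable lborel (\<lambda>\<xi>. complex_of_real (damped_symbol t \<xi> * ((1 / 4 - (norm \<xi>)\<^sup>2) ^ i * gauss_hat a \<xi>)) * cis (- (\<xi> \<bullet> x)))"
    using sums_unique[OF T] by simp
  have "(\<lambda>k. integral\<^sup>L lborel (T k)) sums (LINT \<xi>|lborel. (\<Sum>k. T k \<xi>))"
    by (rule sums_integral[OF Tint AE_I2 s2]) (rule s1)
  then have "(\<lambda>k. of_real ((2 * pi) powr - (real DIM('a) / 2)) * integral\<^sup>L lborel (T k)) sums
      (of_real ((2 * pi) powr - (real DIM('a) / 2)) * (LINT \<xi>|lborel. (\<Sum>k. T k \<xi>)))"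
    by (rule sums_mult)
  moreover have "of_real ((2 * pi) powr - (real DIM('a) / 2)) * integral\<^sup>L lborel (T k) =
      wave_coeff a (k + i) x * (of_real t) ^ (2 * k + 1) / fact (2 * k + 1)" for k
    unfolding T_def integral_mult_right_zero wave_coeff_def fourier_def by (simp del: fact_Suc)
  moreover have "of_real ((2 * pi) powr - (real DIM('a) / 2)) * (LINT \<xi>|lborel. (\<Sum>k. T k \<xi>)) =
      fourier (\<lambda>\<xi>. complex_of_real (damped_symbol t \<xi> * ((1 / 4 - (norm \<xi>)\<^sup>2) ^ i * gauss_hat a \<xi>))) x"
    unfolding fourier_def using sums_unique[OF T] by simp
  ultimately show "fourier (\<lambda>\<xi>. complex_of_real (damped_symbol t \<xi> * ((1 / 4 - (norm \<xi>)\<^sup>2) ^ i * gauss_hat a \<xi>))) x =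
      wave_series (\<lambda>k. wave_coeff a (k + i) x) (of_real t)"
    unfolding wave_series_def by (simp add: sums_iff del: fact_Suc)
qed

section \<open>Pairings of slowly growing functions with the evolved Gaussians\<close>

lemma slowly_growing_integrable_poly_gauss:
  fixes v :: "'a::euclidean_space \<Rightarrow> real"
  assumes "slowly_growing v" "real_polynomial_function P" "a > 0"
  shows "integrable lborel (\<lambda>x. v x * (P x * gauss a x))"
proof -
  obtain k where k: "integrable lborel (\<lambda>x. v x /\<^sub>R (1 + norm x) ^ k)" and v: "v \<in> borel_measurable lborel"
    using assms unfolding slowly_growing_def by blast
  obtain C l where C: "C \<ge> 0" "\<And>x. \<bar>P x\<bar> \<le> C * (1 + norm x) ^ l"
    using real_polynomial_function_growth[OF assms(2)] by blast
  show ?thesis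
  proof (rule Bochner_Integration.integrable_bound)
    show "integrable lborel (\<lambda>x. (C * exp (real (k + l) ^ 2 * a)) * (v x /\<^sub>R (1 + norm x) ^ k))"
      by (intro integrable_mult_right k)
    have "P \<in> borel_measurable borel"
      using real_polynomial_function_continuous[OF assms(2)] by (rule borel_measurable_continuous_onI)
    then show "(\<lambda>x. v x * (P x * gauss a x)) \<in> borel_measurable lborel" using v by measurable
    have "norm (v x * (P x * gauss a x)) \<le> norm ((C * exp (real (k + l) ^ 2 * a)) * (v x /\<^sub>R (1 + norm x) ^ k))" for x
    proof -
      have p1: "1 + norm x > 0" by (simp add: add_pos_nonneg)
      then have p: "(1 + norm x) ^ k > 0" by simp
      have "\<bar>P x\<bar> * gauss a x \<le> C * ((1 + norm x) ^ l * gauss a x)"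
        using C(2)[of x] by (simp add: mult_right_mono flip: mult.assoc)
      also have "\<dots> = C * ((1 + norm x) ^ (k + l) * gauss a x) / (1 + norm x) ^ k"
        using p1 by (simp add: power_add less_imp_neq[THEN not_sym])
      also have "\<dots> \<le> C * exp (real (k + l) ^ 2 * a) / (1 + norm x) ^ k"
        using C(1) p assms by (intro divide_right_mono mult_left_mono gauss_decay) auto
      finally have "\<bar>v x\<bar> * (\<bar>P x\<bar> * gauss a x) \<le> \<bar>v x\<bar> * (C * exp (real (k + l) ^ 2 * a) / (1 + norm x) ^ k)"
        by (rule mult_left_mono) simp
      then show ?thesis using C(1) p by (simp add: abs_mult divide_inverse mult_ac)
    qed
    then show "AE x in lborel. norm (v x * (P x * gauss a x)) \<le> norm ((C * exp (real (k + l) ^ 2 * a)) * (v x /\<^sub>R (1 + norm x) ^ k))"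
      by (rule AE_I2)
  qed
qed

lemma slowly_growing_integrable_gauss:
  "slowly_growing v \<Longrightarrow> a > 0 \<Longrightarrow> integrable lborel (\<lambda>x. v x * gauss a x)"
  using slowly_growing_integrable_poly_gauss[of v "\<lambda>x. 1" a] by auto

lemma slowly_growing_measurable: "slowly_growing v \<Longrightarrow> v \<in> borel_measurable borel"
  by (simp add: slowly_growing_def)

lemma wave_coeff_measurable [measurable]: "wave_coeff a k \<in> borel_measurable (borel :: 'a::euclidean_space measure)"
proof -
  have c: "cis \<in> borel_measurable borel" by (intro borel_measurable_continuous_onI continuous_intros)
  have "(\<lambda>(x::'a). LINT \<xi>|lborel. complex_of_real ((1 / 4 - (norm \<xi>)\<^sup>2) ^ k * gauss_hat a (\<xi>::'a)) * cis (- (\<xi> \<bullet> x))) \<in> borel_measurable borel"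
    unfolding gauss_hat_def using c by measurable
  then show ?thesis unfolding wave_coeff_def fourier_def[abs_def] by measurable
qed

text \<open>These are the coefficients of the time series of the undamped pairing with
  \<open>gauss a\<close>: (1/4 + \<Delta>)^k is moved onto the Gaussian, so v may be as rough as it
  is.\<close>

definition pair_coeff :: "real \<Rightarrow> ('a::euclidean_space \<Rightarrow> real) \<Rightarrow> nat \<Rightarrow> complex" where
  "pair_coeff a v k = (LINT x|lborel. complex_of_real (v x) * wave_coeff a k x)"

lemma damped_apply:
  "damped t (dist_of v) \<phi> = of_real (exp (- t / 2)) *
     (LINT x|lborel. complex_of_real (v x) * fourier (\<lambda>\<xi>. complex_of_real (damped_symbol t \<xi>) * fourier_inv \<phi> \<xi>) x)"
  by (simp add: damped_def dist_fourier_inv_def dist_mult_def dist_fourier_def dist_of_def dist_of_cfun_def)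

lemma fourier_damped_gauss:
  fixes x :: "'a::euclidean_space"
  assumes "a > 0"
  shows "fourier (\<lambda>\<xi>. complex_of_real (damped_symbol t \<xi>) * fourier_inv (\<lambda>x. complex_of_real (gauss a x)) \<xi>) x =
      wave_series (\<lambda>k. wave_coeff a k x) (of_real t)"
    and "fourier (\<lambda>\<xi>. complex_of_real (damped_symbol t \<xi>) * fourier_inv (\<lambda>x. complex_of_real (neg_lap_gauss a x)) \<xi>) x =
      wave_series (\<lambda>k. wave_coeff a k x) (of_real t) / 4 - wave_series (\<lambda>k. wave_coeff a (Suc k) x) (of_real t)"
proof -
  define S where "S = (\<lambda>i (\<xi>::'a). complex_of_real (damped_symbol t \<xi> * ((1 / 4 - (norm \<xi>)\<^sup>2) ^ i * gauss_hat a \<xi>)))"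
  have S: "fourier (S i) x = wave_series (\<lambda>k. wave_coeff a (k + i) x) (of_real t)"
    "integrable lborel (\<lambda>\<xi>. S i \<xi> * cis (- (\<xi> \<bullet> x)))" for i
    unfolding S_def using fourier_damped_symbol[OF assms, of t i x] by auto
  have "complex_of_real (damped_symbol t \<xi>) * fourier_inv (\<lambda>x. complex_of_real (gauss a x)) \<xi> = S 0 \<xi>" for \<xi> :: 'a
    by (simp add: S_def fourier_inv_gauss[OF assms])
  then show "fourier (\<lambda>\<xi>. complex_of_real (damped_symbol t \<xi>) * fourier_inv (\<lambda>x. complex_of_real (gauss a x)) \<xi>) x =
      wave_series (\<lambda>k. wave_coeff a k x) (of_real t)"
    using S(1)[of 0] by (simp add: fun_eq_iff[symmetric])
  have eq: "complex_of_real (damped_symbol t \<xi>) * fourier_inv (\<lambda>x. complex_of_real (neg_lap_gauss a x)) \<xi> = S 0 \<xi> / 4 - S 1 \<xi>" for \<xi> :: 'a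
    by (simp add: S_def fourier_inv_neg_lap_gauss[OF assms] algebra_simps)
  have "(LINT \<xi>|lborel. (S 0 \<xi> / 4 - S 1 \<xi>) * cis (- (\<xi> \<bullet> x))) =
      (LINT \<xi>|lborel. S 0 \<xi> * cis (- (\<xi> \<bullet> x)) / 4 - S 1 \<xi> * cis (- (\<xi> \<bullet> x)))"
    by (simp add: algebra_simps)
  also have "\<dots> = (LINT \<xi>|lborel. S 0 \<xi> * cis (- (\<xi> \<bullet> x))) / 4 - (LINT \<xi>|lborel. S 1 \<xi> * cis (- (\<xi> \<bullet> x)))"
    using S(2)[of 0] S(2)[of 1] by (subst Bochner_Integration.integral_diff) auto
  finally have I: "(LINT \<xi>|lborel. (S 0 \<xi> / 4 - S 1 \<xi>) * cis (- (\<xi> \<bullet> x))) =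
      (LINT \<xi>|lborel. S 0 \<xi> * cis (- (\<xi> \<bullet> x))) / 4 - (LINT \<xi>|lborel. S 1 \<xi> * cis (- (\<xi> \<bullet> x)))" .
  have "fourier (\<lambda>\<xi>. S 0 \<xi> / 4 - S 1 \<xi>) x = fourier (S 0) x / 4 - fourier (S 1) x"
    unfolding fourier_def I right_diff_distrib times_divide_eq_right ..
  then show "fourier (\<lambda>\<xi>. complex_of_real (damped_symbol t \<xi>) * fourier_inv (\<lambda>x. complex_of_real (neg_lap_gauss a x)) \<xi>) x =
      wave_series (\<lambda>k. wave_coeff a k x) (of_real t) / 4 - wave_series (\<lambda>k. wave_coeff a (Suc k) x) (of_real t)"
    unfolding eq S(1) by simp
qed

definition damped_pair :: "(nat \<Rightarrow> complex) \<Rightarrow> real \<Rightarrow> complex" where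
  "damped_pair d t = of_real (exp (- t / 2)) * wave_series d (of_real t)"

definition damped_pair_deriv :: "(nat \<Rightarrow> complex) \<Rightarrow> real \<Rightarrow> complex" where
  "damped_pair_deriv d t = of_real (exp (- t / 2)) * (wave_series_deriv d (of_real t) - wave_series d (of_real t) / 2)"

context
  fixes v :: "'a::euclidean_space \<Rightarrow> real" and a :: real
  assumes v: "v \<in> borel_measurable borel" and a: "a \<ge> 16"
    and int: "integrable lborel (\<lambda>x. v x * gauss (9 * a / 2) x)"
begin

text \<open>The function v enters the bounds for its pairing coefficients through this number alone;
  the width is that of the majorant in \<open>norm_wave_coeff_le\<close>.\<close>

definition gauss_mass :: real where
  "gauss_mass = (LINT x|lborel. \<bar>v x\<bar> * gauss (9 * a / 2) x)"

lemma gauss_mass_nonneg: "gauss_mass \<ge> 0"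
  unfolding gauss_mass_def by (intro integral_nonneg_AE) auto

lemma integrable_gauss_mass: "integrable lborel (\<lambda>x. \<bar>v x\<bar> * gauss (9 * a / 2) x)"
  using integrable_abs[OF int] by (simp add: abs_mult)

lemma integrable_wave_coeff: "integrable lborel (\<lambda>x. complex_of_real (v x) * wave_coeff a k x)"
proof (rule Bochner_Integration.integrable_bound)
  show "integrable lborel (\<lambda>x. (2 * sqrt 2 ^ DIM('a) * fact k) * (\<bar>v x\<bar> * gauss (9 * a / 2) x))"
    by (intro integrable_mult_right integrable_gauss_mass)
  show "(\<lambda>x. complex_of_real (v x) * wave_coeff a k x) \<in> borel_measurable lborel" using v by measurable
  show "AE x in lborel. norm (complex_of_real (v x) * wave_coeff a k x) \<le> norm ((2 * sqrt 2 ^ DIM('a) * fact k) * (\<bar>v x\<bar> * gauss (9 * a / 2) x))"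
  proof (rule AE_I2)
    show "norm (complex_of_real (v x) * wave_coeff a k x) \<le> norm ((2 * sqrt 2 ^ DIM('a) * fact k) * (\<bar>v x\<bar> * gauss (9 * a / 2) x))" for x
      using mult_left_mono[OF norm_wave_coeff_le[OF a, of k x], of "\<bar>v x\<bar>"]
      by (simp add: norm_mult abs_mult mult_ac)
  qed
qed

lemma norm_pair_coeff_le: "norm (pair_coeff a v k) \<le> (2 * sqrt 2 ^ DIM('a) * gauss_mass) * 1 ^ k * fact k"
proof -
  have "norm (complex_of_real (v x) * wave_coeff a k x) \<le> (2 * sqrt 2 ^ DIM('a) * fact k) * (\<bar>v x\<bar> * gauss (9 * a / 2) x)" for x
    using mult_left_mono[OF norm_wave_coeff_le[OF a, of k x], of "\<bar>v x\<bar>"] by (simp add: norm_mult mult_ac)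
  then have "norm (pair_coeff a v k) \<le> (LINT x|lborel. (2 * sqrt 2 ^ DIM('a) * fact k) * (\<bar>v x\<bar> * gauss (9 * a / 2) x))"
    unfolding pair_coeff_def
    by (rule Bochner_Integration.integral_norm_bound_integral[OF integrable_wave_coeff integrable_mult_right[OF integrable_gauss_mass]])
  then have "norm (pair_coeff a v k) \<le> (2 * sqrt 2 ^ DIM('a) * fact k) * gauss_mass"
    unfolding gauss_mass_def integral_mult_right_zero .
  then show ?thesis by (simp add: mult_ac)
qed

lemma norm_pair_coeff_diff_le:
  "norm (pair_coeff a v k - (1 / 4) ^ k * pair_coeff a v 0) \<le> (16 / a * sqrt 2 ^ DIM('a) * gauss_mass) * 1 ^ k * fact k"
proof -
  have eq: "pair_coeff a v k - (1 / 4) ^ k * pair_coeff a v 0 =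
      (LINT x|lborel. complex_of_real (v x) * (wave_coeff a k x - of_real ((1 / 4) ^ k * gauss a x)))"
  proof -
    have "(LINT x|lborel. complex_of_real (v x) * wave_coeff a k x - (1 / 4) ^ k * (complex_of_real (v x) * wave_coeff a 0 x)) =
       pair_coeff a v k - (1 / 4) ^ k * pair_coeff a v 0"
      unfolding pair_coeff_def
      by (subst Bochner_Integration.integral_diff) (auto intro!: integrable_wave_coeff integrable_mult_right)
    then show ?thesis using a by (simp add: wave_coeff_0 algebra_simps)
  qed
  have "integrable lborel (\<lambda>x. complex_of_real (v x) * wave_coeff a k x - (1 / 4) ^ k * (complex_of_real (v x) * wave_coeff a 0 x))"
    by (intro Bochner_Integration.integrable_diff integrable_mult_right integrable_wave_coeff)
  then have i: "integrable lborel (\<lambda>x. complex_of_real (v x) * (wave_coeff a k x - of_real ((1 / 4) ^ k * gauss a x)))"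
    using a by (simp add: wave_coeff_0 algebra_simps)
  have "norm (complex_of_real (v x) * (wave_coeff a k x - of_real ((1 / 4) ^ k * gauss a x))) \<le>
      (16 / a * sqrt 2 ^ DIM('a) * fact k) * (\<bar>v x\<bar> * gauss (9 * a / 2) x)" for x
    using mult_left_mono[OF norm_wave_coeff_diff_le[OF a, of k x], of "\<bar>v x\<bar>"]
    unfolding norm_mult norm_of_real by (simp add: mult_ac)
  then have "norm (pair_coeff a v k - (1 / 4) ^ k * pair_coeff a v 0) \<le>
      (LINT x|lborel. (16 / a * sqrt 2 ^ DIM('a) * fact k) * (\<bar>v x\<bar> * gauss (9 * a / 2) x))"
    unfolding eq by (rule Bochner_Integration.integral_norm_bound_integral[OF i integrable_mult_right[OF integrable_gauss_mass]])
  then have "norm (pair_coeff a v k - (1 / 4) ^ k * pair_coeff a v 0) \<le> (16 / a * sqrt 2 ^ DIM('a) * fact k) * gauss_mass"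
    unfolding gauss_mass_def integral_mult_right_zero .
  then show ?thesis by (simp add: mult_ac)
qed

lemma pair_coeff_0: "pair_coeff a v 0 = of_real (LINT x|lborel. v x * gauss a x)"
  unfolding pair_coeff_def integral_complex_of_real[symmetric] using a by (simp add: wave_coeff_0)

lemma integral_wave_series:
  assumes "i \<le> 1"
  shows "(LINT x|lborel. complex_of_real (v x) * wave_series (\<lambda>k. wave_coeff a (k + i) x) z) =
      wave_series (\<lambda>k. pair_coeff a v (k + i)) z"
    and "integrable lborel (\<lambda>x. complex_of_real (v x) * wave_series (\<lambda>k. wave_coeff a (k + i) x) z)"
proof -
  define g where "g = (\<lambda>x::'a. 2 * sqrt 2 ^ DIM('a) * gauss (9 * a / 2) x)"
  define T where "T = (\<lambda>k x. complex_of_real (v x) * (wave_coeff a (k + i) x * z ^ (2 * k + 1) / fact (2 * k + 1)))"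
  have g: "g x \<ge> 0" for x by (simp add: g_def)
  \<comment> \<open>The shifted series still has to be dominated by an exponential series; for i = 1
    the extra factor k + 1 is absorbed by 2^k.\<close>
  have fi: "(fact (k + i) :: real) \<le> 2 ^ k * fact k" for k
  proof -
    have "real (Suc k) \<le> 2 ^ k" by (metis of_nat_le_iff of_nat_numeral of_nat_power Suc_leI less_exp)
    then show ?thesis using assms by (cases i) (auto simp: mult_right_mono)
  qed
  have wc: "norm (wave_coeff a (k + i) x) \<le> g x * 2 ^ k * fact k" for k x
  proof -
    have "norm (wave_coeff a (k + i) x) \<le> g x * fact (k + i)"
      using norm_wave_coeff_le[OF a, of "k + i" x] by (simp add: g_def mult_ac)
    also have "\<dots> \<le> g x * (2 ^ k * fact k)" by (intro mult_left_mono fi g)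
    finally show ?thesis by (simp add: mult_ac)
  qed
  have bound: "norm (T k x) \<le> (norm z * ((2 * (norm z)\<^sup>2) ^ k /\<^sub>R fact k)) * (\<bar>v x\<bar> * g x)" for k x
    using mult_left_mono[OF wave_series_term_le(2)[where d = "\<lambda>k. wave_coeff a (k + i) x" and z = z, OF wc g zero_le_numeral], of "\<bar>v x\<bar>"]
    unfolding T_def norm_mult[of "complex_of_real (v x)"] norm_of_real by (simp only: mult_ac)
  have vg: "integrable lborel (\<lambda>x. \<bar>v x\<bar> * g x)"
    using integrable_mult_right[OF integrable_gauss_mass, of "2 * sqrt 2 ^ DIM('a)"] by (simp add: g_def mult_ac)
  have Tint: "integrable lborel (T k)" for k
  proof -
    have "integrable lborel (\<lambda>x. (complex_of_real (v x) * wave_coeff a (k + i) x) * (z ^ (2 * k + 1) / fact (2 * k + 1)))"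
      by (intro integrable_mult_left integrable_wave_coeff)
    then show ?thesis by (simp add: T_def mult_ac del: fact_Suc)
  qed
  note summ = sums_summable[OF exp_converges[of "2 * (norm z)\<^sup>2"]]
  have s1: "summable (\<lambda>k. norm (T k x))" for x
    by (rule summable_comparison_test'[where N=0, OF summable_mult2[OF summable_mult[OF summ]]]) (use bound in simp)
  have s2: "summable (\<lambda>k. LINT x|lborel. norm (T k x))"
  proof (rule summable_comparison_test'[where N=0, OF summable_mult2[OF summable_mult[OF summ]]])
    fix k
    have "(LINT x|lborel. norm (T k x)) \<le> (LINT x|lborel. (norm z * ((2 * (norm z)\<^sup>2) ^ k /\<^sub>R fact k)) * (\<bar>v x\<bar> * g x))"
      using vg Tint bound by (intro Bochner_Integration.integral_mono integrable_mult_right) auto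
    then show "norm (LINT x|lborel. norm (T k x)) \<le> norm z * ((2 * (norm z)\<^sup>2) ^ k /\<^sub>R fact k) * (LINT x|lborel. \<bar>v x\<bar> * g x)"
      by (simp add: integral_nonneg_AE)
  qed
  have "summable (\<lambda>k. wave_coeff a (k + i) x * z ^ (2 * k + 1) / fact (2 * k + 1))" for x :: 'a
    by (rule summable_norm_cancel[OF summable_wave_series[of "\<lambda>k. wave_coeff a (k + i) x", OF wc g zero_le_numeral]])
  then have T: "(\<Sum>k. T k x) = complex_of_real (v x) * wave_series (\<lambda>k. wave_coeff a (k + i) x) z" for x
    unfolding T_def wave_series_def by (rule suminf_mult)
  show "integrable lborel (\<lambda>x. complex_of_real (v x) * wave_series (\<lambda>k. wave_coeff a (k + i) x) z)"
    unfolding T[symmetric] by (rule integrable_suminf[OF Tint AE_I2 s2]) (rule s1)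
  have Tk: "integral\<^sup>L lborel (T k) = pair_coeff a v (k + i) * z ^ (2 * k + 1) / fact (2 * k + 1)" for k
  proof -
    have "integral\<^sup>L lborel (T k) = (LINT x|lborel. (complex_of_real (v x) * wave_coeff a (k + i) x) * (z ^ (2 * k + 1) / fact (2 * k + 1)))"
      by (simp add: T_def mult_ac del: fact_Suc)
    then show ?thesis unfolding pair_coeff_def integral_mult_left_zero by simp
  qed
  have "(LINT x|lborel. (\<Sum>k. T k x)) = (\<Sum>k. integral\<^sup>L lborel (T k))"
    by (rule integral_suminf[OF Tint AE_I2 s2]) (rule s1)
  then show "(LINT x|lborel. complex_of_real (v x) * wave_series (\<lambda>k. wave_coeff a (k + i) x) z) =
      wave_series (\<lambda>k. pair_coeff a v (k + i)) z"
    unfolding T Tk wave_series_def[of "\<lambda>k. pair_coeff a v (k + i)"] .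
qed

lemma damped_gauss:
  "damped t (dist_of v) (\<lambda>x. complex_of_real (gauss a x)) = damped_pair (pair_coeff a v) t"
  unfolding damped_apply damped_pair_def using a integral_wave_series(1)[of 0 "of_real t"]
  by (subst fourier_damped_gauss) auto

lemma damped_neg_lap_gauss:
  "damped t (dist_of v) (\<lambda>x. complex_of_real (neg_lap_gauss a x)) =
     damped_pair (pair_coeff a v) t / 4 - damped_pair (\<lambda>k. pair_coeff a v (Suc k)) t"
proof -
  have "(LINT x|lborel. complex_of_real (v x) *
      (wave_series (\<lambda>k. wave_coeff a k x) (of_real t) / 4 - wave_series (\<lambda>k. wave_coeff a (Suc k) x) (of_real t))) =
      (LINT x|lborel. complex_of_real (v x) * wave_series (\<lambda>k. wave_coeff a k x) (of_real t) / 4 -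
         complex_of_real (v x) * wave_series (\<lambda>k. wave_coeff a (Suc k) x) (of_real t))"
    by (simp add: algebra_simps)
  also have "\<dots> = wave_series (pair_coeff a v) (of_real t) / 4 - wave_series (\<lambda>k. pair_coeff a v (Suc k)) (of_real t)"
    using integral_wave_series[of 0 "of_real t"] integral_wave_series[of 1 "of_real t"]
    by (subst Bochner_Integration.integral_diff) auto
  finally have I: "(LINT x|lborel. complex_of_real (v x) *
      (wave_series (\<lambda>k. wave_coeff a k x) (of_real t) / 4 - wave_series (\<lambda>k. wave_coeff a (Suc k) x) (of_real t))) =
      wave_series (pair_coeff a v) (of_real t) / 4 - wave_series (\<lambda>k. pair_coeff a v (Suc k)) (of_real t)" .
  have "a > 0" using a by simp
  then show ?thesis
    unfolding damped_apply damped_pair_def fourier_damped_gauss(2)[OF \<open>a > 0\<close>] I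
    by (simp only: right_diff_distrib times_divide_eq_right)
qed

end

text \<open>If f'' is the shift of f and g(t) = exp (-t/2) f(t), then g'' + g' is the shift of g
  minus g/4. As the shift stands for 1/4 + \<Delta>, this is the damped wave equation for the
  pairing.\<close>

lemma
  fixes d :: "nat \<Rightarrow> complex"
  assumes d: "\<And>k. norm (d k) \<le> B * R ^ k * fact k" and B: "0 \<le> B" and R: "0 \<le> R"
  shows damped_pair_has_derivative: "(damped_pair d has_vector_derivative damped_pair_deriv d t) (at t)"
    and damped_pair_deriv_has_derivative: "(damped_pair_deriv d has_vector_derivative
      damped_pair (\<lambda>k. d (Suc k)) t - damped_pair d t / 4 - damped_pair_deriv d t) (at t)"
    and norm_damped_pair_le: "t \<ge> 0 \<Longrightarrow> norm (damped_pair d t) \<le> B * (t * exp (R * t\<^sup>2))"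
proof -
  have e: "((\<lambda>t. complex_of_real (exp (- t / 2))) has_vector_derivative of_real (- exp (- t / 2) / 2)) (at t)" for t
    by (intro has_vector_derivative_of_real) (auto intro!: derivative_eq_intros simp flip: has_real_derivative_iff_has_vector_derivative)
  have w: "((\<lambda>t. wave_series d (of_real t)) has_vector_derivative wave_series_deriv d (of_real t)) (at t)" for t
    by (rule has_vector_derivative_real_field[OF DERIV_wave_series[OF d B R]])
  have w': "((\<lambda>t. wave_series_deriv d (of_real t)) has_vector_derivative wave_series (\<lambda>k. d (Suc k)) (of_real t)) (at t)" for t
    by (rule has_vector_derivative_real_field[OF DERIV_wave_series_deriv[OF d B R]])
  show "(damped_pair d has_vector_derivative damped_pair_deriv d t) (at t)"
    unfolding damped_pair_def[abs_def] damped_pair_deriv_def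
    by (rule has_vector_derivative_eq_rhs[OF has_vector_derivative_mult[OF e w]]) (simp add: algebra_simps)
  show "(damped_pair_deriv d has_vector_derivative
      damped_pair (\<lambda>k. d (Suc k)) t - damped_pair d t / 4 - damped_pair_deriv d t) (at t)"
    unfolding damped_pair_def damped_pair_deriv_def[abs_def]
    by (rule has_vector_derivative_eq_rhs[OF has_vector_derivative_mult[OF e has_vector_derivative_diff[OF w' has_vector_derivative_divide[OF w]]]])
      (simp add: field_simps)
  assume "t \<ge> 0"
  have "norm (damped_pair d t) = exp (- t / 2) * norm (wave_series d (of_real t))"
    by (simp add: damped_pair_def norm_mult)
  also have "\<dots> \<le> 1 * (B * norm (complex_of_real t) * exp (R * (norm (complex_of_real t))\<^sup>2))"
    using \<open>t \<ge> 0\<close> by (intro mult_mono norm_wave_series_le[OF d B R]) auto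
  finally show "norm (damped_pair d t) \<le> B * (t * exp (R * t\<^sup>2))"
    using \<open>t \<ge> 0\<close> by simp
qed

section \<open>A priori control of the nonlinearity\<close>

lemma gauss_L2:
  fixes x :: "'a::euclidean_space"
  assumes "a > 0"
  shows "(LINT x|lborel. (cmod (complex_of_real (gauss a (x::'a))))\<^sup>2) = sqrt (pi * a) ^ DIM('a)"
    and "integrable lborel (\<lambda>x::'a. (cmod (complex_of_real (gauss a x)))\<^sup>2)"
proof -
  have eq: "(cmod (complex_of_real (gauss a x)))\<^sup>2 = gauss (a / 2) x" for x :: 'a
    by (simp add: gauss_def power2_eq_square flip: exp_add)
  show "(LINT x|lborel. (cmod (complex_of_real (gauss a (x::'a))))\<^sup>2) = sqrt (pi * a) ^ DIM('a)"
    unfolding eq using integral_gauss[of "a / 2", where 'a='a] assms by simp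
  show "integrable lborel (\<lambda>x::'a. (cmod (complex_of_real (gauss a x)))\<^sup>2)"
    unfolding eq using assms by (intro integrable_gauss) simp
qed

text \<open>Each step gains the summable factor \<open>r\<^sup>-\<^sup>j\<close>, which in the limit beats the growth of \<open>m\<close>,
  so that the bound does not depend on \<open>\<Gamma>\<close> and \<open>\<mu>\<close>.\<close>

lemma iterate_bound:
  fixes m :: "nat \<Rightarrow> real"
  assumes step: "\<And>j. m j \<le> \<alpha> * \<beta> ^ j + m (Suc j) / (r ^ j * (2 * \<beta>))"
    and growth: "\<And>j. m j \<le> \<Gamma> * \<mu> ^ j"
    and "\<beta> \<ge> 1" "r > 1" "\<alpha> \<ge> 0" "\<Gamma> \<ge> 0" "\<mu> \<ge> 0"
  shows "m 0 \<le> 2 * \<alpha>"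
proof -
  \<comment> \<open>The product of the factors collected in J applications of \<open>step\<close>.
    The 2 in 2 \<beta> makes P J \<beta>^J at most 2^-J, and the geometric sum is the 2 in the
    conclusion.\<close>
  define P where "P = (\<lambda>J. \<Prod>i<J. 1 / (r ^ i * (2 * \<beta>)))"
  have P0: "P J > 0" for J unfolding P_def using assms by (intro prod_pos) auto
  have PS: "P (Suc J) = P J * (1 / (r ^ J * (2 * \<beta>)))" for J by (simp add: P_def)
  have Pb: "P J * \<beta> ^ J \<le> (1 / 2) ^ J" for J
  proof (induction J)
    case (Suc J)
    have "P (Suc J) * \<beta> ^ Suc J = (P J * \<beta> ^ J) * (1 / 2 * (1 / r ^ J))"
      using assms by (simp add: PS)
    also have "\<dots> \<le> (1 / 2) ^ J * (1 / 2 * 1)"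
      using assms P0[of J] by (intro mult_mono Suc.IH) (auto simp: less_imp_le)
    finally show ?case by simp
  qed (simp add: P_def)
  have un: "m 0 \<le> \<alpha> * (\<Sum>i<J. (1 / 2) ^ i) + P J * m J" for J
  proof (induction J)
    case (Suc J)
    have "P J * m J \<le> P J * (\<alpha> * \<beta> ^ J + m (Suc J) / (r ^ J * (2 * \<beta>)))"
      using step P0 by (intro mult_left_mono) (auto simp: less_imp_le)
    also have "\<dots> = \<alpha> * (P J * \<beta> ^ J) + P (Suc J) * m (Suc J)"
      by (simp add: PS algebra_simps)
    also have "\<dots> \<le> \<alpha> * (1 / 2) ^ J + P (Suc J) * m (Suc J)"
      using Pb \<open>\<alpha> \<ge> 0\<close> by (intro add_right_mono mult_left_mono) auto
    finally show ?case using Suc.IH by (simp add: algebra_simps)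
  qed (simp add: P_def)
  have geo: "(\<Sum>i<J. (1 / 2 :: real) ^ i) \<le> 2" for J
  proof -
    have "(\<Sum>i<J. (1 / 2 :: real) ^ i) = 2 - 2 * (1 / 2) ^ J" by (induction J) auto
    then show ?thesis by simp
  qed
  \<comment> \<open>Successive terms have quotient \<mu> / (2 \<beta> r^J), which tends to 0
    whatever \<mu> is. Hence the remainder disappears in the limit.\<close>
  have "summable (\<lambda>J. P J * \<mu> ^ J)"
  proof -
    have "(\<lambda>J. \<mu> / (2 * \<beta>) * inverse (r ^ J)) \<longlonglongrightarrow> \<mu> / (2 * \<beta>) * 0"
      using assms by (intro tendsto_intros LIMSEQ_inverse_realpow_zero)
    then have "\<forall>\<^sub>F J in sequentially. \<mu> / (2 * \<beta>) * inverse (r ^ J) < 1 / 2"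
      by (intro order_tendstoD) auto
    then obtain N where N: "\<And>J. J \<ge> N \<Longrightarrow> \<mu> / (2 * \<beta>) * inverse (r ^ J) < 1 / 2"
      by (auto simp: eventually_sequentially)
    show ?thesis
    proof (rule summable_ratio_test[where c = "1 / 2" and N = N])
      fix J assume "N \<le> J"
      have "P (Suc J) * \<mu> ^ Suc J = (\<mu> / (2 * \<beta>) * inverse (r ^ J)) * (P J * \<mu> ^ J)"
        by (simp add: PS field_simps)
      also have "\<dots> \<le> 1 / 2 * (P J * \<mu> ^ J)"
        using N[OF \<open>N \<le> J\<close>] P0[of J] assms by (intro mult_right_mono) auto
      finally show "norm (P (Suc J) * \<mu> ^ Suc J) \<le> 1 / 2 * norm (P J * \<mu> ^ J)"
        using P0[of J] P0[of "Suc J"] assms by (simp add: abs_mult)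
    qed simp
  qed
  then have "(\<lambda>J. 2 * \<alpha> + \<Gamma> * (P J * \<mu> ^ J)) \<longlonglongrightarrow> 2 * \<alpha> + \<Gamma> * 0"
    by (intro tendsto_intros summable_LIMSEQ_zero)
  moreover have "m 0 \<le> 2 * \<alpha> + \<Gamma> * (P J * \<mu> ^ J)" for J
  proof -
    have "m 0 \<le> \<alpha> * (\<Sum>i<J. (1 / 2) ^ i) + P J * m J" by (rule un)
    also have "\<dots> \<le> \<alpha> * 2 + P J * (\<Gamma> * \<mu> ^ J)"
      using P0[of J] assms by (intro add_mono mult_left_mono geo growth) auto
    finally show ?thesis by (simp add: mult_ac)
  qed
  ultimately show ?thesis by (simp add: Lim_bounded2[where N = 0])
qed

text \<open>Rescaling by sqrt a reduces to width 1. The polynomial growth in a makes masses along a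
  geometric sequence of widths at most exponential, as \<open>iterate_bound\<close> demands.\<close>

lemma polynomial_gauss_growth:
  fixes x :: "'a::euclidean_space"
  assumes "a \<ge> 1"
  shows "gauss a x \<le> exp ((real k)\<^sup>2) * a ^ k / (1 + norm x) ^ k"
proof -
  define y where "y = x /\<^sub>R sqrt a"
  have sa: "sqrt a \<ge> 1" "sqrt a \<le> a" using assms by (auto simp: real_le_lsqrt power2_eq_square)
  have y: "norm x = sqrt a * norm y" using assms by (simp add: y_def)
  have "gauss a x = gauss 1 y"
    using assms by (simp add: gauss_def y power_mult_distrib)
  have "1 + norm x \<le> a * (1 + norm y)"
    using sa assms mult_right_mono[OF sa(2), of "norm y"] by (simp add: y algebra_simps)
  then have "(1 + norm x) ^ k \<le> (a * (1 + norm y)) ^ k"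
    by (intro power_mono) auto
  then have "(1 + norm x) ^ k * gauss a x \<le> (a * (1 + norm y)) ^ k * gauss a x"
    by (intro mult_right_mono) auto
  also have "\<dots> = a ^ k * ((1 + norm y) ^ k * gauss 1 y)"
    by (simp add: \<open>gauss a x = gauss 1 y\<close> power_mult_distrib)
  also have "\<dots> \<le> a ^ k * exp ((real k)\<^sup>2 * 1)"
    using assms by (intro mult_left_mono gauss_decay) auto
  finally have "(1 + norm x) ^ k * gauss a x \<le> exp ((real k)\<^sup>2) * a ^ k" by (simp add: mult_ac)
  moreover have "(1 + norm x) ^ k > 0" by (simp add: add_pos_nonneg)
  ultimately show ?thesis by (simp add: field_simps)
qed

text \<open>Split d k into (1/4)^k d 0 and a remainder. The first part sums to d 0 times the symbol
  at frequency zero, 2 sinh (h/2), which is positive; the remainder is a series with small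
  coefficients.\<close>

lemma wave_series_lower_bound:
  assumes "h \<ge> 0" "B \<ge> 0" and d: "\<And>k. norm (d k - (1 / 4) ^ k * d 0) \<le> B * 1 ^ k * fact k"
  shows "h * norm (d 0) \<le> norm (wave_series d (of_real h)) + B * (h * exp (h\<^sup>2))"
proof -
  define e where "e = (\<lambda>k. d k - (1 / 4) ^ k * d 0)"
  define f where "f = (\<lambda>k::nat. complex_of_real ((1 / 4) ^ k * (h ^ (2 * k + 1) / fact (2 * k + 1))))"
  have sy: "(\<lambda>k. (1 / 4) ^ k * (h ^ (2 * k + 1) / fact (2 * k + 1))) sums damped_symbol h (0::real)"
    using sums_damped_symbol[of "0::real" h] by simp
  then have f: "(\<lambda>k. f k * d 0) sums (of_real (damped_symbol h (0::real)) * d 0)"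
    unfolding f_def by (intro sums_mult2 sums_of_real)
  have "summable (\<lambda>k. norm (e k * of_real h ^ (2 * k + 1) / fact (2 * k + 1)))"
    using summable_wave_series[of e B 1 "of_real h"] d assms by (simp add: e_def)
  then have e: "(\<lambda>k. e k * of_real h ^ (2 * k + 1) / fact (2 * k + 1)) sums wave_series e (of_real h)"
    using summable_sums[OF summable_norm_cancel] by (simp only: wave_series_def)
  have "e k * of_real h ^ (2 * k + 1) / fact (2 * k + 1) + f k * d 0 = d k * of_real h ^ (2 * k + 1) / fact (2 * k + 1)" for k
  proof -
    have "f k = (1 / 4) ^ k * of_real h ^ (2 * k + 1) / fact (2 * k + 1)"
      unfolding f_def of_real_mult of_real_divide of_real_power of_real_fact by simp
    then show ?thesis
      unfolding e_def left_diff_distrib diff_divide_distrib by (simp del: fact_Suc power_Suc)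
  qed
  with sums_add[OF e f] have "(\<lambda>k. d k * of_real h ^ (2 * k + 1) / fact (2 * k + 1)) sums
      (wave_series e (of_real h) + of_real (damped_symbol h (0::real)) * d 0)"
    by (simp only:)
  then have eq: "wave_series d (of_real h) = wave_series e (of_real h) + of_real (damped_symbol h (0::real)) * d 0"
    unfolding wave_series_def by (simp only: sums_iff)
  \<comment> \<open>All terms are nonnegative, so the symbol is at least its first term, h.\<close>
  have "(\<Sum>k\<in>{0}. (1 / 4) ^ k * (h ^ (2 * k + 1) / fact (2 * k + 1))) \<le> damped_symbol h (0::real)"
    unfolding sums_unique[OF sy] using assms by (intro sum_le_suminf sums_summable[OF sy]) auto
  then have "h * norm (d 0) \<le> damped_symbol h (0::real) * norm (d 0)" by (intro mult_right_mono) auto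
  also have "\<dots> \<le> norm (of_real (damped_symbol h (0::real)) * d 0)" unfolding norm_mult norm_of_real by (intro mult_right_mono) auto
  also have "of_real (damped_symbol h (0::real)) * d 0 = wave_series d (of_real h) - wave_series e (of_real h)"
    using eq by simp
  also have "norm (wave_series d (of_real h) - wave_series e (of_real h)) \<le> norm (wave_series d (of_real h)) + norm (wave_series e (of_real h))"
    by (rule norm_triangle_ineq4)
  also have "norm (wave_series e (of_real h)) \<le> B * (h * exp (h\<^sup>2))"
    using norm_wave_series_le[of e B 1 "of_real h"] d assms by (simp add: e_def mult_ac)
  finally show ?thesis by simp
qed

text \<open>One step of the widening: the mass at width a is bounded by the observed pairing plus
  16/a times a mass at width 9a/2. The root multiplying A is the L^2 norm of \<open>gauss a\<close>.
  Nonnegativity of w identifies the pairing with the mass of its modulus.\<close>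

lemma gauss_mass_step:
  fixes w :: "'a::euclidean_space \<Rightarrow> real"
  assumes w: "slowly_growing w" "\<And>x. w x \<ge> 0" and \<sigma>: "\<bar>\<sigma>\<bar> = 1" and a: "a \<ge> 16" and h: "h \<ge> 0"
    and A: "norm (damped h (dist_of (\<lambda>x. \<sigma> * w x)) (\<lambda>x. complex_of_real (gauss a x))) \<le> A * sqrt (sqrt (pi * a) ^ DIM('a))"
  shows "h * (LINT x|lborel. w x * gauss a x) \<le>
    exp (h / 2) * (A * sqrt (sqrt (pi * a) ^ DIM('a))) + 16 / a * sqrt 2 ^ DIM('a) * (LINT x|lborel. w x * gauss (9 * a / 2) x) * (h * exp (h\<^sup>2))"
proof -
  define v where "v = (\<lambda>x. \<sigma> * w x)"
  have v: "v \<in> borel_measurable borel" unfolding v_def using slowly_growing_measurable[OF w(1)] by measurable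
  have int: "integrable lborel (\<lambda>x. v x * gauss (9 * a / 2) x)"
    unfolding v_def using integrable_mult_right[OF slowly_growing_integrable_gauss[OF w(1), of "9 * a / 2"], of \<sigma>] a
    by (simp add: mult_ac)
  have abs_v: "\<bar>v x\<bar> = w x" for x using \<sigma> w(2)[of x] by (simp add: v_def abs_mult)
  have mass: "gauss_mass v a = (LINT x|lborel. w x * gauss (9 * a / 2) x)"
    unfolding gauss_mass_def[OF v a int] abs_v ..
  have "(LINT x|lborel. v x * gauss a x) = \<sigma> * (LINT x|lborel. w x * gauss a x)"
    unfolding v_def by (simp add: mult.assoc)
  then have d0: "norm (pair_coeff a v 0) = (LINT x|lborel. w x * gauss a x)"
    unfolding pair_coeff_0[OF v a int] using \<sigma> w(2) by (simp add: norm_mult abs_mult integral_nonneg_AE)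
  have "h * norm (pair_coeff a v 0) \<le> norm (wave_series (pair_coeff a v) (of_real h)) +
      16 / a * sqrt 2 ^ DIM('a) * gauss_mass v a * (h * exp (h\<^sup>2))"
    using a gauss_mass_nonneg[OF v a int]
    by (intro wave_series_lower_bound h norm_pair_coeff_diff_le[OF v a int]) auto
  also have "norm (wave_series (pair_coeff a v) (of_real h)) = exp (h / 2) * norm (damped h (dist_of v) (\<lambda>x. complex_of_real (gauss a x)))"
    unfolding damped_gauss[OF v a int] damped_pair_def by (simp add: norm_mult flip: exp_add)
  also have "\<dots> \<le> exp (h / 2) * (A * sqrt (sqrt (pi * a) ^ DIM('a)))"
    using A by (intro mult_left_mono) (auto simp: v_def)
  finally show ?thesis unfolding d0 mass by simp
qed

text \<open>Far from \<open>h = 0\<close> the pairing of \<open>\<D>(h) w\<close> with a wide Gaussian controls \<open>w\<close> locally: up to an error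
  of relative size \<open>1/a\<close>, which is absorbed by passing to wider and wider Gaussians, \<open>\<D>(h)\<close> multiplies
  \<open>gauss a\<close> by a positive number.\<close>

lemma gauss_mass_le:
  fixes \<delta> H amin :: real
  assumes "0 < \<delta>" "\<delta> \<le> H"
  shows "\<exists>a C. a \<ge> amin \<and> a \<ge> 16 \<and> C \<ge> 0 \<and> (\<forall>h \<sigma> A (w :: 'a::euclidean_space \<Rightarrow> real). \<delta> \<le> h \<and> h \<le> H \<and> A \<ge> 0 \<and> \<bar>\<sigma>\<bar> = 1 \<and>
      slowly_growing w \<and> (\<forall>x. w x \<ge> 0) \<and>
      (\<forall>a\<ge>16. norm (damped h (dist_of (\<lambda>x. \<sigma> * w x)) (\<lambda>x. complex_of_real (gauss a x))) \<le> A * sqrt (sqrt (pi * a) ^ DIM('a))) \<longrightarrow>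
      (LINT x|lborel. w x * gauss a x) \<le> C * A)"
proof -
  define n where "n = DIM('a)"
  \<comment> \<open>The growth of (pi b)^n, a crude bound for the L^2 norm of the Gaussian of width
    b, when b is multiplied by 9/2.\<close>
  define \<beta> where "\<beta> = (9 / 2 :: real) ^ n"
  define C' where "C' = 16 * sqrt 2 ^ n * exp (H\<^sup>2)"
  \<comment> \<open>At width a the error factor C'/a is then at most 1/(2 \<beta>), and each further
    widening improves it by 2/9. The entry \<open>amin\<close> lets the caller dominate a prescribed
    Gaussian.\<close>
  define a where "a = max (max amin 16) (2 * \<beta> * C')"
  define C where "C = 2 * (exp (H / 2) / \<delta> * (pi * a) ^ n)"
  have \<beta>: "\<beta> \<ge> 1" by (simp add: \<beta>_def)
  have a: "a \<ge> amin" "a \<ge> 16" "a \<ge> 2 * \<beta> * C'" by (auto simp: a_def)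
  have C'0: "C' \<ge> 0" by (simp add: C'_def)
  have C0: "C \<ge> 0" using a assms by (auto simp: C_def)
  have main: "(LINT x|lborel. w x * gauss a x) \<le> C * A"
    if h: "\<delta> \<le> h" "h \<le> H" and A: "A \<ge> 0" and \<sigma>: "\<bar>\<sigma>\<bar> = 1" and w: "slowly_growing w" "\<And>x. w x \<ge> 0"
      and pair: "\<And>a. a \<ge> 16 \<Longrightarrow> norm (damped h (dist_of (\<lambda>x. \<sigma> * w x)) (\<lambda>x. complex_of_real (gauss a x))) \<le> A * sqrt (sqrt (pi * a) ^ DIM('a))"
    for h \<sigma> A and w :: "'a \<Rightarrow> real"
  proof -
    have h0: "h > 0" using h assms by simp
    define M where "M = (\<lambda>b. LINT x|lborel. w x * gauss b x)"
    have M0: "M b \<ge> 0" for b unfolding M_def using w by (intro integral_nonneg_AE) auto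
    define b where "b = (\<lambda>j::nat. a * (9 / 2) ^ j)"
    have b: "b j \<ge> a" "b j \<ge> 16" "b (Suc j) = 9 * b j / 2" for j
    proof -
      have "a * 1 \<le> a * (9 / 2) ^ j" using a by (intro mult_left_mono one_le_power) auto
      then show "b j \<ge> a" by (simp add: b_def)
      then show "b j \<ge> 16" using a by simp
      show "b (Suc j) = 9 * b j / 2" by (simp add: b_def)
    qed
    have step: "M (b j) \<le> (exp (H / 2) / \<delta> * (pi * a) ^ n * A) * \<beta> ^ j + M (b (Suc j)) / ((9 / 2) ^ j * (2 * \<beta>))" for j
    proof -
      have pb: "pi * b j \<ge> 1" using mult_mono[of 1 pi 1 "b j"] b(2)[of j] pi_gt3 by simp
      have s: "sqrt (sqrt (pi * b j) ^ n) \<le> (pi * b j) ^ n"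
      proof -
        have sq: "sqrt y \<le> y" if "y \<ge> 1" for y :: real
          using that mult_left_mono[of 1 y y] by (intro real_le_lsqrt) (auto simp: power2_eq_square)
        have "sqrt (sqrt (pi * b j) ^ n) \<le> sqrt (pi * b j) ^ n"
          using pb by (intro sq one_le_power) simp
        also have "\<dots> \<le> (pi * b j) ^ n"
          using pb by (intro power_mono sq) auto
        finally show ?thesis .
      qed
      have "h * M (b j) \<le> exp (h / 2) * (A * sqrt (sqrt (pi * b j) ^ n)) + 16 / b j * sqrt 2 ^ n * M (b (Suc j)) * (h * exp (h\<^sup>2))"
        unfolding M_def n_def b(3) using gauss_mass_step[OF w \<sigma> b(2) _ pair[OF b(2)]] h0 by simp
      then have "M (b j) \<le> exp (h / 2) / h * (A * sqrt (sqrt (pi * b j) ^ n)) + 16 * sqrt 2 ^ n * exp (h\<^sup>2) / b j * M (b (Suc j))"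
        using h0 by (simp add: field_simps)
      also have "\<dots> \<le> exp (H / 2) / \<delta> * (A * (pi * b j) ^ n) + C' / b j * M (b (Suc j))"
        unfolding C'_def using h h0 assms A s M0 b(2)[of j]
        by (intro add_mono mult_mono frac_le divide_right_mono mult_left_mono) (auto intro!: power_mono)
      also have "C' / b j * M (b (Suc j)) \<le> 1 / ((9 / 2) ^ j * (2 * \<beta>)) * M (b (Suc j))"
      proof (intro mult_right_mono M0)
        have "C' * (2 * \<beta>) \<le> a" using a(3) by (simp add: mult_ac)
        then have "C' * (2 * \<beta>) * (9 / 2) ^ j \<le> b j" unfolding b_def by (intro mult_right_mono) auto
        then show "C' / b j \<le> 1 / ((9 / 2) ^ j * (2 * \<beta>))"
          using b(2)[of j] \<beta> by (simp add: divide_simps mult_ac)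
      qed
      also have "(pi * b j) ^ n = (pi * a) ^ n * \<beta> ^ j"
        by (simp add: b_def \<beta>_def power_mult_distrib power_mult[symmetric] mult.commute)
      finally show ?thesis by (simp add: mult_ac)
    qed
    obtain k where k: "integrable lborel (\<lambda>x. w x /\<^sub>R (1 + norm x) ^ k)"
      using w(1) unfolding slowly_growing_def by blast
    define G where "G = (LINT x|lborel. w x /\<^sub>R (1 + norm x) ^ k)"
    have G0: "G \<ge> 0" unfolding G_def using w by (intro integral_nonneg_AE) auto
    \<comment> \<open>Here G and k depend on w and admit no uniform control. They are only used to
      make the iteration converge and drop out of its result, so C is the same for every w.\<close>
    have growth: "M (b j) \<le> (exp ((real k)\<^sup>2) * a ^ k * G) * ((9 / 2) ^ k) ^ j" for j
    proof -
      have "M (b j) \<le> (LINT x|lborel. (exp ((real k)\<^sup>2) * b j ^ k) * (w x /\<^sub>R (1 + norm x) ^ k))"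
        unfolding M_def
      proof (rule Bochner_Integration.integral_mono)
        show "integrable lborel (\<lambda>x. w x * gauss (b j) x)"
          using b(2)[of j] by (intro slowly_growing_integrable_gauss w) auto
        show "integrable lborel (\<lambda>x. (exp ((real k)\<^sup>2) * b j ^ k) * (w x /\<^sub>R (1 + norm x) ^ k))"
          by (intro integrable_mult_right k)
        show "w x * gauss (b j) x \<le> (exp ((real k)\<^sup>2) * b j ^ k) * (w x /\<^sub>R (1 + norm x) ^ k)" for x
          using mult_left_mono[OF polynomial_gauss_growth[of "b j" x k] w(2)[of x]] b(2)[of j]
          by (simp add: divide_inverse mult_ac)
      qed
      also have "\<dots> = exp ((real k)\<^sup>2) * b j ^ k * G" unfolding G_def by (rule integral_mult_right_zero)
      also have "b j ^ k = a ^ k * ((9 / 2) ^ k) ^ j"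
        by (simp add: b_def power_mult_distrib power_mult[symmetric] mult.commute)
      finally show ?thesis by (simp add: mult_ac)
    qed
    have "M (b 0) \<le> 2 * (exp (H / 2) / \<delta> * (pi * a) ^ n * A)"
      by (rule iterate_bound[OF step growth]) (use \<beta> a G0 A assms in auto)
    then show ?thesis by (simp add: b_def M_def C_def mult_ac)
  qed
  show ?thesis using a C0 main by blast
qed

section \<open>The tested equation\<close>

text \<open>Cauchy-Schwarz for each representative, followed by the infimum. If S has no
  representative in L^2, the infimum is over the empty set and hence infinite.\<close>

lemma norm_pairing_le_L2_norm:
  fixes S :: "'a::euclidean_space dist"
  assumes \<phi>: "\<phi> \<in> schwartz" and m: "\<phi> \<in> borel_measurable borel"
    and i: "integrable lborel (\<lambda>x. (cmod (\<phi> x))\<^sup>2)" and c: "c > 0" "(LINT x|lborel. (cmod (\<phi> x))\<^sup>2) = c\<^sup>2"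
  shows "ennreal (norm (S \<phi>) / c) \<le> L2_norm S"
  unfolding L2_norm_def
proof (intro INF_greatest ennreal_leI)
  fix g assume "g \<in> L2_reps S"
  then have g: "g \<in> borel_measurable borel" "integrable lborel (\<lambda>x. (cmod (g x))\<^sup>2)" and S: "S \<phi> = (LINT x|lborel. g x * \<phi> x)"
    using \<phi> by (auto simp: L2_reps_def square_integrable_def dist_of_cfun_def)
  define J where "J = (LINT x|lborel. (cmod (g x))\<^sup>2)"
  have J: "J \<ge> 0" unfolding J_def by (intro integral_nonneg_AE) auto
  \<comment> \<open>Taking G strictly above the norm covers the case J = 0. The weight t = c/G is
    the one that balances the two terms of Young's inequality.\<close>
  have "norm (S \<phi>) / c \<le> G" if G: "G > sqrt J" for G
  proof -
    have G0: "G > 0" using G J real_sqrt_ge_zero[OF J] by linarith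
    define t where "t = c / G"
    have t: "t > 0" using G0 c by (simp add: t_def)
    have young: "norm (g x * \<phi> x) \<le> t / 2 * (cmod (g x))\<^sup>2 + 1 / (2 * t) * (cmod (\<phi> x))\<^sup>2" for x
    proof -
      have "0 \<le> (t * cmod (g x) - cmod (\<phi> x))\<^sup>2 / (2 * t)" using t by simp
      also have "\<dots> = t / 2 * (cmod (g x))\<^sup>2 + 1 / (2 * t) * (cmod (\<phi> x))\<^sup>2 - cmod (g x) * cmod (\<phi> x)"
        using t by (simp add: power2_diff power2_eq_square field_simps)
      finally show ?thesis by (simp add: norm_mult)
    qed
    have Yi: "integrable lborel (\<lambda>x. t / 2 * (cmod (g x))\<^sup>2 + 1 / (2 * t) * (cmod (\<phi> x))\<^sup>2)"
      by (intro Bochner_Integration.integrable_add integrable_mult_right i g)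
    have "integrable lborel (\<lambda>x. g x * \<phi> x)"
      by (rule Bochner_Integration.integrable_bound[OF Yi]) (use g m young t in \<open>auto intro!: AE_I2 order_trans[OF young]\<close>)
    then have "norm (S \<phi>) \<le> (LINT x|lborel. t / 2 * (cmod (g x))\<^sup>2 + 1 / (2 * t) * (cmod (\<phi> x))\<^sup>2)"
      unfolding S by (rule Bochner_Integration.integral_norm_bound_integral[OF _ Yi young])
    also have "\<dots> = t / 2 * J + 1 / (2 * t) * c\<^sup>2"
      unfolding J_def c(2)[symmetric] using i g by (subst Bochner_Integration.integral_add) auto
    also have "\<dots> \<le> t / 2 * G\<^sup>2 + 1 / (2 * t) * c\<^sup>2"
    proof -
      have "J \<le> G\<^sup>2" using G G0 J by (simp add: real_sqrt_le_iff' sqrt_le_D less_imp_le)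
      then show ?thesis using t by (intro add_right_mono mult_left_mono) auto
    qed
    also have "\<dots> = G * c" using G0 c by (simp add: t_def power2_eq_square field_simps)
    finally show ?thesis using c by (simp add: field_simps)
  qed
  then show "norm (S \<phi>) / c \<le> sqrt (LINT x|lborel. (cmod (g x))\<^sup>2)"
    unfolding J_def[symmetric] by (rule dense_ge)
qed

lemma AE_obtains_in_interval:
  fixes a b :: real
  assumes "AE t in lborel. t \<in> S \<longrightarrow> P t" "a < b" "{a<..<b} \<subseteq> S"
  obtains t where "a < t" "t < b" "P t"
proof -
  have "\<not> (AE t in lborel. t \<notin> {a<..<b})"
  proof
    assume "AE t in lborel. t \<notin> {a<..<b}"
    then have "emeasure lborel {a<..<b} = 0"
      by (subst (asm) AE_iff_measurable[where N = "{a<..<b}"]) auto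
    with \<open>a < b\<close> show False by simp
  qed
  moreover have "AE t in lborel. t \<notin> {a<..<b}" if "\<And>t. t \<in> {a<..<b} \<Longrightarrow> \<not> P t"
    using assms(1) by eventually_elim (use that assms(3) in auto)
  ultimately show ?thesis using that by auto
qed

text \<open>The time \<open>t\<close> is approximated by a measurable choice of good times in small intervals to its right.\<close>

lemma measurable_pair_of_AE:
  fixes f :: "real \<Rightarrow> real \<Rightarrow> complex"
  assumes m: "AE t in lborel. t \<in> {0<..<T'} \<longrightarrow> (\<lambda>\<tau>. indicator {0<..<t} \<tau> *\<^sub>R f t \<tau>) \<in> borel_measurable borel"
    and c: "\<And>\<tau>. continuous_on UNIV (\<lambda>t. f t \<tau>)" and T: "0 < T" "T < T'"
  shows "(\<lambda>(\<tau>, t). indicator {(\<tau>, t). 0 < \<tau> \<and> \<tau> < t \<and> t < T} (\<tau>, t) *\<^sub>R f t \<tau>) \<in> borel_measurable (borel \<Otimes>\<^sub>M borel)"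
proof -
  \<comment> \<open>For t in the k-th cell of the grid of mesh 1/(i+1) a good time is sought in the
    next cell. It then lies strictly to the right of t, so \<tau> < t stays inside its indicator,
    and at distance less than 2/(i+1).\<close>
  define P where "P = (\<lambda>i k t. real (k + 1) / real (i + 1) < t \<and> t < real (k + 2) / real (i + 1) \<and>
     (\<lambda>\<tau>. indicator {0<..<t} \<tau> *\<^sub>R f t \<tau>) \<in> borel_measurable borel)"
  define d where "d = (\<lambda>i k. SOME t. P i k t)"
  define g where "g = (\<lambda>i k \<tau>. if Ex (P i k) then indicator {0<..<d i k} \<tau> *\<^sub>R f (d i k) \<tau> else 0)"
  define V where "V = (\<lambda>i (\<tau>, t). indicator {(\<tau>, t). 0 < \<tau> \<and> \<tau> < t \<and> t < T} (\<tau>, t) *\<^sub>R g i (nat \<lfloor>t * real (i + 1)\<rfloor>) \<tau>)"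
  have d: "P i k (d i k)" if "Ex (P i k)" for i k
    unfolding d_def using that by (rule someI_ex)
  have [measurable]: "g i k \<in> borel_measurable borel" for i k
  proof (cases "Ex (P i k)")
    case True
    from d[OF True] have "(\<lambda>\<tau>. indicator {0<..<d i k} \<tau> *\<^sub>R f (d i k) \<tau>) \<in> borel_measurable borel"
      by (simp add: P_def)
    with True show ?thesis by (simp add: g_def)
  next
    case False
    have "g i k = (\<lambda>_. 0)" unfolding g_def if_not_P[OF False] ..
    then show ?thesis by simp
  qed
  have ind [measurable]: "{(\<tau> :: real, t). 0 < \<tau> \<and> \<tau> < t \<and> t < T} \<in> sets (borel \<Otimes>\<^sub>M borel)"
  proof -
    have "{(\<tau> :: real, t). 0 < \<tau> \<and> \<tau> < t \<and> t < T} = {p \<in> space (borel \<Otimes>\<^sub>M borel). 0 < fst p \<and> fst p < snd p \<and> snd p < T}"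
      by (auto simp: space_pair_measure)
    also have "\<dots> \<in> sets (borel \<Otimes>\<^sub>M borel)" by measurable
    finally show ?thesis .
  qed
  have V: "V i \<in> borel_measurable (borel \<Otimes>\<^sub>M borel)" for i
  proof -
    have "(\<lambda>p. g i (nat \<lfloor>snd p * real (i + 1)\<rfloor>) (fst p)) \<in> borel_measurable (borel \<Otimes>\<^sub>M borel)"
      by (rule measurable_compose_countable'[where f = "\<lambda>k p. g i k (fst p)" and I = UNIV]) measurable
    then show ?thesis unfolding V_def case_prod_beta by measurable
  qed
  have "(\<lambda>i. V i (\<tau>, t)) \<longlonglongrightarrow> indicator {(\<tau>, t). 0 < \<tau> \<and> \<tau> < t \<and> t < T} (\<tau>, t) *\<^sub>R f t \<tau>" for \<tau> t
  proof (cases "0 < \<tau> \<and> \<tau> < t \<and> t < T")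
    case True
    define s where "s = (\<lambda>i. d i (nat \<lfloor>t * real (i + 1)\<rfloor>))"
    \<comment> \<open>The gap between T and T' leaves room for the next cell, once the mesh is fine
      enough; for coarser grids the default 0 in g may occur.\<close>
    have "(\<lambda>i. T + 2 / real (i + 1)) \<longlonglongrightarrow> T" by real_asymp
    then have "\<forall>\<^sub>F i in sequentially. T + 2 / real (i + 1) < T'"
      using T by (intro order_tendstoD)
    then have ev: "\<forall>\<^sub>F i in sequentially. t < s i \<and> s i < t + 2 / real (i + 1) \<and> V i (\<tau>, t) = f (s i) \<tau>"
    proof eventually_elim
      case (elim i)
      define k where "k = nat \<lfloor>t * real (i + 1)\<rfloor>"
      have "t * real (i + 1) \<ge> 0" using True by simp
      then have k: "real k \<le> t * real (i + 1)" "t * real (i + 1) < real k + 1"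
        unfolding k_def by linarith+
      have k1: "t < real (k + 1) / real (i + 1)"
        using k(2) by (subst pos_less_divide_eq) auto
      have "real k / real (i + 1) \<le> t"
        using k(1) by (subst pos_divide_le_eq) auto
      then have k2: "real (k + 2) / real (i + 1) \<le> t + 2 / real (i + 1)"
        by (simp add: add_divide_distrib)
      obtain r where "P i k r"
      proof (rule AE_obtains_in_interval[OF m, of "real (k + 1) / real (i + 1)" "real (k + 2) / real (i + 1)"])
        show "{real (k + 1) / real (i + 1)<..<real (k + 2) / real (i + 1)} \<subseteq> {0<..<T'}"
          using True k1 k2 elim by (auto intro: less_trans) 
      qed (auto simp: P_def divide_strict_right_mono)
      then have ex: "Ex (P i k)" by blast
      from d[OF ex] have "P i k (s i)" by (simp add: s_def k_def)
      then have s: "t < s i" "s i < t + 2 / real (i + 1)"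
        using k1 k2 unfolding P_def by linarith+
      have "V i (\<tau>, t) = indicator {0<..<d i k} \<tau> *\<^sub>R f (d i k) \<tau>"
        using True ex by (simp add: V_def g_def k_def)
      also have "\<dots> = f (s i) \<tau>" using True s by (simp add: s_def k_def)
      finally show ?case using s by blast
    qed
    have "s \<longlonglongrightarrow> t"
    proof (rule tendsto_sandwich[of "\<lambda>_. t" s _ "\<lambda>i. t + 2 / real (i + 1)"])
      show "(\<lambda>i. t + 2 / real (i + 1)) \<longlonglongrightarrow> t" by real_asymp
    qed (use ev in \<open>auto elim: eventually_mono\<close>)
    then have "(\<lambda>i. f (s i) \<tau>) \<longlonglongrightarrow> f t \<tau>"
      using c[of \<tau>] by (intro isCont_tendsto_compose[of t "\<lambda>t. f t \<tau>"]) (auto simp: continuous_on_eq_continuous_at)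
    then have "(\<lambda>i. V i (\<tau>, t)) \<longlonglongrightarrow> f t \<tau>"
      by (rule Lim_transform_eventually) (use ev in \<open>auto elim: eventually_mono\<close>)
    with True show ?thesis by simp
  qed (simp add: V_def)
  then show ?thesis
    by (intro borel_measurable_LIMSEQ_metric[OF V]) auto
qed

section \<open>Integration by parts in time against a cutoff\<close>

locale cutoff =
  fixes \<eta> \<eta>' \<eta>'' :: "real \<Rightarrow> real" and T :: real
  assumes der: "\<And>t. (\<eta> has_real_derivative \<eta>' t) (at t)" "\<And>t. (\<eta>' has_real_derivative \<eta>'' t) (at t)"
    and cont: "continuous_on UNIV \<eta>''" and T: "T > 0"
    and vals: "\<eta> 0 = 1" "\<eta>' 0 = 0" "\<eta> T = 0" "\<eta>' T = 0"
begin

lemma continuous_cutoff: "continuous_on S \<eta>" "continuous_on S \<eta>'" "continuous_on S \<eta>''"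
  using der cont by (auto intro: continuous_on_subset DERIV_continuous_on DERIV_subset)

lemma cutoff_vector_derivative:
  "((\<lambda>t. complex_of_real (\<eta> t)) has_vector_derivative of_real (\<eta>' t)) (at t)"
  "((\<lambda>t. complex_of_real (\<eta>' t)) has_vector_derivative of_real (\<eta>'' t)) (at t)"
  using der by (auto intro!: has_vector_derivative_of_real simp flip: has_real_derivative_iff_has_vector_derivative)

context
  fixes d :: "nat \<Rightarrow> complex" and B R :: real
  assumes d: "\<And>k. norm (d k) \<le> B * R ^ k * fact k" and B: "0 \<le> B" and R: "0 \<le> R"
begin

abbreviation "d' \<equiv> \<lambda>k. d (Suc k)"

lemma shifted_bounds: "norm (d' k) \<le> (B * R) * (2 * R) ^ k * fact k" "0 \<le> B * R" "0 \<le> 2 * R"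
  using shift_bound[OF d B R] B R by auto

lemmas K_deriv = damped_pair_has_derivative[OF d B R] damped_pair_deriv_has_derivative[OF d B R]
  damped_pair_has_derivative[OF shifted_bounds] damped_pair_deriv_has_derivative[OF shifted_bounds]

lemma continuous_K: "continuous_on S (damped_pair d)" "continuous_on S (damped_pair_deriv d)"
  "continuous_on S (damped_pair d')" "continuous_on S (damped_pair_deriv d')"
  using K_deriv by (auto intro!: continuous_at_imp_continuous_on has_vector_derivative_continuous)

text \<open>With K(t) = \<open>damped_pair d (t - \<tau>)\<close>, the damped wave equation makes
  the integrand the derivative of \<eta>' K - \<eta> (K' + K). At T everything vanishes by the
  cutoff. At \<tau> one has K = 0 and K' = d 0.\<close>

lemma cutoff_duhamel:
  assumes "\<tau> \<le> T"
  shows "(LINT t|lborel. indicator {\<tau>..T} t *\<^sub>R (of_real (\<eta>'' t - \<eta>' t) * damped_pair d (t - \<tau>) +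
      of_real (\<eta> t) * (damped_pair d (t - \<tau>) / 4 - damped_pair d' (t - \<tau>)))) = of_real (\<eta> \<tau>) * d 0"
proof -
  have sh: "((\<lambda>t. F (t - \<tau>)) has_vector_derivative D) (at t)" if "(F has_vector_derivative D) (at (t - \<tau>))"
    for F :: "real \<Rightarrow> complex" and D t
  proof -
    have "((\<lambda>t. t - \<tau>) has_vector_derivative 1) (at t)"
      by (auto intro!: derivative_eq_intros simp flip: has_real_derivative_iff_has_vector_derivative)
    from vector_diff_chain_at[OF this that] show ?thesis by (simp add: o_def)
  qed
  have "(LINT t|lborel. indicator {\<tau>..T} t *\<^sub>R (of_real (\<eta>'' t - \<eta>' t) * damped_pair d (t - \<tau>) +
      of_real (\<eta> t) * (damped_pair d (t - \<tau>) / 4 - damped_pair d' (t - \<tau>)))) =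
    (of_real (\<eta>' T) * damped_pair d (T - \<tau>) - of_real (\<eta> T) * (damped_pair_deriv d (T - \<tau>) + damped_pair d (T - \<tau>))) -
    (of_real (\<eta>' \<tau>) * damped_pair d (\<tau> - \<tau>) - of_real (\<eta> \<tau>) * (damped_pair_deriv d (\<tau> - \<tau>) + damped_pair d (\<tau> - \<tau>)))"
  proof (rule integral_FTC_atLeastAtMost[OF assms])
    fix t
    have "((\<lambda>t. of_real (\<eta>' t) * damped_pair d (t - \<tau>) - of_real (\<eta> t) * (damped_pair_deriv d (t - \<tau>) + damped_pair d (t - \<tau>)))
      has_vector_derivative
       (of_real (\<eta>' t) * damped_pair_deriv d (t - \<tau>) + of_real (\<eta>'' t) * damped_pair d (t - \<tau>)) -
       (of_real (\<eta> t) * ((damped_pair d' (t - \<tau>) - damped_pair d (t - \<tau>) / 4 - damped_pair_deriv d (t - \<tau>)) + damped_pair_deriv d (t - \<tau>)) +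
        of_real (\<eta>' t) * (damped_pair_deriv d (t - \<tau>) + damped_pair d (t - \<tau>)))) (at t)"
      by (intro has_vector_derivative_diff has_vector_derivative_mult has_vector_derivative_add cutoff_vector_derivative sh K_deriv)
    then show "((\<lambda>t. of_real (\<eta>' t) * damped_pair d (t - \<tau>) - of_real (\<eta> t) * (damped_pair_deriv d (t - \<tau>) + damped_pair d (t - \<tau>)))
      has_vector_derivative (of_real (\<eta>'' t - \<eta>' t) * damped_pair d (t - \<tau>) +
      of_real (\<eta> t) * (damped_pair d (t - \<tau>) / 4 - damped_pair d' (t - \<tau>)))) (at t within {\<tau>..T})"
      by (rule has_vector_derivative_at_within[OF has_vector_derivative_eq_rhs]) (simp add: algebra_simps)
  next
    show "continuous_on {\<tau>..T} (\<lambda>t. of_real (\<eta>'' t - \<eta>' t) * damped_pair d (t - \<tau>) +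
      of_real (\<eta> t) * (damped_pair d (t - \<tau>) / 4 - damped_pair d' (t - \<tau>)))"
      by (intro continuous_intros continuous_cutoff continuous_on_compose2[OF continuous_K(1)[of UNIV]]
          continuous_on_compose2[OF continuous_K(3)[of UNIV]]) auto
  qed
  then show ?thesis by (simp add: vals damped_pair_def damped_pair_deriv_def)
qed

text \<open>The same computation with K' in place of K. At t = 0 the term with K' is killed by
  \<eta>'(0) = 0, and K'' + K' vanishes because K and its shift do. Thus the time derivative of the
  operator contributes nothing, and the two data enter only through their sum.\<close>

lemma cutoff_time_derivative:
  "(LINT t|lborel. indicator {0..T} t *\<^sub>R (of_real (\<eta>'' t - \<eta>' t) * damped_pair_deriv d t +
      of_real (\<eta> t) * (damped_pair_deriv d t / 4 - damped_pair_deriv d' t))) = 0"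
proof -
  have "(LINT t|lborel. indicator {0..T} t *\<^sub>R (of_real (\<eta>'' t - \<eta>' t) * damped_pair_deriv d t +
      of_real (\<eta> t) * (damped_pair_deriv d t / 4 - damped_pair_deriv d' t))) =
    (of_real (\<eta>' T) * damped_pair_deriv d T - of_real (\<eta> T) * (damped_pair d' T - damped_pair d T / 4)) -
    (of_real (\<eta>' 0) * damped_pair_deriv d 0 - of_real (\<eta> 0) * (damped_pair d' 0 - damped_pair d 0 / 4))"
  proof (rule integral_FTC_atLeastAtMost)
    show "0 \<le> T" using T by simp
    fix t
    have "((\<lambda>t. of_real (\<eta>' t) * damped_pair_deriv d t - of_real (\<eta> t) * (damped_pair d' t - damped_pair d t / 4))
      has_vector_derivative
       (of_real (\<eta>' t) * (damped_pair d' t - damped_pair d t / 4 - damped_pair_deriv d t) + of_real (\<eta>'' t) * damped_pair_deriv d t) -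
       (of_real (\<eta> t) * (damped_pair_deriv d' t - damped_pair_deriv d t / 4) +
        of_real (\<eta>' t) * (damped_pair d' t - damped_pair d t / 4))) (at t)"
      by (intro has_vector_derivative_diff has_vector_derivative_mult has_vector_derivative_divide cutoff_vector_derivative K_deriv)
    then show "((\<lambda>t. of_real (\<eta>' t) * damped_pair_deriv d t - of_real (\<eta> t) * (damped_pair d' t - damped_pair d t / 4))
      has_vector_derivative (of_real (\<eta>'' t - \<eta>' t) * damped_pair_deriv d t +
      of_real (\<eta> t) * (damped_pair_deriv d t / 4 - damped_pair_deriv d' t))) (at t within {0..T})"
      by (rule has_vector_derivative_at_within[OF has_vector_derivative_eq_rhs]) (simp add: algebra_simps)
  next
    show "continuous_on {0..T} (\<lambda>t. of_real (\<eta>'' t - \<eta>' t) * damped_pair_deriv d t +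
      of_real (\<eta> t) * (damped_pair_deriv d t / 4 - damped_pair_deriv d' t))"
      by (intro continuous_intros continuous_cutoff continuous_K) auto
  qed
  then show ?thesis by (simp add: vals damped_pair_def damped_pair_deriv_def)
qed

end

end

lemma slowly_growing_cmult: "slowly_growing v \<Longrightarrow> slowly_growing (\<lambda>x. c * v x :: real)"
  unfolding slowly_growing_def
proof (elim conjE exE, intro conjI)
  fix k assume v: "v \<in> borel_measurable lborel" and "integrable lborel (\<lambda>x. v x /\<^sub>R (1 + norm x) ^ k)"
  from integrable_mult_right[OF this(2), of c] show "\<exists>k. integrable lborel (\<lambda>x. (c * v x) /\<^sub>R (1 + norm x) ^ k)"
    by (intro exI[of _ k]) (simp add: mult_ac)
  show "(\<lambda>x. c * v x) \<in> borel_measurable lborel" using v by measurable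
qed

lemma integrable_wide_gauss: "slowly_growing v \<Longrightarrow> a \<ge> 16 \<Longrightarrow> integrable lborel (\<lambda>x. v x * gauss (9 * a / 2) x)"
  by (intro slowly_growing_integrable_gauss) auto

lemma slowly_growing_neg_lap:
  assumes "slowly_growing v" "a > 0"
  shows "integrable lborel (\<lambda>x. v x * neg_lap_gauss a x)"
  unfolding neg_lap_gauss_def
  by (intro slowly_growing_integrable_poly_gauss assms real_polynomial_function_diff real_polynomial_function_divide
      real_polynomial_function_norm_square) auto

context
  fixes v :: "'a::euclidean_space \<Rightarrow> real" and a :: real
  assumes v: "slowly_growing v" and a: "a \<ge> 16"
begin

lemma pair_coeff_bounds:
  "norm (pair_coeff a v k) \<le> (2 * sqrt 2 ^ DIM('a) * (LINT x|lborel. \<bar>v x\<bar> * gauss (9 * a / 2) x)) * 1 ^ k * fact k"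
  "0 \<le> 2 * sqrt 2 ^ DIM('a) * (LINT x|lborel. \<bar>v x\<bar> * gauss (9 * a / 2) x)" "(0 :: real) \<le> 1"
  using norm_pair_coeff_le[OF slowly_growing_measurable[OF v] a integrable_wide_gauss[OF v a]]
    gauss_mass_nonneg[OF slowly_growing_measurable[OF v] a integrable_wide_gauss[OF v a]]
  by (auto simp: gauss_mass_def[OF slowly_growing_measurable[OF v] a integrable_wide_gauss[OF v a]])

lemmas pair_damped_gauss = damped_gauss[OF slowly_growing_measurable[OF v] a integrable_wide_gauss[OF v a]]
lemmas pair_damped_neg_lap_gauss = damped_neg_lap_gauss[OF slowly_growing_measurable[OF v] a integrable_wide_gauss[OF v a]]
lemmas pair_coeff_at_0 = pair_coeff_0[OF slowly_growing_measurable[OF v] a integrable_wide_gauss[OF v a]]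
lemmas pair_shift_bounds = shift_bound[OF pair_coeff_bounds]

lemma dt_damped_gauss:
  "dt_damped t (dist_of v) (\<lambda>x. complex_of_real (gauss a x)) = damped_pair_deriv (pair_coeff a v) t"
  unfolding dt_damped_def pair_damped_gauss
  by (rule vector_derivative_at[OF damped_pair_has_derivative[OF pair_coeff_bounds]])

lemma dt_damped_neg_lap_gauss:
  "dt_damped t (dist_of v) (\<lambda>x. complex_of_real (neg_lap_gauss a x)) =
     damped_pair_deriv (pair_coeff a v) t / 4 - damped_pair_deriv (\<lambda>k. pair_coeff a v (Suc k)) t"
  unfolding dt_damped_def pair_damped_neg_lap_gauss
  using pair_coeff_bounds(2)
  by (intro vector_derivative_at has_vector_derivative_diff has_vector_derivative_divide
      damped_pair_has_derivative[OF pair_coeff_bounds] damped_pair_has_derivative[OF pair_shift_bounds]) auto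

text \<open>A majorant uniform in the elapsed time, for the Fubini argument. The exponent 2 T^2
  accommodates the shifted series, whose R is doubled.\<close>

lemma norm_damped_test_le:
  assumes "0 \<le> h" "h \<le> T"
  defines "K \<equiv> 4 * sqrt 2 ^ DIM('a) * (T * exp (2 * T\<^sup>2)) * (LINT x|lborel. \<bar>v x\<bar> * gauss (9 * a / 2) x)"
  shows "norm (damped h (dist_of v) (\<lambda>x. complex_of_real (gauss a x))) \<le> K"
    and "norm (damped h (dist_of v) (\<lambda>x. complex_of_real (neg_lap_gauss a x))) \<le> K"
proof -
  define B where "B = 2 * sqrt 2 ^ DIM('a) * (LINT x|lborel. \<bar>v x\<bar> * gauss (9 * a / 2) x)"
  have B: "B \<ge> 0" unfolding B_def by (rule pair_coeff_bounds(2))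
  have K: "K = 2 * (B * (T * exp (2 * T\<^sup>2)))" by (simp add: K_def B_def)
  have h2: "h\<^sup>2 \<le> T\<^sup>2" using assms by (intro power_mono) auto
  have e: "h * exp (R * h\<^sup>2) \<le> T * exp (2 * T\<^sup>2)" if "0 \<le> R" "R \<le> 2" for R
    using assms that h2 by (intro mult_mono) (auto intro: mult_mono)
  have 1: "norm (damped_pair (pair_coeff a v) h) \<le> B * (T * exp (2 * T\<^sup>2))"
    unfolding B_def
    by (rule order_trans[OF norm_damped_pair_le[OF pair_coeff_bounds assms(1)] mult_left_mono[OF e]])
      (use pair_coeff_bounds(2) in auto)
  have 2: "norm (damped_pair (\<lambda>k. pair_coeff a v (Suc k)) h) \<le> B * (T * exp (2 * T\<^sup>2))"
  proof -
    have "norm (damped_pair (\<lambda>k. pair_coeff a v (Suc k)) h) \<le> (B * 1) * (h * exp (2 * 1 * h\<^sup>2))"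
      using pair_coeff_bounds(2) unfolding B_def
      by (intro norm_damped_pair_le[OF pair_shift_bounds _ _ assms(1)]) auto
    also have "\<dots> \<le> B * (T * exp (2 * T\<^sup>2))" using e[of 2] B by (simp add: mult_left_mono)
    finally show ?thesis .
  qed
  show "norm (damped h (dist_of v) (\<lambda>x. complex_of_real (gauss a x))) \<le> K"
    unfolding pair_damped_gauss K using 1 norm_ge_zero[of "damped_pair (pair_coeff a v) h"] by linarith
  have "norm (damped_pair (pair_coeff a v) h / 4 - damped_pair (\<lambda>k. pair_coeff a v (Suc k)) h) \<le>
      norm (damped_pair (pair_coeff a v) h / 4) + norm (damped_pair (\<lambda>k. pair_coeff a v (Suc k)) h)"
    by (rule norm_triangle_ineq4)
  also have "norm (damped_pair (pair_coeff a v) h / 4) = norm (damped_pair (pair_coeff a v) h) / 4"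
    by (simp add: norm_divide)
  finally show "norm (damped h (dist_of v) (\<lambda>x. complex_of_real (neg_lap_gauss a x))) \<le> K"
    unfolding pair_damped_neg_lap_gauss K using 1 2 norm_ge_zero[of "damped_pair (pair_coeff a v) h"] by linarith
qed

text \<open>Continuity in t without exceptional times, for fixed \<tau>, is what upgrades
  measurability in \<tau> to joint measurability.\<close>

lemma continuous_damped_test:
  "continuous_on UNIV (\<lambda>t. damped (t - \<tau>) (dist_of v) (\<lambda>x. complex_of_real (gauss a x)))"
  "continuous_on UNIV (\<lambda>t. damped (t - \<tau>) (dist_of v) (\<lambda>x. complex_of_real (neg_lap_gauss a x)))"
proof -
  have "continuous_on UNIV (damped_pair (pair_coeff a v))" "continuous_on UNIV (damped_pair (\<lambda>k. pair_coeff a v (Suc k)))"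
    using damped_pair_has_derivative[OF pair_coeff_bounds] damped_pair_has_derivative[OF pair_shift_bounds] pair_coeff_bounds(2)
    by (auto intro!: continuous_at_imp_continuous_on has_vector_derivative_continuous)
  then show "continuous_on UNIV (\<lambda>t. damped (t - \<tau>) (dist_of v) (\<lambda>x. complex_of_real (gauss a x)))"
    "continuous_on UNIV (\<lambda>t. damped (t - \<tau>) (dist_of v) (\<lambda>x. complex_of_real (neg_lap_gauss a x)))"
    unfolding pair_damped_gauss pair_damped_neg_lap_gauss
    by (auto intro!: continuous_intros continuous_on_compose2[of UNIV "damped_pair _" _ "\<lambda>t. t - \<tau>"])
qed

end

section \<open>A mild solution paired with Gaussian test functions\<close>

locale mild_solution_tested = cutoff \<eta> \<eta>' \<eta>'' T for \<eta> \<eta>' \<eta>'' :: "real \<Rightarrow> real" and T +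
  fixes u :: "real \<Rightarrow> 'a::euclidean_space \<Rightarrow> real" and v\<^sub>0 v\<^sub>1 :: "'a \<Rightarrow> real" and \<sigma> p a T' :: real
  assumes sol: "mild_solution_Linf (\<lambda>r. \<sigma> * \<bar>r\<bar> powr p) v\<^sub>0 v\<^sub>1 T' u"
    and \<sigma>: "\<sigma> = 1 \<or> \<sigma> = -1" and T': "T < T'" and a: "a \<ge> 16"
    and v01: "slowly_growing v\<^sub>0" "slowly_growing v\<^sub>1"
begin

definition w :: "real \<Rightarrow> 'a \<Rightarrow> real" where "w \<tau> x = \<bar>u \<tau> x\<bar> powr p"

definition F :: "real \<Rightarrow> real \<Rightarrow> 'a dist" where "F t \<tau> = damped (t - \<tau>) (dist_of (\<lambda>x. \<sigma> * w \<tau> x))"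

text \<open>Two functions suffice: at fixed t the adjoint operator applied to \<eta>(t)
  \<open>gauss a\<close> is (\<eta>'' - \<eta>') times the first plus \<eta> times the
  second.\<close>

definition tests :: "('a \<Rightarrow> complex) set" where
  "tests = {\<lambda>x. complex_of_real (gauss a x), \<lambda>x. complex_of_real (neg_lap_gauss a x)}"

lemma tests_schwartz: "\<phi> \<in> tests \<Longrightarrow> \<phi> \<in> schwartz"
  using gauss_schwartz[of a, where 'a='a] neg_lap_gauss_schwartz[of a, where 'a='a] a by (auto simp: tests_def)

lemma duhamel_eq: "duhamel_integrand (\<lambda>r. \<sigma> * \<bar>r\<bar> powr p) u t \<tau> = F t \<tau>"
  by (simp add: duhamel_integrand_def F_def w_def)

lemma w_nonneg: "w \<tau> x \<ge> 0" by (simp add: w_def)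

lemma solution:
  "AE t in lborel. t \<in> {0<..<T'} \<longrightarrow> slowly_growing (u t)"
  "AE t in lborel. t \<in> {0<..<T'} \<longrightarrow>
     (AE \<tau> in lborel. \<tau> \<in> {0<..<t} \<longrightarrow> slowly_growing (\<lambda>x. \<sigma> * w \<tau> x)) \<and>
     L2_bochner_integrable {0<..<t} (F t) \<and>
     (\<forall>\<phi>\<in>schwartz. dist_of (u t) \<phi> =
        dt_damped t (dist_of v\<^sub>0) \<phi> + damped t (dist_of v\<^sub>0) \<phi> + damped t (dist_of v\<^sub>1) \<phi>
        + (LINT \<tau>:{0<..<t}|lborel. F t \<tau> \<phi>))"
  using sol unfolding mild_solution_Linf_def duhamel_eq w_def by auto

lemma F_measurable:
  "AE t in lborel. t \<in> {0<..<T'} \<longrightarrow>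
     (\<forall>\<phi>\<in>tests. (\<lambda>\<tau>. indicator {0<..<t} \<tau> *\<^sub>R F t \<tau> \<phi>) \<in> borel_measurable borel)"
  using solution(2)
  by eventually_elim
    (auto simp: L2_bochner_integrable_def L2_strongly_measurable_def set_borel_measurable_def tests_schwartz)

lemma null_set_of_bad_times:
  obtains N where "N \<in> null_sets lborel" "\<And>\<tau>. \<tau> \<in> {0<..<T} \<Longrightarrow> \<tau> \<notin> N \<Longrightarrow> slowly_growing (\<lambda>x. \<sigma> * w \<tau> x)"
proof -
  obtain t where "T < t" "AE \<tau> in lborel. \<tau> \<in> {0<..<t} \<longrightarrow> slowly_growing (\<lambda>x. \<sigma> * w \<tau> x)"
    by (rule AE_obtains_in_interval[OF solution(2) T']) (use T in auto)
  then have "AE \<tau> in lborel. \<tau> \<in> {0<..<T} \<longrightarrow> slowly_growing (\<lambda>x. \<sigma> * w \<tau> x)"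
    by (auto elim!: eventually_mono)
  then obtain N where N: "{\<tau> \<in> space lborel. \<not> (\<tau> \<in> {0<..<T} \<longrightarrow> slowly_growing (\<lambda>x. \<sigma> * w \<tau> x))} \<subseteq> N"
    "emeasure lborel N = 0" "N \<in> sets lborel"
    by (rule AE_E)
  show ?thesis by (rule that[of N]) (use N in auto)
qed

text \<open>Slow growth of the source holds for almost every \<tau>, but the set of such \<tau> need
  not be Borel. Removing a chosen Borel null set gives a measurable set of times.\<close>

definition good :: "real set" where
  "good = {0<..<T} - (SOME N. N \<in> null_sets lborel \<and> (\<forall>\<tau>\<in>{0<..<T} - N. slowly_growing (\<lambda>x. \<sigma> * w \<tau> x)))"

lemma good:
  shows good_sets [measurable]: "good \<in> sets borel" and AE_good: "AE \<tau> in lborel. \<tau> \<in> {0<..<T} \<longrightarrow> \<tau> \<in> good"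
    and good_growing: "\<tau> \<in> good \<Longrightarrow> slowly_growing (\<lambda>x. \<sigma> * w \<tau> x)" and good_subset: "good \<subseteq> {0<..<T}"
proof -
  define N where "N = (SOME N. N \<in> null_sets lborel \<and> (\<forall>\<tau>\<in>{0<..<T} - N. slowly_growing (\<lambda>x. \<sigma> * w \<tau> x)))"
  have N: "N \<in> null_sets lborel \<and> (\<forall>\<tau>\<in>{0<..<T} - N. slowly_growing (\<lambda>x. \<sigma> * w \<tau> x))"
    unfolding N_def
  proof (rule someI_ex)
    obtain N where "N \<in> null_sets lborel" "\<And>\<tau>. \<tau> \<in> {0<..<T} \<Longrightarrow> \<tau> \<notin> N \<Longrightarrow> slowly_growing (\<lambda>x. \<sigma> * w \<tau> x)"
      by (rule null_set_of_bad_times, rule that)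
    then show "\<exists>N. N \<in> null_sets lborel \<and> (\<forall>\<tau>\<in>{0<..<T} - N. slowly_growing (\<lambda>x. \<sigma> * w \<tau> x))"
      by (intro exI[of _ N] conjI ballI) simp_all
  qed
  have g: "good = {0<..<T} - N" by (simp add: good_def N_def)
  show "good \<in> sets borel" unfolding g using N by (auto simp: null_sets_def)
  show "AE \<tau> in lborel. \<tau> \<in> {0<..<T} \<longrightarrow> \<tau> \<in> good"
    using AE_not_in[OF conjunct1[OF N]] by eventually_elim (auto simp: g)
  show "\<tau> \<in> good \<Longrightarrow> slowly_growing (\<lambda>x. \<sigma> * w \<tau> x)" using N by (auto simp: g)
  show "good \<subseteq> {0<..<T}" by (auto simp: g)
qed

lemma growing_w: "slowly_growing (w \<tau>)" if "slowly_growing (\<lambda>x. \<sigma> * w \<tau> x)"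
  using slowly_growing_cmult[OF that, of \<sigma>] \<sigma> by auto

definition mass :: "real \<Rightarrow> real" where
  "mass \<tau> = (LINT x|lborel. w \<tau> x * gauss (9 * a / 2) x)"

lemma mass_eq: "(LINT x|lborel. \<bar>\<sigma> * w \<tau> x\<bar> * gauss (9 * a / 2) x) = mass \<tau>"
  using \<sigma> w_nonneg by (auto simp: mass_def abs_mult)

lemma mass_nonneg: "mass \<tau> \<ge> 0"
  unfolding mass_def by (intro integral_nonneg_AE) (auto simp: w_nonneg)

lemma mass_bound:
  obtains t C where "T < t" "C > 0" "(\<integral>\<^sup>+\<tau>\<in>{0<..<t}. L2_norm (F t \<tau>) \<partial>lborel) < \<infinity>"
    "\<And>\<tau>. \<tau> \<in> good \<Longrightarrow> ennreal (mass \<tau>) \<le> ennreal C * L2_norm (F t \<tau>)"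
proof -
  obtain t where t: "T < t" "L2_bochner_integrable {0<..<t} (F t)"
    by (rule AE_obtains_in_interval[OF solution(2) T']) (use T in auto)
  \<comment> \<open>For \<tau> < T the elapsed time t - \<tau> stays between t - T > 0 and t, so one
    constant serves all \<tau>. Asking for b at least 9a/2 makes the controlled Gaussian dominate
    the one in \<open>mass\<close>.\<close>
  obtain b C where b: "b \<ge> 9 * a / 2" "b \<ge> 16" "C \<ge> 0" and main:
    "\<And>h \<rho> A (w :: 'a \<Rightarrow> real). t - T \<le> h \<Longrightarrow> h \<le> t \<Longrightarrow> A \<ge> 0 \<Longrightarrow> \<bar>\<rho>\<bar> = 1 \<Longrightarrow>
      slowly_growing w \<Longrightarrow> (\<And>x. w x \<ge> 0) \<Longrightarrow>
      (\<And>a. a \<ge> 16 \<Longrightarrow> norm (damped h (dist_of (\<lambda>x. \<rho> * w x)) (\<lambda>x. complex_of_real (gauss a x))) \<le> A * sqrt (sqrt (pi * a) ^ DIM('a))) \<Longrightarrow>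
      (LINT x|lborel. w x * gauss b x) \<le> C * A"
    using gauss_mass_le[of "t - T" t "9 * a / 2", where 'a='a] t T by (auto; blast)
  show ?thesis
  \<comment> \<open>C may be 0; C + 1 is positive and keeps the right-hand side infinite where the
    norm is infinite.\<close>
  proof (rule that[of t "C + 1"])
    show "(\<integral>\<^sup>+\<tau>\<in>{0<..<t}. L2_norm (F t \<tau>) \<partial>lborel) < \<infinity>"
      using t by (simp add: L2_bochner_integrable_def)
    fix \<tau> assume \<tau>: "\<tau> \<in> good"
    note g = good_growing[OF \<tau>]
    have \<tau>T: "0 < \<tau>" "\<tau> < T" using good_subset \<tau> by auto
    show "ennreal (mass \<tau>) \<le> ennreal (C + 1) * L2_norm (F t \<tau>)"
    proof (cases "L2_norm (F t \<tau>)")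
      case (real A)
      have "(LINT x|lborel. w \<tau> x * gauss b x) \<le> C * A"
      proof (rule main[of "t - \<tau>" A \<sigma>])
        fix a' :: real assume a': "a' \<ge> 16"
        define c where "c = sqrt (sqrt (pi * a') ^ DIM('a))"
        have c: "c > 0" "c\<^sup>2 = sqrt (pi * a') ^ DIM('a)" using a' by (auto simp: c_def)
        have "ennreal (norm (F t \<tau> (\<lambda>x. complex_of_real (gauss a' x))) / c) \<le> L2_norm (F t \<tau>)"
        proof (rule norm_pairing_le_L2_norm[OF gauss_schwartz _ gauss_L2(2) c(1)])
          show "(LINT x|lborel. (cmod (complex_of_real (gauss a' (x::'a))))\<^sup>2) = c\<^sup>2"
            unfolding c(2) using a' by (intro gauss_L2(1)) simp
        qed (use a' in auto)
        then have "norm (F t \<tau> (\<lambda>x. complex_of_real (gauss a' x))) / c \<le> A" using real by simp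
        then show "norm (damped (t - \<tau>) (dist_of (\<lambda>x. \<sigma> * w \<tau> x)) (\<lambda>x. complex_of_real (gauss a' x))) \<le> A * sqrt (sqrt (pi * a') ^ DIM('a))"
          using c(1) by (simp add: F_def c_def field_simps)
      qed (use \<tau>T \<sigma> real growing_w[OF g] w_nonneg in auto)
      moreover have "mass \<tau> \<le> (LINT x|lborel. w \<tau> x * gauss b x)"
        unfolding mass_def using a b growing_w[OF g] w_nonneg
        by (intro Bochner_Integration.integral_mono slowly_growing_integrable_gauss mult_left_mono gauss_mono) auto
      ultimately have "mass \<tau> \<le> (C + 1) * A" using real by (simp add: algebra_simps)
      then have "ennreal (mass \<tau>) \<le> ennreal ((C + 1) * A)" by (rule ennreal_leI)
      also have "\<dots> = ennreal (C + 1) * ennreal A" using b real by (intro ennreal_mult) auto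
      finally show ?thesis using real by simp
    next
      case top
      then show ?thesis using b by (simp add: ennreal_mult_top)
    qed
  qed (use t b in auto)
qed

text \<open>
  The pairing of the Duhamel integrand with a test function; it is cut off at a null set of times, outside of which it is
  given by a power series in \<open>t - \<tau>\<close>.
\<close>

definition W :: "('a \<Rightarrow> complex) \<Rightarrow> real \<times> real \<Rightarrow> complex" where
  "W \<phi> = (\<lambda>(\<tau>, t). indicator {(\<tau>, t). 0 < \<tau> \<and> \<tau> < t \<and> t < T} (\<tau>, t) *\<^sub>R (if \<tau> \<in> good then F t \<tau> \<phi> else 0))"

lemma W_measurable: "\<phi> \<in> tests \<Longrightarrow> W \<phi> \<in> borel_measurable (lborel \<Otimes>\<^sub>M lborel)"
proof -
  assume \<phi>: "\<phi> \<in> tests"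
  have "(\<lambda>(\<tau>, t). indicator {(\<tau>, t). 0 < \<tau> \<and> \<tau> < t \<and> t < T} (\<tau>, t) *\<^sub>R (if \<tau> \<in> good then F t \<tau> \<phi> else 0)) \<in> borel_measurable (borel \<Otimes>\<^sub>M borel)"
  proof (rule measurable_pair_of_AE[OF _ _ T T'])
    show "AE t in lborel. t \<in> {0<..<T'} \<longrightarrow> (\<lambda>\<tau>. indicator {0<..<t} \<tau> *\<^sub>R (if \<tau> \<in> good then F t \<tau> \<phi> else 0)) \<in> borel_measurable borel"
      using F_measurable
    proof eventually_elim
      case (elim t)
      show ?case
      proof
        assume "t \<in> {0<..<T'}"
        with elim \<phi> have [measurable]: "(\<lambda>\<tau>. indicator {0<..<t} \<tau> *\<^sub>R F t \<tau> \<phi>) \<in> borel_measurable borel" by blast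
        have "(\<lambda>\<tau>. indicator {0<..<t} \<tau> *\<^sub>R (if \<tau> \<in> good then F t \<tau> \<phi> else 0)) =
            (\<lambda>\<tau>. indicator good \<tau> *\<^sub>R (indicator {0<..<t} \<tau> *\<^sub>R F t \<tau> \<phi>))"
          by (auto simp: indicator_def)
        also have "\<dots> \<in> borel_measurable borel" by measurable
        finally show "(\<lambda>\<tau>. indicator {0<..<t} \<tau> *\<^sub>R (if \<tau> \<in> good then F t \<tau> \<phi> else 0)) \<in> borel_measurable borel" .
      qed
    qed
    show "continuous_on UNIV (\<lambda>t. if \<tau> \<in> good then F t \<tau> \<phi> else 0)" for \<tau>
      using continuous_damped_test[OF good_growing a, of \<tau> \<tau>] \<phi>
      by (cases "\<tau> \<in> good") (auto simp: F_def tests_def)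
  qed
  moreover have "borel_measurable (lborel \<Otimes>\<^sub>M lborel) = (borel_measurable (borel \<Otimes>\<^sub>M borel) :: (real \<times> real \<Rightarrow> complex) set)"
    by (intro measurable_cong_sets sets_pair_measure_cong) auto
  ultimately show ?thesis unfolding W_def by (simp only:)
qed

lemma norm_W_le:
  assumes "\<phi> \<in> tests"
  shows "norm (W \<phi> (\<tau>, t)) \<le> indicator {0<..<T} t * (indicator good \<tau> * (4 * sqrt 2 ^ DIM('a) * (T * exp (2 * T\<^sup>2)) * mass \<tau>))"
proof (cases "0 < \<tau> \<and> \<tau> < t \<and> t < T \<and> \<tau> \<in> good")
  case True
  then have "norm (F t \<tau> \<phi>) \<le> 4 * sqrt 2 ^ DIM('a) * (T * exp (2 * T\<^sup>2)) * mass \<tau>"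
    using norm_damped_test_le[OF good_growing a, of \<tau> "t - \<tau>" T] assms unfolding mass_eq
    by (auto simp: tests_def F_def)
  with True show ?thesis by (simp add: W_def)
next
  case False
  then have "W \<phi> (\<tau>, t) = 0" by (auto simp: W_def)
  then show ?thesis using T mass_nonneg by simp
qed

lemma W_integrable:
  assumes "\<phi> \<in> tests"
  shows "integrable (lborel \<Otimes>\<^sub>M lborel) (W \<phi>)"
proof (rule integrableI_bounded[OF W_measurable[OF assms]])
  define K where "K = 4 * sqrt 2 ^ DIM('a) * (T * exp (2 * T\<^sup>2))"
  have K: "K > 0" using T by (simp add: K_def)
  obtain s C where s: "T < s" "C > 0" "(\<integral>\<^sup>+\<tau>\<in>{0<..<s}. L2_norm (F s \<tau>) \<partial>lborel) < \<infinity>"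
    "\<And>\<tau>. \<tau> \<in> good \<Longrightarrow> ennreal (mass \<tau>) \<le> ennreal C * L2_norm (F s \<tau>)"
    by (rule mass_bound, rule that)
  define I where "I = (\<lambda>\<tau>. \<integral>\<^sup>+t. norm (W \<phi> (\<tau>, t)) \<partial>lborel)"
  have [measurable]: "W \<phi> \<in> borel_measurable (lborel \<Otimes>\<^sub>M lborel)" by (rule W_measurable[OF assms])
  have Im: "I \<in> borel_measurable lborel" unfolding I_def by measurable
  define c where "c = T * K * C"
  have c: "c > 0" using T K s by (simp add: c_def)
  have le: "I \<tau> \<le> ennreal c * (L2_norm (F s \<tau>) * indicator {0<..<s} \<tau>)" for \<tau>
  proof (cases "\<tau> \<in> good")
    case True
    then have \<tau>: "0 < \<tau>" "\<tau> < s" using good_subset s by auto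
    have "I \<tau> \<le> (\<integral>\<^sup>+t. ennreal (K * mass \<tau>) * indicator {0<..<T} t \<partial>lborel)"
      unfolding I_def
    proof (intro nn_integral_mono)
      fix t
      show "ennreal (norm (W \<phi> (\<tau>, t))) \<le> ennreal (K * mass \<tau>) * indicator {0<..<T} t"
        using ennreal_leI[OF norm_W_le[OF assms, of \<tau> t]] True
        by (cases "t \<in> {0<..<T}") (auto simp: K_def)
    qed
    also have "\<dots> = ennreal (K * mass \<tau>) * ennreal T"
      using T by (simp add: nn_integral_cmult)
    also have "\<dots> = ennreal (T * K) * ennreal (mass \<tau>)"
      using T K mass_nonneg by (simp add: mult_ac flip: ennreal_mult)
    also have "\<dots> \<le> ennreal (T * K) * (ennreal C * L2_norm (F s \<tau>))"
      by (intro mult_left_mono s True) auto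
    also have "\<dots> = ennreal c * L2_norm (F s \<tau>)"
      using T K s by (simp add: c_def ennreal_mult mult.assoc)
    finally show ?thesis using \<tau> by simp
  next
    case False
    then have "W \<phi> (\<tau>, t) = 0" for t by (simp add: W_def)
    then show ?thesis by (simp add: I_def)
  qed
  \<comment> \<open>The constant is moved to the side of I before integrating: pulling it out of the
    integral uses measurability, which is available for I but not for \<tau> \<mapsto>
    \<open>L2_norm (F s \<tau>)\<close>.\<close>
  have "ennreal (1 / c) * I \<tau> \<le> L2_norm (F s \<tau>) * indicator {0<..<s} \<tau>" for \<tau>
  proof -
    have "ennreal (1 / c) * I \<tau> \<le> ennreal (1 / c) * (ennreal c * (L2_norm (F s \<tau>) * indicator {0<..<s} \<tau>))"
      by (intro mult_left_mono le) auto
    also have "\<dots> = ennreal (1 / c * c) * (L2_norm (F s \<tau>) * indicator {0<..<s} \<tau>)"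
      using c by (subst ennreal_mult) (auto simp: mult.assoc)
    also have "1 / c * c = 1" using c by simp
    finally show ?thesis by simp
  qed
  then have "(\<integral>\<^sup>+\<tau>. ennreal (1 / c) * I \<tau> \<partial>lborel) \<le> (\<integral>\<^sup>+\<tau>\<in>{0<..<s}. L2_norm (F s \<tau>) \<partial>lborel)"
    by (intro nn_integral_mono)
  also note s(3)
  finally have "ennreal (1 / c) * (\<integral>\<^sup>+\<tau>. I \<tau> \<partial>lborel) < \<infinity>"
    unfolding nn_integral_cmult[OF Im] .
  then have "(\<integral>\<^sup>+\<tau>. I \<tau> \<partial>lborel) < \<infinity>"
    using c by (auto simp: ennreal_mult_less_top)
  then show "(\<integral>\<^sup>+q. norm (W \<phi> q) \<partial>(lborel \<Otimes>\<^sub>M lborel)) < \<infinity>"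
    unfolding I_def by (subst lborel.nn_integral_fst[symmetric]) auto
qed

end

lemma integral_Ioo_eq_Icc:
  fixes f :: "real \<Rightarrow> 'b::{banach, second_countable_topology}"
  assumes "\<And>t. t \<in> {a<..<b} \<Longrightarrow> f t = g t" "\<And>t. t \<notin> {a..b} \<Longrightarrow> f t = 0"
  shows "integral\<^sup>L lborel f = (LINT t|lborel. indicator {a..b} t *\<^sub>R g t)"
proof (rule integral_discrete_difference[where X = "{a, b}"])
  show "f t = indicator {a..b} t *\<^sub>R g t" if "t \<notin> {a, b}" for t
    using assms(1)[of t] assms(2)[of t] that by (cases "t \<in> {a..b}") auto
qed auto

section \<open>The tested Duhamel term, integrated in both orders\<close>

context mild_solution_tested
begin

abbreviation "G \<equiv> \<lambda>x::'a. complex_of_real (gauss a x)"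
abbreviation "L \<equiv> \<lambda>x::'a. complex_of_real (neg_lap_gauss a x)"

lemma GL_tests: "G \<in> tests" "L \<in> tests" by (auto simp: tests_def)

definition weight :: "real \<Rightarrow> complex" where "weight t = of_real (\<eta>'' t - \<eta>' t)"

text \<open>Integrated over t first, Z yields \<sigma> times the nonlinear term at time \<tau>.
  Integrated over \<tau> first, it yields the tested solution at time t minus the free evolution of
  the data. Equality of the two is the weak form of the equation.\<close>

definition Z :: "real \<times> real \<Rightarrow> complex" where
  "Z = (\<lambda>(\<tau>, t). weight t * W G (\<tau>, t) + of_real (\<eta> t) * W L (\<tau>, t))"

lemma weighted_W_integrable:
  assumes "\<phi> \<in> tests" "continuous_on UNIV c"
  shows "integrable (lborel \<Otimes>\<^sub>M lborel) (\<lambda>(\<tau>, t). c t * W \<phi> (\<tau>, t))"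
proof -
  have "bounded (c ` {0..T})"
    using assms(2) by (intro compact_imp_bounded compact_continuous_image) (auto intro: continuous_on_subset)
  then obtain B where "\<forall>z\<in>c ` {0..T}. norm z \<le> B" unfolding bounded_iff by blast
  then have B: "\<And>t. t \<in> {0..T} \<Longrightarrow> norm (c t) \<le> B" by blast
  show ?thesis
  proof (rule Bochner_Integration.integrable_bound)
    show "integrable (lborel \<Otimes>\<^sub>M lborel) (\<lambda>q. of_real B * W \<phi> q)"
      by (intro integrable_mult_right W_integrable assms)
    have "c \<in> borel_measurable borel" using assms(2) by (rule borel_measurable_continuous_onI)
    then show "(\<lambda>(\<tau>, t). c t * W \<phi> (\<tau>, t)) \<in> borel_measurable (lborel \<Otimes>\<^sub>M lborel)"
      using W_measurable[OF assms(1)] by measurable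
    have "norm (c t * W \<phi> (\<tau>, t)) \<le> norm (of_real B * W \<phi> (\<tau>, t))" for \<tau> t
    proof (cases "t \<in> {0..T}")
      case True
      then have "norm (c t) \<le> \<bar>B\<bar>" using B[of t] by simp
      then show ?thesis by (simp add: norm_mult mult_right_mono)
    next
      case False
      then have "W \<phi> (\<tau>, t) = 0" by (auto simp: W_def)
      then show ?thesis by simp
    qed
    then show "AE q in lborel \<Otimes>\<^sub>M lborel. norm (case q of (\<tau>, t) \<Rightarrow> c t * W \<phi> (\<tau>, t)) \<le> norm (of_real B * W \<phi> q)"
      by auto
  qed
qed

lemma Z_integrable: "integrable (lborel \<Otimes>\<^sub>M lborel) Z"
proof -
  have "integrable (lborel \<Otimes>\<^sub>M lborel) (\<lambda>q. (case q of (\<tau>, t) \<Rightarrow> weight t * W G (\<tau>, t)) + (case q of (\<tau>, t) \<Rightarrow> of_real (\<eta> t) * W L (\<tau>, t)))"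
    unfolding weight_def
    by (intro Bochner_Integration.integrable_add weighted_W_integrable GL_tests continuous_intros continuous_cutoff)
  then show ?thesis unfolding Z_def by (simp add: case_prod_unfold)
qed

definition e :: "real \<Rightarrow> real" where
  "e \<tau> = indicator good \<tau> * (\<eta> \<tau> * (LINT x|lborel. w \<tau> x * gauss a x))"

lemma Z_integral_time: "(LINT t|lborel. Z (\<tau>, t)) = of_real (\<sigma> * e \<tau>)"
proof (cases "\<tau> \<in> good")
  case True
  note g = good_growing[OF True]
  have \<tau>: "0 < \<tau>" "\<tau> < T" using True good_subset by auto
  define d where "d = pair_coeff a (\<lambda>x. \<sigma> * w \<tau> x)"
  have "(LINT t|lborel. Z (\<tau>, t)) = (LINT t|lborel. indicator {\<tau>..T} t *\<^sub>R (of_real (\<eta>'' t - \<eta>' t) * damped_pair d (t - \<tau>) +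
      of_real (\<eta> t) * (damped_pair d (t - \<tau>) / 4 - damped_pair (\<lambda>k. d (Suc k)) (t - \<tau>))))"
    using True \<tau>
    by (intro integral_Ioo_eq_Icc)
      (auto simp: Z_def W_def weight_def F_def d_def pair_damped_gauss[OF g a] pair_damped_neg_lap_gauss[OF g a])
  also have "\<dots> = of_real (\<eta> \<tau>) * d 0"
    unfolding d_def by (rule cutoff_duhamel[OF pair_coeff_bounds[OF g a]]) (use \<tau> in simp)
  also have "\<dots> = of_real (\<sigma> * e \<tau>)"
    using True unfolding d_def pair_coeff_at_0[OF g a] e_def by (simp add: mult.assoc)
  finally show ?thesis .
next
  case False
  then have "Z (\<tau>, t) = 0" for t by (simp add: Z_def W_def)
  with False show ?thesis by (simp add: e_def)
qed

text \<open>The a priori finiteness of the double integral of |u|^p against the test function: up to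
  the sign, e is a partial integral of the integrable Z. It permits cancelling the integral of e in
  \<open>tested_inequality\<close>.\<close>

lemma e_integrable: "integrable lborel e"
proof -
  have "integrable lborel (\<lambda>\<tau>. LINT t|lborel. Z (\<tau>, t))"
    using lborel_pair.integrable_fst[of "\<lambda>\<tau> t. Z (\<tau>, t)"] Z_integrable by simp
  then have "integrable lborel (\<lambda>\<tau>. Re (of_real (\<sigma> * e \<tau>)))"
    unfolding Z_integral_time by (rule integrable_Re)
  from integrable_mult_right[OF this, of \<sigma>] show ?thesis using \<sigma> by (auto simp: mult.assoc[symmetric])
qed

definition data :: "real \<Rightarrow> complex" where
  "data t = weight t * (dt_damped t (dist_of v\<^sub>0) G + damped t (dist_of v\<^sub>0) G + damped t (dist_of v\<^sub>1) G) +
    of_real (\<eta> t) * (dt_damped t (dist_of v\<^sub>0) L + damped t (dist_of v\<^sub>0) L + damped t (dist_of v\<^sub>1) L)"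

text \<open>The three pieces of the free evolution fall under \<open>cutoff_time_derivative\<close>
  (once) and \<open>cutoff_duhamel\<close> at \<tau> = 0 (twice), where \<eta>(0) = 1.\<close>

lemma data_integral:
  "integrable lborel (\<lambda>t. indicator {0..T} t *\<^sub>R data t)"
  "(LINT t|lborel. indicator {0..T} t *\<^sub>R data t) = of_real (LINT x|lborel. (v\<^sub>0 x + v\<^sub>1 x) * gauss a x)"
proof -
  define d0 where "d0 = pair_coeff a v\<^sub>0"
  define d1 where "d1 = pair_coeff a v\<^sub>1"
  define D where "D = (\<lambda>d t. of_real (\<eta>'' t - \<eta>' t) * damped_pair d t + of_real (\<eta> t) * (damped_pair d t / 4 - damped_pair (\<lambda>k. d (Suc k)) t))"
  define D' where "D' = (\<lambda>t. of_real (\<eta>'' t - \<eta>' t) * damped_pair_deriv d0 t + of_real (\<eta> t) * (damped_pair_deriv d0 t / 4 - damped_pair_deriv (\<lambda>k. d0 (Suc k)) t))"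
  note b0 = pair_coeff_bounds[OF v01(1) a, folded d0_def]
  note b1 = pair_coeff_bounds[OF v01(2) a, folded d1_def]
  have data: "data t = D' t + D d0 t + D d1 t" for t
    unfolding data_def weight_def dt_damped_gauss[OF v01(1) a] dt_damped_neg_lap_gauss[OF v01(1) a]
      pair_damped_gauss[OF v01(1) a] pair_damped_neg_lap_gauss[OF v01(1) a] pair_damped_gauss[OF v01(2) a] pair_damped_neg_lap_gauss[OF v01(2) a]
      D_def D'_def d0_def d1_def by (simp add: algebra_simps)
  have c: "continuous_on {0..T} D'" "continuous_on {0..T} (D d0)" "continuous_on {0..T} (D d1)"
    unfolding D_def D'_def
    by (auto intro!: continuous_intros continuous_cutoff continuous_K[OF b0] continuous_K[OF b1])
  have i: "integrable lborel (\<lambda>t. indicator {0..T} t *\<^sub>R D' t)" "integrable lborel (\<lambda>t. indicator {0..T} t *\<^sub>R D d0 t)"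
    "integrable lborel (\<lambda>t. indicator {0..T} t *\<^sub>R D d1 t)"
    using c[THEN borel_integrable_atLeastAtMost'] by (auto simp: set_integrable_def)
  show "integrable lborel (\<lambda>t. indicator {0..T} t *\<^sub>R data t)"
    unfolding data scaleR_add_right by (intro Bochner_Integration.integrable_add i)
  have "(LINT t|lborel. indicator {0..T} t *\<^sub>R data t) =
      (LINT t|lborel. indicator {0..T} t *\<^sub>R D' t) + (LINT t|lborel. indicator {0..T} t *\<^sub>R D d0 t) + (LINT t|lborel. indicator {0..T} t *\<^sub>R D d1 t)"
    unfolding data scaleR_add_right by (simp add: i Bochner_Integration.integral_add)
  also have "(LINT t|lborel. indicator {0..T} t *\<^sub>R D' t) = 0"
    unfolding D'_def by (rule cutoff_time_derivative[OF b0])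
  also have "(LINT t|lborel. indicator {0..T} t *\<^sub>R D d0 t) = d0 0"
    using cutoff_duhamel[OF b0, of 0] T unfolding D_def by (simp add: vals)
  also have "(LINT t|lborel. indicator {0..T} t *\<^sub>R D d1 t) = d1 0"
    using cutoff_duhamel[OF b1, of 0] T unfolding D_def by (simp add: vals)
  also have "0 + d0 0 + d1 0 = of_real (LINT x|lborel. (v\<^sub>0 x + v\<^sub>1 x) * gauss a x)"
  proof -
    have "(LINT x|lborel. (v\<^sub>0 x + v\<^sub>1 x) * gauss a x) = (LINT x|lborel. v\<^sub>0 x * gauss a x) + (LINT x|lborel. v\<^sub>1 x * gauss a x)"
      unfolding distrib_right using a v01 by (intro Bochner_Integration.integral_add slowly_growing_integrable_gauss) auto
    then show ?thesis unfolding d0_def d1_def pair_coeff_at_0[OF v01(1) a] pair_coeff_at_0[OF v01(2) a] by simp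
  qed
  finally show "(LINT t|lborel. indicator {0..T} t *\<^sub>R data t) = of_real (LINT x|lborel. (v\<^sub>0 x + v\<^sub>1 x) * gauss a x)" .
qed

lemma Z_integral_source:
  "AE t in lborel. t \<in> {0<..<T} \<longrightarrow> (LINT \<tau>|lborel. Z (\<tau>, t)) = weight t * dist_of (u t) G + of_real (\<eta> t) * dist_of (u t) L - data t"
proof -
  have i: "AE t in lborel. integrable lborel (\<lambda>\<tau>. W \<phi> (\<tau>, t))" if "\<phi> \<in> tests" for \<phi>
    using lborel_pair.AE_integrable_snd[of "\<lambda>\<tau> t. W \<phi> (\<tau>, t)"] W_integrable[OF that] by simp
  show ?thesis
    using solution(2) F_measurable i[OF GL_tests(1)] i[OF GL_tests(2)]
  proof eventually_elim
    case (elim t)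
    show ?case
    proof
      assume t: "t \<in> {0<..<T}"
      then have t': "t \<in> {0<..<T'}" using T' by auto
      have W: "(LINT \<tau>|lborel. W \<phi> (\<tau>, t)) = (LINT \<tau>:{0<..<t}|lborel. F t \<tau> \<phi>)" if "\<phi> \<in> tests" for \<phi>
        unfolding set_lebesgue_integral_def
      proof (rule integral_cong_AE)
        show "(\<lambda>\<tau>. W \<phi> (\<tau>, t)) \<in> borel_measurable lborel"
          using elim(3,4) that by (auto simp: tests_def dest: borel_measurable_integrable)
        show "(\<lambda>\<tau>. indicator {0<..<t} \<tau> *\<^sub>R F t \<tau> \<phi>) \<in> borel_measurable lborel"
          using elim(2) t' that by simp
        show "AE \<tau> in lborel. W \<phi> (\<tau>, t) = indicator {0<..<t} \<tau> *\<^sub>R F t \<tau> \<phi>"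
          using AE_good by eventually_elim (use t in \<open>auto simp: W_def indicator_def\<close>)
      qed
      have "(LINT \<tau>|lborel. Z (\<tau>, t)) = weight t * (LINT \<tau>|lborel. W G (\<tau>, t)) + of_real (\<eta> t) * (LINT \<tau>|lborel. W L (\<tau>, t))"
        unfolding Z_def prod.case using elim(3,4)
        by (subst Bochner_Integration.integral_add) auto
      also have "\<dots> = weight t * (LINT \<tau>:{0<..<t}|lborel. F t \<tau> G) + of_real (\<eta> t) * (LINT \<tau>:{0<..<t}|lborel. F t \<tau> L)"
        by (simp only: W GL_tests)
      also have "\<dots> = weight t * dist_of (u t) G + of_real (\<eta> t) * dist_of (u t) L - data t"
        using elim(1) t' GL_tests[THEN tests_schwartz] by (simp add: data_def algebra_simps)
      finally show "(LINT \<tau>|lborel. Z (\<tau>, t)) = weight t * dist_of (u t) G + of_real (\<eta> t) * dist_of (u t) L - data t" .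
    qed
  qed
qed

text \<open>The pointwise hypothesis is Young's inequality for u times the adjoint operator on the
  test function, with a remainder Y independent of t. Its first term integrates to exactly the
  nonlinear term on the other side and cancels; T is the length of the time interval over which Y is
  integrated.\<close>

lemma tested_inequality:
  fixes Y :: "'a \<Rightarrow> real"
  assumes Y: "integrable lborel Y"
    and young: "\<And>t x r. 0 < t \<Longrightarrow> t < T \<Longrightarrow>
      \<bar>r\<bar> * \<bar>(\<eta>'' t - \<eta>' t) * gauss a (x :: 'a) + \<eta> t * neg_lap_gauss a x\<bar> \<le> \<eta> t * (\<bar>r\<bar> powr p * gauss a x) + Y x"
  shows "\<sigma> * (LINT x|lborel. (v\<^sub>0 x + v\<^sub>1 x) * gauss a x) \<le> T * (LINT x|lborel. Y x)"
proof -
  define I where "I = (\<lambda>t. LINT \<tau>|lborel. Z (\<tau>, t))"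
  have Ii: "integrable lborel I"
    unfolding I_def using lborel_pair.integrable_snd[of "\<lambda>\<tau> t. Z (\<tau>, t)"] Z_integrable by simp
  have "integral\<^sup>L lborel I = (LINT \<tau>|lborel. (LINT t|lborel. Z (\<tau>, t)))"
    unfolding I_def using lborel_pair.Fubini_integral[of "\<lambda>\<tau> t. Z (\<tau>, t)"] Z_integrable by simp
  also have "\<dots> = of_real (\<sigma> * integral\<^sup>L lborel e)"
    unfolding Z_integral_time integral_complex_of_real by simp
  finally have Ie: "integral\<^sup>L lborel I = of_real (\<sigma> * integral\<^sup>L lborel e)" .
  have u: "\<sigma> * Re (weight t * dist_of (u t) G + of_real (\<eta> t) * dist_of (u t) L) \<le> e t + (LINT x|lborel. Y x)"
    if t: "t \<in> good" and ut: "slowly_growing (u t)" for t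
  proof -
    have t': "0 < t" "t < T" using t good_subset by auto
    define \<psi> where "\<psi> = (\<lambda>x::'a. (\<eta>'' t - \<eta>' t) * gauss a x + \<eta> t * neg_lap_gauss a x)"
    have iu: "integrable lborel (\<lambda>x. u t x * gauss a x)" "integrable lborel (\<lambda>x. u t x * neg_lap_gauss a x)"
      using ut a by (auto intro: slowly_growing_integrable_gauss slowly_growing_neg_lap)
    have D: "dist_of (u t) (\<lambda>x. complex_of_real (h x)) = of_real (LINT x|lborel. u t x * h x)" for h
      unfolding dist_of_def dist_of_cfun_def integral_complex_of_real[symmetric] by simp
    have "(LINT x|lborel. u t x * \<psi> x) = (LINT x|lborel. (\<eta>'' t - \<eta>' t) * (u t x * gauss a x) + \<eta> t * (u t x * neg_lap_gauss a x))"
      by (simp add: \<psi>_def algebra_simps)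
    also have "\<dots> = (\<eta>'' t - \<eta>' t) * (LINT x|lborel. u t x * gauss a x) + \<eta> t * (LINT x|lborel. u t x * neg_lap_gauss a x)"
      using iu by (subst Bochner_Integration.integral_add) auto
    finally have "\<sigma> * Re (weight t * dist_of (u t) G + of_real (\<eta> t) * dist_of (u t) L) = \<sigma> * (LINT x|lborel. u t x * \<psi> x)"
      unfolding D weight_def by simp
    also have "\<dots> \<le> \<bar>LINT x|lborel. u t x * \<psi> x\<bar>" using \<sigma> by auto
    also have "\<dots> \<le> (LINT x|lborel. \<eta> t * (w t x * gauss a x) + Y x)"
    proof -
      have i1: "integrable lborel (\<lambda>x. u t x * \<psi> x)"
      proof -
        have "integrable lborel (\<lambda>x. (\<eta>'' t - \<eta>' t) * (u t x * gauss a x) + \<eta> t * (u t x * neg_lap_gauss a x))"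
          by (intro Bochner_Integration.integrable_add integrable_mult_right iu)
        then show ?thesis by (simp add: \<psi>_def algebra_simps)
      qed
      have i2: "integrable lborel (\<lambda>x. \<eta> t * (w t x * gauss a x) + Y x)"
        using a by (intro Bochner_Integration.integrable_add integrable_mult_right Y slowly_growing_integrable_gauss growing_w good_growing t) auto
      have "norm (u t x * \<psi> x) \<le> \<eta> t * (w t x * gauss a x) + Y x" for x
        using young[OF t', of "u t x" x] by (simp add: \<psi>_def w_def abs_mult)
      from Bochner_Integration.integral_norm_bound_integral[OF i1 i2 this] show ?thesis by simp
    qed
    also have "\<dots> = e t + (LINT x|lborel. Y x)"
      using a t Y slowly_growing_integrable_gauss[OF growing_w[OF good_growing[OF t]], of a]
      by (subst Bochner_Integration.integral_add) (auto simp: e_def)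
    finally show ?thesis .
  qed
  have indT: "integrable lborel (indicator {0..T} :: real \<Rightarrow> real)" using T by (intro integrable_real_indicator) auto
  \<comment> \<open>J majorizes \<sigma> \<open>Re (I t)\<close>, whose integral is that of e.
    Comparing the integrals leaves the data against Y.\<close>
  define J where "J = (\<lambda>t. e t + indicator {0..T} t * (LINT x|lborel. Y x) - \<sigma> * Re (indicator {0..T} t *\<^sub>R data t))"
  have "AE t in lborel. t \<noteq> 0" "AE t in lborel. t \<noteq> T" by (rule AE_lborel_singleton)+
  then have "AE t in lborel. \<sigma> * Re (I t) \<le> J t"
    using Z_integral_source AE_good solution(1)
  proof eventually_elim
    case (elim t)
    show ?case
    proof (cases "t \<in> {0<..<T}")
      case True
      then have "t \<in> good" "slowly_growing (u t)" using elim T' by auto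
      from u[OF this] True elim show ?thesis by (simp add: I_def J_def right_diff_distrib)
    next
      case False
      then have "Z (\<tau>, t) = 0" for \<tau> by (auto simp: Z_def W_def)
      then have "I t = 0" by (simp add: I_def)
      moreover have "t \<notin> {0..T}" "t \<notin> good" using False elim good_subset by auto
      ultimately show ?thesis by (simp add: J_def e_def)
    qed
  qed
  moreover have Ji: "integrable lborel J"
    unfolding J_def using data_integral(1) e_integrable indT
    by (intro Bochner_Integration.integrable_add Bochner_Integration.integrable_diff integrable_mult_right integrable_mult_left integrable_Re) auto
  ultimately have "(LINT t|lborel. \<sigma> * Re (I t)) \<le> integral\<^sup>L lborel J"
    using Ii by (intro integral_mono_AE integrable_mult_right integrable_Re) auto
  moreover have "(LINT t|lborel. \<sigma> * Re (I t)) = integral\<^sup>L lborel e"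
  proof -
    have "(LINT t|lborel. \<sigma> * Re (I t)) = \<sigma> * Re (integral\<^sup>L lborel I)"
      using Ii by (simp add: integral_Re)
    then show ?thesis unfolding Ie using \<sigma> by auto
  qed
  moreover have "integral\<^sup>L lborel J = integral\<^sup>L lborel e + T * (LINT x|lborel. Y x) - \<sigma> * (LINT x|lborel. (v\<^sub>0 x + v\<^sub>1 x) * gauss a x)"
  proof -
    have "integral\<^sup>L lborel J = (LINT t|lborel. e t + indicator {0..T} t * (LINT x|lborel. Y x)) - (LINT t|lborel. \<sigma> * Re (indicator {0..T} t *\<^sub>R data t))"
      unfolding J_def using data_integral(1) e_integrable indT
      by (intro Bochner_Integration.integral_diff Bochner_Integration.integrable_add integrable_mult_right integrable_mult_left integrable_Re) auto
    also have "(LINT t|lborel. \<sigma> * Re (indicator {0..T} t *\<^sub>R data t)) = \<sigma> * Re (LINT t|lborel. indicator {0..T} t *\<^sub>R data t)"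
      unfolding integral_mult_right_zero by (simp only: integral_Re[OF data_integral(1)])
    also have "\<dots> = \<sigma> * (LINT x|lborel. (v\<^sub>0 x + v\<^sub>1 x) * gauss a x)"
      unfolding data_integral(2) by simp
    also have "(LINT t|lborel. e t + indicator {0..T} t * (LINT x|lborel. Y x)) = integral\<^sup>L lborel e + T * (LINT x|lborel. Y x)"
      using e_integrable T indT by (subst Bochner_Integration.integral_add) auto
    finally show ?thesis .
  qed
  ultimately show ?thesis by linarith
qed

end

section \<open>The upper bound for the lifespan\<close>

text \<open>A crude form without the sharp constants: depending on whether y or x^(p-1) is larger,
  one of the two summands alone bounds the product.\<close>

lemma young_le:
  fixes x y p :: real
  assumes "x \<ge> 0" "y \<ge> 0" "p > 1"
  shows "x * y \<le> x powr p + y powr (p / (p - 1))"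
proof (cases "x = 0 \<or> y = 0")
  case False
  with assms have xy: "x > 0" "y > 0" by auto
  show ?thesis
  proof (cases "y \<le> x powr (p - 1)")
    case True
    then have "x * y \<le> x * x powr (p - 1)" using xy by (intro mult_left_mono) auto
    also have "\<dots> = x powr p" using xy by (simp add: powr_mult_base)
    finally show ?thesis by (simp add: add_increasing2)
  next
    case False
    then have "(x powr (p - 1)) powr (1 / (p - 1)) \<le> y powr (1 / (p - 1))"
      using assms by (intro powr_mono2) auto
    then have "x \<le> y powr (1 / (p - 1))" using xy assms by (simp add: powr_powr)
    then have "x * y \<le> y powr (1 / (p - 1)) * y" using xy by (intro mult_right_mono) auto
    also have "\<dots> = y powr (1 + 1 / (p - 1))" using xy by (simp add: powr_mult_base mult.commute)
    also have "1 + 1 / (p - 1) = p / (p - 1)" using assms by (simp add: field_simps)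
    finally show ?thesis by (simp add: add_increasing)
  qed
qed (use assms in auto)

text \<open>Give r the factor \<theta>^(2/(p-1)). Raising it to the power p gains the exponent
  2p/(p-1) - 2/(p-1) = 2, exactly the two powers of \<theta> lost in two derivatives of the cutoff.
  The condition on m leaves a nonnegative power of \<theta> over.\<close>

lemma weighted_young_le:
  fixes r y p \<theta> :: real
  assumes "r \<ge> 0" "y \<ge> 0" "p > 1" "0 < \<theta>" "\<theta> \<le> 1" and m: "real m \<ge> 2 / (p - 1)"
  shows "r * (y * \<theta> ^ m) \<le> r powr p * \<theta> ^ (m + 2) + y powr (p / (p - 1))"
proof -
  define c where "c = real m - 2 / (p - 1)"
  have c: "c \<ge> 0" using m by (simp add: c_def)
  have \<theta>: "\<theta> ^ m = \<theta> powr c * \<theta> powr (2 / (p - 1))"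
    using assms by (simp add: c_def powr_realpow flip: powr_add)
  have "r * (y * \<theta> ^ m) = \<theta> powr c * ((r * \<theta> powr (2 / (p - 1))) * y)"
    by (simp add: \<theta> mult_ac)
  also have "\<dots> \<le> \<theta> powr c * ((r * \<theta> powr (2 / (p - 1))) powr p + y powr (p / (p - 1)))"
    using assms by (intro mult_left_mono young_le) auto
  also have "\<dots> = r powr p * (\<theta> powr c * (\<theta> powr (2 / (p - 1))) powr p) + \<theta> powr c * y powr (p / (p - 1))"
    using assms by (simp add: powr_mult algebra_simps)
  also have "\<theta> powr c * (\<theta> powr (2 / (p - 1))) powr p = \<theta> powr (c + 2 / (p - 1) * p)"
    by (simp add: powr_powr powr_add)
  also have "c + 2 / (p - 1) * p = real (m + 2)"
  proof -
    have "c + 2 / (p - 1) * p = real m + 2 / (p - 1) * (p - 1)" by (simp add: c_def right_diff_distrib)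
    also have "2 / (p - 1) * (p - 1) = 2"
      using assms by (simp only: times_divide_eq_left) (rule nonzero_mult_div_cancel_right, simp)
    finally show ?thesis by simp
  qed
  also have "\<theta> powr real (m + 2) = \<theta> ^ (m + 2)" using assms by (intro powr_realpow) auto
  also have "\<theta> powr c * y powr (p / (p - 1)) \<le> 1 * y powr (p / (p - 1))"
    using assms c by (intro mult_right_mono powr_le1) auto
  finally show ?thesis by simp
qed

text \<open>The exponent m + 2 leaves \<theta>^m after two derivatives, for \<theta> = 1 - t^2/T^2.
  Being even in t, the cutoff has zero derivative at t = 0.\<close>

definition \<eta>\<^sub>0 :: "nat \<Rightarrow> real \<Rightarrow> real \<Rightarrow> real" where
  "\<eta>\<^sub>0 m T t = (1 - t\<^sup>2 / T\<^sup>2) ^ (m + 2)"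

definition \<eta>\<^sub>1 :: "nat \<Rightarrow> real \<Rightarrow> real \<Rightarrow> real" where
  "\<eta>\<^sub>1 m T t = - (real (m + 2) * (2 * t / T\<^sup>2)) * (1 - t\<^sup>2 / T\<^sup>2) ^ (m + 1)"

definition \<eta>\<^sub>2 :: "nat \<Rightarrow> real \<Rightarrow> real \<Rightarrow> real" where
  "\<eta>\<^sub>2 m T t = real (m + 2) * real (m + 1) * (2 * t / T\<^sup>2)\<^sup>2 * (1 - t\<^sup>2 / T\<^sup>2) ^ m -
     real (m + 2) * (2 / T\<^sup>2) * (1 - t\<^sup>2 / T\<^sup>2) ^ (m + 1)"

lemma cutoff_power:
  assumes "T > 0"
  shows "cutoff (\<eta>\<^sub>0 m T) (\<eta>\<^sub>1 m T) (\<eta>\<^sub>2 m T) T"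
proof
  fix t
  have b: "((\<lambda>t. 1 - t\<^sup>2 / T\<^sup>2) has_real_derivative - (2 * t / T\<^sup>2)) (at t)"
  proof -
    have "((\<lambda>t. 1 - inverse (T\<^sup>2) * t\<^sup>2) has_real_derivative - (inverse (T\<^sup>2) * (2 * t))) (at t)"
      by (auto intro!: derivative_eq_intros)
    then show ?thesis by (simp add: divide_inverse mult_ac)
  qed
  show "(\<eta>\<^sub>0 m T has_real_derivative \<eta>\<^sub>1 m T t) (at t)"
    unfolding \<eta>\<^sub>0_def[abs_def] \<eta>\<^sub>1_def
    by (rule DERIV_cong[OF DERIV_power[OF b, of "m + 2"]]) (simp add: mult_ac)
  have c: "((\<lambda>t. - (real (m + 2) * (2 * t / T\<^sup>2))) has_real_derivative - (real (m + 2) * (2 / T\<^sup>2))) (at t)"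
  proof -
    have "((\<lambda>t. (- (real (m + 2) * (2 / T\<^sup>2))) * t) has_real_derivative - (real (m + 2) * (2 / T\<^sup>2))) (at t)"
      by (rule DERIV_cmult_Id)
    then show ?thesis by (simp add: mult_ac)
  qed
  define s where "s = 2 * t / T\<^sup>2"
  define v where "v = 2 / T\<^sup>2"
  have eq: "\<eta>\<^sub>2 m T t = - (real (m + 2) * v) * (1 - t\<^sup>2 / T\<^sup>2) ^ (m + 1) +
      real (m + 1) * (- s * (1 - t\<^sup>2 / T\<^sup>2) ^ (m + 1 - Suc 0)) * (- (real (m + 2) * s))"
    unfolding \<eta>\<^sub>2_def power2_eq_square[of "2 * t / T\<^sup>2"] s_def[symmetric] v_def[symmetric]
    by (simp only: add_diff_cancel_right' One_nat_def[symmetric] mult_minus_left mult_minus_right minus_minus mult_ac) (simp add: power2_eq_square)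
  show "(\<eta>\<^sub>1 m T has_real_derivative \<eta>\<^sub>2 m T t) (at t)"
    unfolding \<eta>\<^sub>1_def[abs_def] eq
    using DERIV_mult[OF c DERIV_power[OF b, of "m + 1"]] unfolding s_def v_def .
  show "continuous_on UNIV (\<eta>\<^sub>2 m T)" unfolding \<eta>\<^sub>2_def using assms by (intro continuous_intros) auto
qed (use assms in \<open>auto simp: \<eta>\<^sub>0_def \<eta>\<^sub>1_def\<close>)

text \<open>The second derivative is of order 1/T^2, which T \<ge> 1 lets one weaken to the order
  1/T of the first. That is also the order of the Laplacian on a Gaussian of width parameter 16 T:
  the scaling is that of the heat equation.\<close>

lemma cutoff_bounds:
  assumes T: "T \<ge> 1" and t: "0 < t" "t < T"
  defines "\<theta> \<equiv> 1 - t\<^sup>2 / T\<^sup>2"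
  shows "0 < \<theta>" "\<theta> \<le> 1" "\<bar>\<eta>\<^sub>2 m T t - \<eta>\<^sub>1 m T t\<bar> \<le> 8 * (real m + 2)\<^sup>2 / T * \<theta> ^ m" "\<eta>\<^sub>0 m T t \<le> \<theta> ^ m"
proof -
  have "t\<^sup>2 < T\<^sup>2" using t by (intro power_strict_mono) auto
  then show \<theta>: "0 < \<theta>" "\<theta> \<le> 1" using T by (auto simp: \<theta>_def divide_simps)
  have p1: "\<theta> ^ (m + 1) \<le> \<theta> ^ m" using \<theta> by (intro power_decreasing) auto
  show "\<eta>\<^sub>0 m T t \<le> \<theta> ^ m" unfolding \<eta>\<^sub>0_def \<theta>_def[symmetric] using \<theta> by (intro power_decreasing) auto
  have TT: "1 / T\<^sup>2 \<le> 1 / T" using T by (simp add: power2_eq_square divide_simps)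
  have s: "0 \<le> 2 * t / T\<^sup>2" "2 * t / T\<^sup>2 \<le> 2 / T" using t T by (auto simp: power2_eq_square divide_simps)
  have s2: "(2 * t / T\<^sup>2)\<^sup>2 \<le> 4 / T"
  proof -
    have "(2 * t / T\<^sup>2)\<^sup>2 \<le> (2 / T)\<^sup>2" by (intro power_mono s)
    also have "\<dots> = 4 * (1 / T\<^sup>2)" by (simp add: power2_eq_square)
    also have "\<dots> \<le> 4 * (1 / T)" by (intro mult_left_mono TT) simp
    finally show ?thesis by simp
  qed
  have M: "real (m + 2) * real (m + 1) \<le> (real m + 2)\<^sup>2" "real (m + 2) \<le> (real m + 2)\<^sup>2"
    by (auto simp: power2_eq_square algebra_simps)
  have A: "\<bar>real (m + 2) * real (m + 1) * (2 * t / T\<^sup>2)\<^sup>2 * \<theta> ^ m\<bar> \<le> (real m + 2)\<^sup>2 * (4 / T) * \<theta> ^ m"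
  proof -
    have "real (m + 2) * real (m + 1) * (2 * t / T\<^sup>2)\<^sup>2 * \<theta> ^ m \<le> (real m + 2)\<^sup>2 * (4 / T) * \<theta> ^ m"
      using \<theta> s2 M(1) T by (intro mult_mono) auto
    moreover have "0 \<le> real (m + 2) * real (m + 1) * (2 * t / T\<^sup>2)\<^sup>2 * \<theta> ^ m" using \<theta> by simp
    ultimately show ?thesis by linarith
  qed
  have B: "\<bar>real (m + 2) * (2 / T\<^sup>2) * \<theta> ^ (m + 1)\<bar> \<le> (real m + 2)\<^sup>2 * (2 / T) * \<theta> ^ m"
  proof -
    have "real (m + 2) * (2 / T\<^sup>2) * \<theta> ^ (m + 1) \<le> (real m + 2)\<^sup>2 * (2 / T) * \<theta> ^ m"
      using \<theta> TT M(2) p1 T by (intro mult_mono) auto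
    moreover have "0 \<le> real (m + 2) * (2 / T\<^sup>2) * \<theta> ^ (m + 1)" using \<theta> by simp
    ultimately show ?thesis by linarith
  qed
  have C: "\<bar>- (real (m + 2) * (2 * t / T\<^sup>2)) * \<theta> ^ (m + 1)\<bar> \<le> (real m + 2)\<^sup>2 * (2 / T) * \<theta> ^ m"
  proof -
    have "(real (m + 2) * (2 * t / T\<^sup>2)) * \<theta> ^ (m + 1) \<le> (real m + 2)\<^sup>2 * (2 / T) * \<theta> ^ m"
      using \<theta> s M(2) p1 T by (intro mult_mono) auto
    moreover have "0 \<le> (real (m + 2) * (2 * t / T\<^sup>2)) * \<theta> ^ (m + 1)"
      using \<theta> s(1) by (intro mult_nonneg_nonneg) auto
    ultimately show ?thesis by (simp only: mult_minus_left abs_minus_cancel abs_of_nonneg)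
  qed
  have "\<bar>\<eta>\<^sub>2 m T t - \<eta>\<^sub>1 m T t\<bar> \<le> (real m + 2)\<^sup>2 * (4 / T) * \<theta> ^ m + (real m + 2)\<^sup>2 * (2 / T) * \<theta> ^ m + (real m + 2)\<^sup>2 * (2 / T) * \<theta> ^ m"
    unfolding \<eta>\<^sub>2_def \<eta>\<^sub>1_def \<theta>_def[symmetric]
  proof -
    have "\<bar>X - Y - Z\<bar> \<le> a + b + c" if "\<bar>X\<bar> \<le> a" "\<bar>Y\<bar> \<le> b" "\<bar>Z\<bar> \<le> c" for X Y Z a b c :: real
      using that by linarith
    from this[OF A B C] show "\<bar>real (m + 2) * real (m + 1) * (2 * t / T\<^sup>2)\<^sup>2 * \<theta> ^ m -
      real (m + 2) * (2 / T\<^sup>2) * \<theta> ^ (m + 1) - - (real (m + 2) * (2 * t / T\<^sup>2)) * \<theta> ^ (m + 1)\<bar> \<le>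
      (real m + 2)\<^sup>2 * (4 / T) * \<theta> ^ m + (real m + 2)\<^sup>2 * (2 / T) * \<theta> ^ m + (real m + 2)\<^sup>2 * (2 / T) * \<theta> ^ m" .
  qed
  then show "\<bar>\<eta>\<^sub>2 m T t - \<eta>\<^sub>1 m T t\<bar> \<le> 8 * (real m + 2)\<^sup>2 / T * \<theta> ^ m"
    by (simp add: algebra_simps)
qed

lemma scaled_gauss_decay:
  fixes x :: "'a::euclidean_space"
  assumes "T > 0" "q \<ge> 0" "q \<le> real M"
  shows "(1 + (norm x)\<^sup>2 / T) powr q * gauss (16 * T) x \<le> exp (64 * (real M)\<^sup>2) * gauss (32 * T) x"
proof -
  define y where "y = x /\<^sub>R sqrt T"
  have "norm y = norm x / sqrt T" using assms by (simp add: y_def divide_inverse mult.commute)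
  then have y2: "(norm y)\<^sup>2 = (norm x)\<^sup>2 / T" using assms by (simp add: power_divide)
  have g: "gauss (c * T) x = gauss c y" for c using assms unfolding gauss_def y2 by (simp add: mult_ac)
  have "1 + (norm x)\<^sup>2 / T \<le> (1 + norm y)\<^sup>2" unfolding y2[symmetric] by (simp add: power2_sum)
  then have "(1 + (norm x)\<^sup>2 / T) ^ M \<le> (1 + norm y) ^ (2 * M)"
    unfolding power_mult using assms by (intro power_mono) auto
  moreover have "(1 + (norm x)\<^sup>2 / T) powr q \<le> (1 + (norm x)\<^sup>2 / T) ^ M"
  proof -
    have "1 + (norm x)\<^sup>2 / T \<ge> 1" using assms by simp
    then have "(1 + (norm x)\<^sup>2 / T) powr q \<le> (1 + (norm x)\<^sup>2 / T) powr real M" using assms by (intro powr_mono) auto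
    also have "\<dots> = (1 + (norm x)\<^sup>2 / T) ^ M" using \<open>1 + (norm x)\<^sup>2 / T \<ge> 1\<close> by (intro powr_realpow) linarith
    finally show ?thesis .
  qed
  ultimately have "(1 + (norm x)\<^sup>2 / T) powr q * gauss (16 * T) x \<le> (1 + norm y) ^ (2 * M) * gauss 16 y"
    unfolding g by (intro mult_right_mono) auto
  also have "\<dots> \<le> exp (real (2 * M) ^ 2 * 16) * gauss (2 * 16) y" by (intro gauss_decay(2)) simp
  also have "real (2 * M) ^ 2 * 16 = 64 * (real M)\<^sup>2" by (simp add: power2_eq_square)
  also have "gauss (2 * 16) y = gauss (32 * T) x" unfolding g by simp
  finally show ?thesis .
qed

text \<open>Only the annulus \<open>\<surd>T < |x| \<le> 2 \<surd>T\<close>, where the Gaussian of width \<open>\<surd>T\<close> is bounded below, is used.\<close>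

lemma data_lower_bound:
  fixes f :: "'a::euclidean_space \<Rightarrow> real"
  assumes T: "T \<ge> 1" and lam: "lam > 0" and int: "integrable lborel (\<lambda>x. f x * gauss (16 * T) x)"
    and f: "AE x in lborel. f x \<ge> (if norm x > 1 then norm x powr (- lam) else 0)"
  shows "2 powr (- lam) * exp (- 1 / 8) * unit_ball_vol (real DIM('a)) * (T powr (- lam / 2) * sqrt T ^ DIM('a)) \<le>
    (LINT x|lborel. f x * gauss (16 * T) x)"
proof -
  define n where "n = DIM('a)"
  define V where "V = unit_ball_vol (real n)"
  define A where "A = cball (0::'a) (2 * sqrt T) - cball 0 (sqrt T)"
  \<comment> \<open>On the annulus |x|^2 is at most 4T, so the Gaussian of width parameter 16 T is
    at least exp (-4T / 32T) = exp (-1/8).\<close>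
  define c where "c = (2 * sqrt T) powr (- lam) * exp (- 1 / 8)"
  have V: "V \<ge> 0" by (simp add: V_def)
  have sT: "sqrt T \<ge> 1" using T by simp
  have "emeasure lborel A \<le> emeasure lborel (cball (0::'a) (2 * sqrt T))"
    unfolding A_def by (intro emeasure_mono) auto
  also have "\<dots> < \<infinity>" by (rule emeasure_lborel_cball_finite)
  finally have A: "A \<in> sets lborel" "emeasure lborel A < \<infinity>"
    by (auto simp: A_def)
  \<comment> \<open>The annulus has volume V T^(n/2) (2^n - 1), and n \<ge> 1.\<close>
  have mA: "measure lborel A \<ge> V * sqrt T ^ n"
  proof -
    have "measure lborel A = measure lborel (cball (0::'a) (2 * sqrt T)) - measure lborel (cball (0::'a) (sqrt T))"
      unfolding A_def
    proof (intro measure_Diff)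
      show "emeasure lborel (cball (0::'a) (2 * sqrt T)) \<noteq> \<infinity>"
        using emeasure_lborel_cball_finite[of "0::'a" "2 * sqrt T"] by auto
      show "cball (0::'a) (sqrt T) \<subseteq> cball 0 (2 * sqrt T)" using sT by (intro subset_cball) simp
    qed auto
    also have "\<dots> = V * (2 * sqrt T) ^ n - V * sqrt T ^ n"
      using T by (simp add: content_cball V_def n_def)
    also have "\<dots> = V * sqrt T ^ n * (2 ^ n - 1)" by (simp add: power_mult_distrib algebra_simps)
    also have "\<dots> \<ge> V * sqrt T ^ n * 1"
    proof (intro mult_left_mono)
      have "n \<ge> 1" unfolding n_def using DIM_positive[where 'a='a] by linarith
      then have "(2::real) ^ 1 \<le> 2 ^ n" by (intro power_increasing) auto
      then show "(1::real) \<le> 2 ^ n - 1" by simp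
    qed (use V T in auto)
    finally show ?thesis by simp
  qed
  have "2 powr (- lam) * exp (- 1 / 8) * V * (T powr (- lam / 2) * sqrt T ^ n) = c * (V * sqrt T ^ n)"
    using T unfolding c_def by (simp add: powr_mult powr_half_sqrt[symmetric] powr_powr)
  also have "\<dots> \<le> c * measure lborel A" using mA by (intro mult_left_mono) (auto simp: c_def)
  also have "\<dots> = (LINT x|lborel. indicator A x * c)" using A by simp
  also have "\<dots> \<le> (LINT x|lborel. f x * gauss (16 * T) x)"
  proof (rule integral_mono_AE)
    show "integrable lborel (\<lambda>x. indicator A x * c)" using A by (intro integrable_mult_left) auto
    show "AE x in lborel. indicator A x * c \<le> f x * gauss (16 * T) x"
      using f
    proof eventually_elim
      case (elim x)
      show ?case
      proof (cases "x \<in> A")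
        case True
        then have x: "sqrt T < norm x" "norm x \<le> 2 * sqrt T" by (auto simp: A_def)
        then have "norm x > 1" using sT by linarith
        have "(2 * sqrt T) powr (- lam) \<le> norm x powr (- lam)"
          using x lam \<open>norm x > 1\<close> by (intro powr_mono2') auto
        also have "\<dots> \<le> f x" using elim \<open>norm x > 1\<close> by simp
        finally have 1: "(2 * sqrt T) powr (- lam) \<le> f x" .
        have "(norm x)\<^sup>2 \<le> (2 * sqrt T)\<^sup>2" using x by (intro power_mono) auto
        then have "(norm x)\<^sup>2 \<le> 4 * T" using T by (simp add: power_mult_distrib)
        then have "exp (- 1 / 8) \<le> gauss (16 * T) x" using T by (simp add: gauss_def field_simps)
        with 1 have "c \<le> f x * gauss (16 * T) x"
          unfolding c_def by (intro mult_mono order_trans[OF _ 1]) auto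
        then show ?thesis using True by simp
      next
        case False
        have "f x \<ge> 0" using elim by (auto split: if_splits intro: order_trans[OF powr_ge_zero])
        then show ?thesis using False by simp
      qed
    qed
  qed (rule int)
  finally show ?thesis unfolding V_def n_def .
qed

text \<open>C is fixed before \<epsilon>, the data and the solution. Data and remainder carry the
  same factor T^(n/2), which cancels and leaves \<epsilon> T^(-lam/2) against T^(1-q) with q =
  p/(p-1).\<close>

lemma existence_time_bound:
  fixes p lam :: real
  assumes p: "p > 1" and lam: "lam > 0"
  defines "\<kappa> \<equiv> 1 / (p - 1) - lam / 2"
  assumes \<kappa>: "\<kappa> > 0"
  shows "\<exists>C>0. \<forall>\<epsilon> \<sigma> T T' u u\<^sub>0 (u\<^sub>1 :: 'a::euclidean_space \<Rightarrow> real).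
    0 < \<epsilon> \<and> 1 \<le> T \<and> T < T' \<and> (\<sigma> = 1 \<or> \<sigma> = -1) \<and> slowly_growing u\<^sub>0 \<and> slowly_growing u\<^sub>1 \<and>
    (AE x in lborel. \<sigma> * (u\<^sub>0 x + u\<^sub>1 x) \<ge> (if norm x > 1 then norm x powr (- lam) else 0)) \<and>
    mild_solution_Linf (\<lambda>r. \<sigma> * \<bar>r\<bar> powr p) (\<lambda>x. \<epsilon> * u\<^sub>0 x) (\<lambda>x. \<epsilon> * u\<^sub>1 x) T' u \<longrightarrow>
    T \<le> C * \<epsilon> powr (- 1 / \<kappa>)"
proof -
  define n where "n = DIM('a)"
  define q where "q = p / (p - 1)"
  define m where "m = nat \<lceil>2 / (p - 1)\<rceil>"
  define M where "M = nat \<lceil>q\<rceil>"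
  \<comment> \<open>The constant of \<open>cutoff_bounds\<close> plus the dimension, which bounds
    the Laplacian of the Gaussian.\<close>
  define K where "K = 8 * (real m + 2)\<^sup>2 + real n"
  define E where "E = exp (64 * (real M)\<^sup>2)"
  define c where "c = 2 powr (- lam) * exp (- 1 / 8) * unit_ball_vol (real n)"
  define C\<^sub>1 where "C\<^sub>1 = K powr q * E * sqrt (64 * pi) ^ n"
  define C where "C = (C\<^sub>1 / c) powr (1 / \<kappa>)"
  have q: "q > 0" "q \<le> real M" using p by (auto simp: q_def M_def real_nat_ceiling_ge)
  have m: "real m \<ge> 2 / (p - 1)" unfolding m_def by (rule real_nat_ceiling_ge)
  have K: "K > 0" unfolding K_def by (intro add_pos_nonneg) (auto simp: zero_less_power2)
  have E: "E > 0" by (simp add: E_def)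
  have c: "c > 0" unfolding c_def by (intro mult_pos_pos unit_ball_vol_pos) auto
  have C\<^sub>1: "C\<^sub>1 > 0" using K E by (simp add: C\<^sub>1_def)
  have "T \<le> C * \<epsilon> powr (- 1 / \<kappa>)"
    if \<epsilon>: "0 < \<epsilon>" and T: "1 \<le> T" "T < T'" and \<sigma>: "\<sigma> = 1 \<or> \<sigma> = -1"
      and gr: "slowly_growing u\<^sub>0" "slowly_growing u\<^sub>1"
      and pos: "AE x in lborel. \<sigma> * (u\<^sub>0 x + u\<^sub>1 x) \<ge> (if norm x > 1 then norm x powr (- lam) else 0)"
      and sol: "mild_solution_Linf (\<lambda>r. \<sigma> * \<bar>r\<bar> powr p) (\<lambda>x. \<epsilon> * u\<^sub>0 x) (\<lambda>x. \<epsilon> * u\<^sub>1 x) T' u"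
    for \<epsilon> \<sigma> T T' u and u\<^sub>0 u\<^sub>1 :: "'a \<Rightarrow> real"
  proof -
    interpret cut: cutoff "\<eta>\<^sub>0 m T" "\<eta>\<^sub>1 m T" "\<eta>\<^sub>2 m T" T using T by (intro cutoff_power) simp
    interpret sol: mild_solution_tested "\<eta>\<^sub>0 m T" "\<eta>\<^sub>1 m T" "\<eta>\<^sub>2 m T" T u "\<lambda>x. \<epsilon> * u\<^sub>0 x" "\<lambda>x. \<epsilon> * u\<^sub>1 x" \<sigma> p "16 * T" T'
      by unfold_locales (use T \<sigma> sol gr in \<open>auto intro: slowly_growing_cmult\<close>)
    \<comment> \<open>The remainder in Young's inequality is y^q times the Gaussian. Its polynomial
      weight in x / sqrt T costs the factor E, independent of T, and doubles the width parameter
      from 16 T to 32 T.\<close>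
    define Y where "Y = (\<lambda>x::'a. (K / T) powr q * E * gauss (32 * T) x)"
    have test: "\<bar>r\<bar> * \<bar>(\<eta>\<^sub>2 m T t - \<eta>\<^sub>1 m T t) * gauss (16 * T) x + \<eta>\<^sub>0 m T t * neg_lap_gauss (16 * T) x\<bar> \<le>
        \<eta>\<^sub>0 m T t * (\<bar>r\<bar> powr p * gauss (16 * T) x) + Y x" if t: "0 < t" "t < T" for t r and x :: 'a
    proof -
      define \<theta> where "\<theta> = 1 - t\<^sup>2 / T\<^sup>2"
      define y where "y = K / T * (1 + (norm x)\<^sup>2 / T)"
      note b = cutoff_bounds(1,2)[OF T(1) t, folded \<theta>_def] cutoff_bounds(3,4)[OF T(1) t, of m, folded \<theta>_def]
      have y: "y \<ge> 0" using K T by (simp add: y_def)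
      have \<eta>0: "\<eta>\<^sub>0 m T t = \<theta> ^ (m + 2)" by (simp add: \<eta>\<^sub>0_def \<theta>_def)
      have lap: "\<bar>neg_lap_gauss (16 * T) x\<bar> \<le> real n / T * (1 + (norm x)\<^sup>2 / T) * gauss (16 * T) x"
      proof -
        have n1: "real n \<ge> 1" unfolding n_def using DIM_positive[where 'a='a] by linarith
        have "\<bar>real n / (16 * T) - (norm x)\<^sup>2 / (16 * T)\<^sup>2\<bar> \<le> real n / (16 * T) + (norm x)\<^sup>2 / (16 * T)\<^sup>2"
          using T by (intro abs_leI) auto
        also have "\<dots> \<le> real n / T + real n / T * ((norm x)\<^sup>2 / T)"
        proof (intro add_mono)
          show "real n / (16 * T) \<le> real n / T" using T by (intro divide_left_mono) auto
          have "(norm x)\<^sup>2 / (16 * T)\<^sup>2 \<le> 1 * ((norm x)\<^sup>2 / (T * T))"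
            using T by (simp add: power2_eq_square divide_simps)
          also have "\<dots> \<le> real n * ((norm x)\<^sup>2 / (T * T))" using n1 by (intro mult_right_mono) auto
          finally show "(norm x)\<^sup>2 / (16 * T)\<^sup>2 \<le> real n / T * ((norm x)\<^sup>2 / T)" by simp
        qed
        also have "\<dots> = real n / T * (1 + (norm x)\<^sup>2 / T)" by (simp add: algebra_simps)
        finally have "\<bar>real n / (16 * T) - (norm x)\<^sup>2 / (16 * T)\<^sup>2\<bar> \<le> real n / T * (1 + (norm x)\<^sup>2 / T)" .
        from mult_right_mono[OF this gauss_nonneg] show ?thesis
          unfolding neg_lap_gauss_def n_def[symmetric] abs_mult abs_of_nonneg[OF gauss_nonneg] .
      qed
      have "\<bar>(\<eta>\<^sub>2 m T t - \<eta>\<^sub>1 m T t) * gauss (16 * T) x + \<eta>\<^sub>0 m T t * neg_lap_gauss (16 * T) x\<bar> \<le>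
          \<bar>\<eta>\<^sub>2 m T t - \<eta>\<^sub>1 m T t\<bar> * gauss (16 * T) x + \<eta>\<^sub>0 m T t * \<bar>neg_lap_gauss (16 * T) x\<bar>"
        using b(1) by (intro order_trans[OF abs_triangle_ineq]) (simp add: abs_mult \<eta>0)
      also have "\<dots> \<le> (8 * (real m + 2)\<^sup>2 / T * \<theta> ^ m) * (1 + (norm x)\<^sup>2 / T) * gauss (16 * T) x +
          \<theta> ^ m * (real n / T * (1 + (norm x)\<^sup>2 / T) * gauss (16 * T) x)"
      proof (intro add_mono mult_mono lap b)
        show "\<bar>\<eta>\<^sub>2 m T t - \<eta>\<^sub>1 m T t\<bar> \<le> 8 * (real m + 2)\<^sup>2 / T * \<theta> ^ m * (1 + (norm x)\<^sup>2 / T)"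
        proof -
          have "8 * (real m + 2)\<^sup>2 / T * \<theta> ^ m * 1 \<le> 8 * (real m + 2)\<^sup>2 / T * \<theta> ^ m * (1 + (norm x)\<^sup>2 / T)"
            using b(1) T by (intro mult_left_mono) auto
          with b(3) show ?thesis by linarith
        qed
      qed (use b T in auto)
      also have "\<dots> = y * \<theta> ^ m * gauss (16 * T) x"
        unfolding y_def K_def by (simp add: algebra_simps add_divide_distrib)
      finally have "\<bar>r\<bar> * \<bar>(\<eta>\<^sub>2 m T t - \<eta>\<^sub>1 m T t) * gauss (16 * T) x + \<eta>\<^sub>0 m T t * neg_lap_gauss (16 * T) x\<bar> \<le>
          \<bar>r\<bar> * (y * \<theta> ^ m * gauss (16 * T) x)"
        by (rule mult_left_mono) simp
      also have "\<dots> = (\<bar>r\<bar> * (y * \<theta> ^ m)) * gauss (16 * T) x" by simp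
      also have "\<dots> \<le> (\<bar>r\<bar> powr p * \<theta> ^ (m + 2) + y powr q) * gauss (16 * T) x"
        unfolding q_def using y p b m by (intro mult_right_mono weighted_young_le) auto
      also have "y powr q * gauss (16 * T) x \<le> Y x"
      proof -
        have "y powr q * gauss (16 * T) x = (K / T) powr q * ((1 + (norm x)\<^sup>2 / T) powr q * gauss (16 * T) x)"
          unfolding y_def using K T by (subst powr_mult) auto
        also have "\<dots> \<le> (K / T) powr q * (E * gauss (32 * T) x)"
          unfolding E_def using T q by (intro mult_left_mono scaled_gauss_decay) auto
        finally show ?thesis by (simp add: Y_def mult_ac)
      qed
      then have "(\<bar>r\<bar> powr p * \<theta> ^ (m + 2) + y powr q) * gauss (16 * T) x \<le> \<eta>\<^sub>0 m T t * (\<bar>r\<bar> powr p * gauss (16 * T) x) + Y x"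
        by (simp add: \<eta>0 algebra_simps)
      finally show ?thesis .
    qed
    have Yint: "integrable lborel Y" unfolding Y_def using T by (intro integrable_mult_right integrable_gauss) auto
    have TY: "T * (LINT x|lborel. Y x) = C\<^sub>1 * (T powr (1 - q) * sqrt T ^ n)"
    proof -
      have "T * (LINT x|lborel. Y x) = T * ((K / T) powr q * E * sqrt (64 * pi * T) ^ n)"
        unfolding Y_def n_def using T by (simp add: integral_gauss mult_ac)
      also have "(K / T) powr q = K powr q * T powr (- q)"
        using K T by (subst powr_divide) (auto simp: powr_minus divide_inverse)
      also have "sqrt (64 * pi * T) ^ n = sqrt (64 * pi) ^ n * sqrt T ^ n" by (simp only: real_sqrt_mult power_mult_distrib)
      also have "T * (K powr q * T powr (- q) * E * (sqrt (64 * pi) ^ n * sqrt T ^ n)) = C\<^sub>1 * ((T powr 1 * T powr (- q)) * sqrt T ^ n)"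
        using T by (simp add: C\<^sub>1_def mult_ac)
      also have "T powr 1 * T powr (- q) = T powr (1 - q)" unfolding powr_add[symmetric] by simp
      finally show ?thesis .
    qed
    have int: "integrable lborel (\<lambda>x. (\<sigma> * (u\<^sub>0 x + u\<^sub>1 x)) * gauss (16 * T) x)"
    proof -
      have "integrable lborel (\<lambda>x. \<sigma> * (u\<^sub>0 x * gauss (16 * T) x + u\<^sub>1 x * gauss (16 * T) x))"
        using gr T by (intro integrable_mult_right Bochner_Integration.integrable_add slowly_growing_integrable_gauss) auto
      then show ?thesis by (simp add: algebra_simps)
    qed
    have "\<epsilon> * (c * (T powr (- lam / 2) * sqrt T ^ n)) \<le> \<epsilon> * (LINT x|lborel. (\<sigma> * (u\<^sub>0 x + u\<^sub>1 x)) * gauss (16 * T) x)"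
      using data_lower_bound[OF T(1) lam int pos] \<epsilon> by (intro mult_left_mono) (auto simp: c_def n_def)
    also have "\<dots> = \<sigma> * (LINT x|lborel. (\<epsilon> * u\<^sub>0 x + \<epsilon> * u\<^sub>1 x) * gauss (16 * T) x)"
      unfolding integral_mult_right_zero[symmetric] by (simp add: algebra_simps)
    also have "\<dots> \<le> T * (LINT x|lborel. Y x)"
      by (rule sol.tested_inequality[OF Yint test])
    also have "\<dots> = C\<^sub>1 * (T powr (1 - q) * sqrt T ^ n)" by (rule TY)
    finally have "(\<epsilon> * c * T powr (- lam / 2)) * sqrt T ^ n \<le> (C\<^sub>1 * T powr (1 - q)) * sqrt T ^ n" by (simp add: mult_ac)
    then have "\<epsilon> * c * T powr (- lam / 2) \<le> C\<^sub>1 * T powr (1 - q)" using T by simp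
    then have "(\<epsilon> * c * T powr (- lam / 2)) * T powr (q - 1) \<le> (C\<^sub>1 * T powr (1 - q)) * T powr (q - 1)"
      by (rule mult_right_mono) simp
    then have "\<epsilon> * c * (T powr (- lam / 2) * T powr (q - 1)) \<le> C\<^sub>1 * (T powr (1 - q) * T powr (q - 1))"
      by (simp only: mult.assoc)
    moreover have "T powr (1 - q) * T powr (q - 1) = 1" unfolding powr_add[symmetric] using T by simp
    \<comment> \<open>Since q - 1 = 1/(p-1), the exponents add up to \<kappa>; this is where the
      relation between lifespan and decay rate of the data arises.\<close>
    moreover have "T powr (- lam / 2) * T powr (q - 1) = T powr \<kappa>"
    proof -
      have "- lam / 2 + (q - 1) = \<kappa>" using p by (simp add: q_def \<kappa>_def field_simps)
      then show ?thesis unfolding powr_add[symmetric] by simp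
    qed
    ultimately have "\<epsilon> * c * T powr \<kappa> \<le> C\<^sub>1" by simp
    then have "T powr \<kappa> \<le> C\<^sub>1 / c * (1 / \<epsilon>)" using \<epsilon> c by (simp add: field_simps)
    then have "(T powr \<kappa>) powr (1 / \<kappa>) \<le> (C\<^sub>1 / c * (1 / \<epsilon>)) powr (1 / \<kappa>)"
      using \<kappa> by (intro powr_mono2) auto
    moreover have "(T powr \<kappa>) powr (1 / \<kappa>) = T" using T \<kappa> by (simp add: powr_powr)
    moreover have "(C\<^sub>1 / c * (1 / \<epsilon>)) powr (1 / \<kappa>) = C * \<epsilon> powr (- 1 / \<kappa>)"
    proof -
      have "(1 / \<epsilon>) powr (1 / \<kappa>) = \<epsilon> powr (- 1 / \<kappa>)" using \<epsilon> by (subst powr_divide) (auto simp: powr_minus_divide)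
      then show ?thesis unfolding C_def using C\<^sub>1 c \<epsilon> by (subst powr_mult) auto
    qed
    ultimately show ?thesis by simp
  qed
  moreover have "C > 0" using C\<^sub>1 c by (simp add: C_def)
  ultimately show ?thesis by blast
qed

theorem theorem1p5:
  fixes n p\<^sub>0 :: nat and p r s \<alpha> lam \<kappa> \<sigma> :: real and N :: "real \<Rightarrow> real"
  assumes n: "n = CARD('n::finite)"
    and p: "p > 1"
    and sign: "\<sigma> = 1 \<or> \<sigma> = -1"
    and N: "N = (\<lambda>u. \<sigma> * \<bar>u\<bar> powr p)"
    and p0: "real p\<^sub>0 \<le> p"
    and adm: "admissible_nonlinearity p p\<^sub>0 N"
    and s: "0 \<le> s" "0 \<le> \<lfloor>s\<rfloor>" "\<lfloor>s\<rfloor> \<le> int p\<^sub>0" "n = 1 \<Longrightarrow> s < 1"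
    and r: "1 \<le> r" "r \<le> 2"
    and case1: "real n \<le> 2 * s \<Longrightarrow> min (1 + r / 2) (1 + r / real n) \<le> p"
    and case2: "2 * s < real n \<Longrightarrow> n \<ge> 2 \<Longrightarrow>
      1 + r / real n \<le> p \<and>
      p \<le> min (1 + 2 / (real n - 2 * s)) (2 * real n / (r * (real n - 2 * s)))"
    and case3: "2 * s < real n \<Longrightarrow> n = 1 \<Longrightarrow> 1 + r / 2 \<le> p \<and> p \<le> 1 / (1 - 2 * s)"
    and subcrit: "p < 1 + 2 * r / real n"
    and \<alpha>: "real n * (1 / r - 1 / 2) < \<alpha>" "\<alpha> < 2 / (p - 1) - real n / 2"
    and lam: "real n / 2 + \<alpha> < lam" "lam < 2 / (p - 1)"
    and \<kappa>: "\<kappa> = 1 / (p - 1) - lam / 2"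
  shows "\<exists>\<epsilon>\<^sub>2>0. \<forall>u\<^sub>0 u\<^sub>1 :: real ^ 'n \<Rightarrow> real.
      u\<^sub>0 \<in> sobolev s 0 \<inter> sobolev 0 \<alpha> \<and>
      u\<^sub>1 \<in> sobolev (s - 1) 0 \<inter> sobolev 0 \<alpha> \<and>
      (AE x in lborel. \<sigma> * (u\<^sub>0 x + u\<^sub>1 x) \<ge> (if norm x > 1 then norm x powr (- lam) else 0)) \<longrightarrow>
      (\<exists>C>0. \<forall>\<epsilon>. 0 < \<epsilon> \<and> \<epsilon> \<le> \<epsilon>\<^sub>2 \<longrightarrow>
        lifespan N s \<alpha> (\<lambda>x. \<epsilon> * u\<^sub>0 x) (\<lambda>x. \<epsilon> * u\<^sub>1 x) \<le> ennreal (C * \<epsilon> powr (- 1 / \<kappa>)))"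
proof -
  \<comment> \<open>From r \<le> 2 it follows that \<alpha> is positive, and with it lam; positive
    lam makes the data bound decreasing in |x|.\<close>
  have "0 \<le> real n * (1 / r - 1 / 2)" using r by (intro mult_nonneg_nonneg) (auto simp: field_simps)
  then have lam0: "lam > 0" using \<alpha> lam by (smt (verit) divide_nonneg_nonneg of_nat_0_le_iff)
  have \<kappa>0: "\<kappa> > 0" using lam(2) by (simp add: \<kappa>)
  obtain C where C: "C > 0" and bound: "\<And>\<epsilon> \<sigma> T T' u u\<^sub>0 (u\<^sub>1 :: real ^ 'n \<Rightarrow> real).
    0 < \<epsilon> \<Longrightarrow> 1 \<le> T \<Longrightarrow> T < T' \<Longrightarrow> \<sigma> = 1 \<or> \<sigma> = -1 \<Longrightarrow> slowly_growing u\<^sub>0 \<Longrightarrow> slowly_growing u\<^sub>1 \<Longrightarrow>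
    AE x in lborel. \<sigma> * (u\<^sub>0 x + u\<^sub>1 x) \<ge> (if norm x > 1 then norm x powr (- lam) else 0) \<Longrightarrow>
    mild_solution_Linf (\<lambda>r. \<sigma> * \<bar>r\<bar> powr p) (\<lambda>x. \<epsilon> * u\<^sub>0 x) (\<lambda>x. \<epsilon> * u\<^sub>1 x) T' u \<Longrightarrow>
    T \<le> C * \<epsilon> powr (- 1 / \<kappa>)"
    using existence_time_bound[OF p lam0 \<kappa>0[unfolded \<kappa>], where 'a = "real ^ 'n"] unfolding \<kappa>[symmetric] by blast
  show ?thesis
  \<comment> \<open>With 1 as the upper limit for \<epsilon>, the power \<epsilon>^(-1/\<kappa>) is
    at least 1. Times below 1, to which \<open>existence_time_bound\<close> does not apply, are then
    covered by \<open>max C 1\<close>.\<close>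
  proof (rule exI[of _ 1], intro conjI allI impI)
    fix u\<^sub>0 u\<^sub>1 :: "real ^ 'n \<Rightarrow> real"
    assume *: "u\<^sub>0 \<in> sobolev s 0 \<inter> sobolev 0 \<alpha> \<and> u\<^sub>1 \<in> sobolev (s - 1) 0 \<inter> sobolev 0 \<alpha> \<and>
      (AE x in lborel. \<sigma> * (u\<^sub>0 x + u\<^sub>1 x) \<ge> (if norm x > 1 then norm x powr (- lam) else 0))"
    then have gr: "slowly_growing u\<^sub>0" "slowly_growing u\<^sub>1" by (auto simp: sobolev_def)
    show "\<exists>C>0. \<forall>\<epsilon>. 0 < \<epsilon> \<and> \<epsilon> \<le> 1 \<longrightarrow>
        lifespan N s \<alpha> (\<lambda>x. \<epsilon> * u\<^sub>0 x) (\<lambda>x. \<epsilon> * u\<^sub>1 x) \<le> ennreal (C * \<epsilon> powr (- 1 / \<kappa>))"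
    proof (rule exI[of _ "max C 1"], intro conjI allI impI)
      fix \<epsilon> :: real assume \<epsilon>: "0 < \<epsilon> \<and> \<epsilon> \<le> 1"
      have e1: "1 \<le> \<epsilon> powr (- 1 / \<kappa>)"
        using \<epsilon> \<kappa>0 powr_mono2'[of "- 1 / \<kappa>" \<epsilon> 1] by simp
      have ge1: "1 \<le> max C 1 * \<epsilon> powr (- 1 / \<kappa>)"
        using mult_mono[of 1 "max C 1" 1 "\<epsilon> powr (- 1 / \<kappa>)"] e1 by simp
      show "lifespan N s \<alpha> (\<lambda>x. \<epsilon> * u\<^sub>0 x) (\<lambda>x. \<epsilon> * u\<^sub>1 x) \<le> ennreal (max C 1 * \<epsilon> powr (- 1 / \<kappa>))"
        unfolding lifespan_def
      proof (intro SUP_least ennreal_leI)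
        fix T assume "T \<in> {T. 0 < T \<and> (\<exists>u. mild_solution N s \<alpha> (\<lambda>x. \<epsilon> * u\<^sub>0 x) (\<lambda>x. \<epsilon> * u\<^sub>1 x) T u)}"
        then obtain u where u: "\<And>T'. 0 < T' \<Longrightarrow> T' < T \<Longrightarrow> mild_solution_Linf N (\<lambda>x. \<epsilon> * u\<^sub>0 x) (\<lambda>x. \<epsilon> * u\<^sub>1 x) T' u"
          unfolding mild_solution_def by blast
        show "T \<le> max C 1 * \<epsilon> powr (- 1 / \<kappa>)"
        \<comment> \<open>A solution on [0, T) satisfies the integral equation only on (0, T') with
          T' < T, and the bound applies to times strictly below T'. Hence T is approached from
          below.\<close>
        proof (rule dense_le)
          fix T\<^sub>1 assume "T\<^sub>1 < T"
          show "T\<^sub>1 \<le> max C 1 * \<epsilon> powr (- 1 / \<kappa>)"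
          proof (cases "1 \<le> T\<^sub>1")
            case True
            obtain T' where T': "T\<^sub>1 < T'" "T' < T" using dense[OF \<open>T\<^sub>1 < T\<close>] by blast
            have "T\<^sub>1 \<le> C * \<epsilon> powr (- 1 / \<kappa>)"
              by (rule bound[OF _ True T'(1) sign gr _ u[OF _ T'(2), unfolded N]]) (use \<epsilon> True T' * in auto)
            also have "\<dots> \<le> max C 1 * \<epsilon> powr (- 1 / \<kappa>)" by (intro mult_right_mono) auto
            finally show ?thesis .
          qed (use ge1 in simp)
        qed
      qed
    qed simp
  qed simp
qed

end
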